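(* Suppose $X$ is an $E_\infty$-space. Then the homology suspension map $$\sigma:\tilde{H}_*(\Omega X)\longrightarrow\tilde{H}_{*+1}(X)$$ is a map of $(\bigoplus_{k\ge0}H_*(\Sigma_k),\circ)$-modules.
   Context: Fix a prime $p$; $H_*$ denotes homology with $\mathbb{F}_p$-coefficients. Spaces are compactly generated weak Hausdorff. Operads are operads in spaces whose $0$-th space is a point. An $E_\infty$-operad is an operad $\mathcal{C}$ such that for all $n\ge0$ the space $\mathcal{C}(n)$ is contractible, the $\Sigma_n$-action on it is free, and $\mathcal{C}(n)$ is $\Sigma_n$-equivariantly homotopy equivalent to a $\Sigma_n$-CW complex. Fix an $E_\infty$-operad $\mathcal{C}$; an $E_\infty$-space is a $\mathcal{C}$-algebra $X$, with structure maps $\theta:\mathcal{C}(n)\times_{\Sigma_n}X^n\to X$. Its basepoint $x_0=1$ is the image of $\theta:\mathcal{C}(0)\times X^0\to X$. The loop space $\Omega X=\Omega(X,x_0)$ is an $E_\infty$-space under the pointwise action of $\mathcal{C}$. $\bigoplus_{k\ge0}H_*(\Sigma_k)$ is a ring under the product $\circ$ induced by $\Sigma_m\times\Sigma_n\to\Sigma_{mn}$ from the action on $\{1,\dots,m\}\times\{1,\dots,n\}$. For an $E_\infty$-space $Y$, $H_*(Y)$ is a module over this ring through the pairings $\circ:H_*(\Sigma_k)\otimes H_*(Y)\to H_*(Y)$, defined as the cross product into $H_*((\mathcal{C}(k)/\Sigma_k)\times Y)$ followed by the map induced by $([c],y)\mapsto\theta(c;y,\dots,y)$ ($\mathcal{C}(k)/\Sigma_k$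 is a model for $B\Sigma_k$). The reduced homology $\tilde{H}_*(Y)=H_*(Y)/H_*(y_0)$, with $y_0$ the basepoint given by the $E_\infty$-structure, is given the quotient module structure. For a pointed space $Z$, the homology suspension $\sigma:\tilde{H}_*(\Omega Z)\to\tilde{H}_{*+1}(Z)$ is the suspension isomorphism $\tilde{H}_*(\Omega Z)\cong\tilde{H}_{*+1}(\Sigma\Omega Z)$ followed by the map induced by the counit $\Sigma\Omega Z\to Z$, $\alpha\wedge t\mapsto\alpha(t)$, where $\Sigma Y=Y\wedge S^1$ (suspension coordinate on the right). *)

theory Defs
  imports "HOL-Homology.Homology" "HOL-Algebra.Sym_Groups" "HOL-Algebra.Module"
    "HOL-Computational_Algebra.Primes"
begin

section \<open>Compactly generated weak Hausdorff spaces\<close>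

text \<open>
  A space is weak Hausdorff if continuous images of compact Hausdorff spaces \<open>K\<close> are closed.
  Test spaces carried by \<^typ>\<open>'a set set\<close> suffice: choose one preimage in \<open>K\<close> of every point of
  the image; the closure of this set has the same image, and since it is a Hausdorff space with
  a dense subset no larger than \<^typ>\<open>'a\<close>, it embeds as a set into \<^typ>\<open>'a set set\<close>
  (send a point to the family of those subsets of the dense set that have it in their closure).
\<close>

definition weak_Hausdorff :: "'a topology \<Rightarrow> bool" where
  "weak_Hausdorff X \<longleftrightarrow>
     (\<forall>(K :: 'a set set topology) f.
        compact_space K \<and> Hausdorff_space K \<and> continuous_map K X f
        \<longrightarrow> closedin X (f ` topspace K))"

text \<open>
  In a weak Hausdorff space the images of compact Hausdorff test spaces are exactly the compact
  Hausdorff subspaces, so that testing on the latter gives the usual \<open>k\<close>-closed sets.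
  All spaces that are \<open>k\<close>-ified below (products and loop spaces) are weak Hausdorff.
\<close>

definition k_closed :: "'a topology \<Rightarrow> 'a set \<Rightarrow> bool" where
  "k_closed X A \<longleftrightarrow> A \<subseteq> topspace X \<and>
     (\<forall>K. compactin X K \<and> Hausdorff_space (subtopology X K)
        \<longrightarrow> closedin (subtopology X K) (A \<inter> K))"

definition CGWH :: "'a topology \<Rightarrow> bool" where
  "CGWH X \<longleftrightarrow> weak_Hausdorff X \<and> (\<forall>A. k_closed X A \<longrightarrow> closedin X A)"

definition kify :: "'a topology \<Rightarrow> 'a topology" where
  "kify X = topology (\<lambda>U. U \<subseteq> topspace X \<and> k_closed X (topspace X - U))"

lemma k_closed_compl:
  assumes "U \<subseteq> topspace X"
  shows "k_closed X (topspace X - U) \<longleftrightarrow>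
    (\<forall>K. compactin X K \<and> Hausdorff_space (subtopology X K)
        \<longrightarrow> openin (subtopology X K) (U \<inter> K))"
proof -
  have "closedin (subtopology X K) ((topspace X - U) \<inter> K) \<longleftrightarrow> openin (subtopology X K) (U \<inter> K)"
    if "compactin X K" for K
  proof -
    have K: "K \<subseteq> topspace X" using that compactin_subset_topspace by blast
    have "(topspace X - U) \<inter> K = topspace (subtopology X K) - U \<inter> K"
      using K by auto
    then show ?thesis
      using K assms by (auto simp: openin_closedin_eq inf.absorb2)
  qed
  then show ?thesis unfolding k_closed_def by auto
qed

lemma openin_kify:
  "openin (kify X) U \<longleftrightarrow> U \<subseteq> topspace X \<and>
     (\<forall>K. compactin X K \<and> Hausdorff_space (subtopology X K)
        \<longrightarrow> openin (subtopology X K) (U \<inter> K))"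
proof -
  have eq: "(\<lambda>U. U \<subseteq> topspace X \<and> k_closed X (topspace X - U)) =
    (\<lambda>U. U \<subseteq> topspace X \<and>
     (\<forall>K. compactin X K \<and> Hausdorff_space (subtopology X K)
        \<longrightarrow> openin (subtopology X K) (U \<inter> K)))"
    by (intro ext conj_cong refl k_closed_compl)
  have "istopology (\<lambda>U. U \<subseteq> topspace X \<and>
     (\<forall>K. compactin X K \<and> Hausdorff_space (subtopology X K)
        \<longrightarrow> openin (subtopology X K) (U \<inter> K)))"
    unfolding istopology_def
  proof (intro conjI allI impI)
    fix S T
    assume S: "S \<subseteq> topspace X \<and> (\<forall>K. compactin X K \<and> Hausdorff_space (subtopology X K)
                  \<longrightarrow> openin (subtopology X K) (S \<inter> K))"
      and T: "T \<subseteq> topspace X \<and> (\<forall>K. compactin X K \<and> Hausdorff_space (subtopology X K)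
                  \<longrightarrow> openin (subtopology X K) (T \<inter> K))"
    show "S \<inter> T \<subseteq> topspace X" using S by blast
    fix K assume "compactin X K \<and> Hausdorff_space (subtopology X K)"
    then have "openin (subtopology X K) (S \<inter> K)" "openin (subtopology X K) (T \<inter> K)"
      using S T by blast+
    then have "openin (subtopology X K) ((S \<inter> K) \<inter> (T \<inter> K))" by (rule openin_Int)
    moreover have "(S \<inter> K) \<inter> (T \<inter> K) = S \<inter> T \<inter> K" by blast
    ultimately show "openin (subtopology X K) (S \<inter> T \<inter> K)" by (simp only:)
  next
    fix \<K>
    assume *: "\<forall>S\<in>\<K>. S \<subseteq> topspace X \<and> (\<forall>K. compactin X K \<and> Hausdorff_space (subtopology X K)
                  \<longrightarrow> openin (subtopology X K) (S \<inter> K))"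
    show "\<Union> \<K> \<subseteq> topspace X" using * by blast
    fix K assume "compactin X K \<and> Hausdorff_space (subtopology X K)"
    then have "openin (subtopology X K) (\<Union>S\<in>\<K>. S \<inter> K)"
      using * by (intro openin_Union) blast
    moreover have "(\<Union>S\<in>\<K>. S \<inter> K) = \<Union> \<K> \<inter> K" by blast
    ultimately show "openin (subtopology X K) (\<Union> \<K> \<inter> K)" by (simp only:)
  qed
  then show ?thesis unfolding kify_def eq by (simp only: topology_inverse')
qed

lemma topspace_kify [simp]: "topspace (kify X) = topspace X"
proof
  show "topspace (kify X) \<subseteq> topspace X"
    using openin_topspace[of "kify X"] by (simp only: openin_kify)
  have "openin (subtopology X K) (topspace X \<inter> K)" for K
    by (metis openin_topspace topspace_subtopology)
  then have "openin (kify X) (topspace X)" by (simp add: openin_kify)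
  then show "topspace X \<subseteq> topspace (kify X)" by (rule openin_subset)
qed

definition kprod :: "'a topology \<Rightarrow> 'b topology \<Rightarrow> ('a \<times> 'b) topology" where
  "kprod X Y = kify (prod_topology X Y)"

definition quotient_topology :: "'a topology \<Rightarrow> ('a \<Rightarrow> 'b) \<Rightarrow> 'b topology" where
  "quotient_topology X q =
     topology (\<lambda>U. U \<subseteq> q ` topspace X \<and> openin X {x \<in> topspace X. q x \<in> U})"

lemma openin_quotient_topology:
  "openin (quotient_topology X q) U \<longleftrightarrow>
     U \<subseteq> q ` topspace X \<and> openin X {x \<in> topspace X. q x \<in> U}"
proof -
  have "istopology (\<lambda>U. U \<subseteq> q ` topspace X \<and> openin X {x \<in> topspace X. q x \<in> U})"
    unfolding istopology_def
  proof (intro conjI allI impI)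
    fix S T
    assume "S \<subseteq> q ` topspace X \<and> openin X {x \<in> topspace X. q x \<in> S}"
      and "T \<subseteq> q ` topspace X \<and> openin X {x \<in> topspace X. q x \<in> T}"
    moreover have "{x \<in> topspace X. q x \<in> S \<inter> T} =
        {x \<in> topspace X. q x \<in> S} \<inter> {x \<in> topspace X. q x \<in> T}" by auto
    ultimately show "S \<inter> T \<subseteq> q ` topspace X" "openin X {x \<in> topspace X. q x \<in> S \<inter> T}"
      by auto
  next
    fix \<K>
    assume *: "\<forall>K\<in>\<K>. K \<subseteq> q ` topspace X \<and> openin X {x \<in> topspace X. q x \<in> K}"
    have "{x \<in> topspace X. q x \<in> \<Union> \<K>} = (\<Union>K\<in>\<K>. {x \<in> topspace X. q x \<in> K})" by auto
    with * show "\<Union> \<K> \<subseteq> q ` topspace X" "openin X {x \<in> topspace X. q x \<in> \<Union> \<K>}"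
      by auto
  qed
  then show ?thesis by (simp add: quotient_topology_def topology_inverse')
qed


section \<open>Equivariant CW complexes\<close>

definition right_action :: "('g, 'm) monoid_scheme \<Rightarrow> 'a topology \<Rightarrow> ('a \<Rightarrow> 'g \<Rightarrow> 'a) \<Rightarrow> bool" where
  "right_action G X act \<longleftrightarrow>
     (\<forall>g \<in> carrier G. continuous_map X X (\<lambda>x. act x g)) \<and>
     (\<forall>x \<in> topspace X. act x \<one>\<^bsub>G\<^esub> = x) \<and>
     (\<forall>x \<in> topspace X. \<forall>g \<in> carrier G. \<forall>h \<in> carrier G. act (act x g) h = act x (g \<otimes>\<^bsub>G\<^esub> h))"

definition equivariant_on ::
    "('g, 'm) monoid_scheme \<Rightarrow> 'a topology \<Rightarrow> ('a \<Rightarrow> 'g \<Rightarrow> 'a) \<Rightarrow> ('b \<Rightarrow> 'g \<Rightarrow> 'b) \<Rightarrow> ('a \<Rightarrow> 'b) \<Rightarrow> bool" where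
  "equivariant_on G X actX actY f \<longleftrightarrow>
     (\<forall>x \<in> topspace X. \<forall>g \<in> carrier G. f (actX x g) = actY (f x) g)"

definition equivariantly_homotopy_equivalent ::
    "('g, 'm) monoid_scheme \<Rightarrow> 'a topology \<Rightarrow> ('a \<Rightarrow> 'g \<Rightarrow> 'a) \<Rightarrow>
     'b topology \<Rightarrow> ('b \<Rightarrow> 'g \<Rightarrow> 'b) \<Rightarrow> bool" where
  "equivariantly_homotopy_equivalent G X actX Y actY \<longleftrightarrow>
     (\<exists>f g. continuous_map X Y f \<and> equivariant_on G X actX actY f \<and>
            continuous_map Y X g \<and> equivariant_on G Y actY actX g \<and>
            homotopic_with (equivariant_on G X actX actX) X X (g \<circ> f) id \<and>
            homotopic_with (equivariant_on G Y actY actY) Y Y (f \<circ> g) id)"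

definition disc :: "nat \<Rightarrow> (nat \<Rightarrow> real) set" where
  "disc m = {x \<in> topspace (Euclidean_space m). (\<Sum>i<m. (x i)\<^sup>2) \<le> 1}"

definition disc_boundary :: "nat \<Rightarrow> (nat \<Rightarrow> real) set" where
  "disc_boundary m = {x \<in> topspace (Euclidean_space m). (\<Sum>i<m. (x i)\<^sup>2) = 1}"

text \<open>
  CW complexes with a right action of the discrete group \<open>G\<close>.  The set \<open>sk m\<close> is the
  \<open>(m - 1)\<close>-skeleton.  An equivariant \<open>m\<close>-cell, the product of the space of
  cosets \<open>H g\<close> with \<open>D\<^sup>m\<close>, is given by the subgroup \<open>H\<close> and the restriction \<open>\<phi>\<close> of its
  characteristic map \<open>(H g, x) \<mapsto> \<phi>(x) g\<close> to the coset of the unit.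
  The clauses for \<open>m\<close> say that \<open>sk (Suc m)\<close> is the pushout of \<open>sk m\<close> and these cells along
  their boundaries; the last clause says that the space is the colimit of its skeleta.
\<close>

definition G_CW_complex :: "('g, 'm) monoid_scheme \<Rightarrow> 'a topology \<Rightarrow> ('a \<Rightarrow> 'g \<Rightarrow> 'a) \<Rightarrow> bool" where
  "G_CW_complex G Z act \<longleftrightarrow> right_action G Z act \<and>
     (\<exists>(sk :: nat \<Rightarrow> 'a set) (cells :: nat \<Rightarrow> (((nat \<Rightarrow> real) \<Rightarrow> 'a) \<times> 'g set) set).
        sk 0 = {} \<and>
        (\<forall>m.
          (\<forall>(\<phi>, H) \<in> cells m.
             subgroup H G \<and>
             continuous_map (subtopology (Euclidean_space m) (disc m)) Z \<phi> \<and>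
             (\<forall>x \<in> disc m. \<forall>h \<in> H. act (\<phi> x) h = \<phi> x) \<and>
             \<phi> ` disc_boundary m \<subseteq> sk m \<and>
             (\<forall>x \<in> disc m - disc_boundary m. \<forall>g \<in> carrier G. act (\<phi> x) g \<notin> sk m)) \<and>
          (\<forall>(\<phi>, H) \<in> cells m. \<forall>(\<psi>, K) \<in> cells m.
             \<forall>x \<in> disc m - disc_boundary m. \<forall>y \<in> disc m - disc_boundary m.
             \<forall>g \<in> carrier G. \<forall>h \<in> carrier G.
               act (\<phi> x) g = act (\<psi> y) h \<longrightarrow>
               (\<phi>, H) = (\<psi>, K) \<and> x = y \<and> H #>\<^bsub>G\<^esub> g = H #>\<^bsub>G\<^esub> h) \<and>
          sk (Suc m) = sk m \<union> {act (\<phi> x) g |\<phi> H x g. (\<phi>, H) \<in> cells m \<and> x \<in> disc m \<and> g \<in> carrier G} \<and>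
          (\<forall>A \<subseteq> sk (Suc m).
             closedin (subtopology Z (sk (Suc m))) A \<longleftrightarrow>
             closedin (subtopology Z (sk m)) (A \<inter> sk m) \<and>
             (\<forall>(\<phi>, H) \<in> cells m. \<forall>g \<in> carrier G.
                closedin (subtopology (Euclidean_space m) (disc m)) {x \<in> disc m. act (\<phi> x) g \<in> A}))) \<and>
        topspace Z = (\<Union>m. sk m) \<and>
        (\<forall>A \<subseteq> topspace Z. closedin Z A \<longleftrightarrow> (\<forall>m. closedin (subtopology Z (sk m)) (A \<inter> sk m))))"


section \<open>Operads and their algebras\<close>

text \<open>
  Tuples are extensional functions on \<open>{1..k}\<close>.  The structure map
  \<open>C(k) \<times> C(j 1) \<times> \<dots> \<times> C(j k) \<rightarrow> C(j 1 + \<dots> + j k)\<close> is \<open>(c, d) \<mapsto> opcomp C k j c d\<close>,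
  and \<open>opact C n c \<sigma>\<close> is the right action of \<open>\<sigma>\<close> on \<open>c\<close> in \<open>C(n)\<close>.
\<close>

record 'c operad =
  opspace :: "nat \<Rightarrow> 'c topology"
  opact :: "nat \<Rightarrow> 'c \<Rightarrow> (nat \<Rightarrow> nat) \<Rightarrow> 'c"
  opunit :: 'c
  opcomp :: "nat \<Rightarrow> (nat \<Rightarrow> nat) \<Rightarrow> 'c \<Rightarrow> (nat \<Rightarrow> 'c) \<Rightarrow> 'c"

text \<open>The \<open>r\<close>-th place of the \<open>s\<close>-th of consecutive blocks of lengths \<open>j 1, j 2, \<dots>\<close>.\<close>

definition block_pos :: "(nat \<Rightarrow> nat) \<Rightarrow> nat \<Rightarrow> nat \<Rightarrow> nat" where
  "block_pos j s r = (\<Sum>i = 1..<s. j i) + r"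

text \<open>\<open>\<sigma>(j 1, \<dots>, j k)\<close>, permuting \<open>k\<close> blocks of lengths \<open>j 1, \<dots>, j k\<close> as \<open>\<sigma>\<close> permutes \<open>k\<close> letters,
  and the block sum \<open>\<tau> 1 \<oplus> \<dots> \<oplus> \<tau> k\<close>.\<close>

definition block_perm :: "nat \<Rightarrow> (nat \<Rightarrow> nat) \<Rightarrow> (nat \<Rightarrow> nat) \<Rightarrow> nat \<Rightarrow> nat" where
  "block_perm k j \<sigma> a =
     (if a \<in> {1..(\<Sum>s = 1..k. j s)}
      then THE b. \<exists>s \<in> {1..k}. \<exists>r \<in> {1..j s}.
             a = block_pos j s r \<and> b = block_pos (j \<circ> inv_into UNIV \<sigma>) (\<sigma> s) r
      else a)"

definition block_sum :: "nat \<Rightarrow> (nat \<Rightarrow> nat) \<Rightarrow> (nat \<Rightarrow> nat \<Rightarrow> nat) \<Rightarrow> nat \<Rightarrow> nat" where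
  "block_sum k j \<tau> a =
     (if a \<in> {1..(\<Sum>s = 1..k. j s)}
      then THE b. \<exists>s \<in> {1..k}. \<exists>r \<in> {1..j s}. a = block_pos j s r \<and> b = block_pos j s (\<tau> s r)
      else a)"

abbreviation op_tuples :: "'c operad \<Rightarrow> nat \<Rightarrow> (nat \<Rightarrow> nat) \<Rightarrow> (nat \<Rightarrow> 'c) topology" where
  "op_tuples C k j \<equiv> product_topology (\<lambda>s. opspace C (j s)) {1..k}"

definition is_operad :: "'c operad \<Rightarrow> bool" where
  "is_operad C \<longleftrightarrow>
     (\<forall>n. CGWH (opspace C n)) \<and>
     (\<exists>c. topspace (opspace C 0) = {c}) \<and>
     (\<forall>n. right_action (sym_group n) (opspace C n) (opact C n)) \<and>
     opunit C \<in> topspace (opspace C 1) \<and>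
     (\<forall>k. \<forall>j \<in> extensional {1..k}.
        continuous_map (kprod (opspace C k) (op_tuples C k j)) (opspace C (\<Sum>s = 1..k. j s))
          (\<lambda>(c, d). opcomp C k j c d)) \<and>
     (\<forall>k. \<forall>j \<in> extensional {1..k}. \<forall>l \<in> extensional {1..(\<Sum>s = 1..k. j s)}.
        \<forall>c \<in> topspace (opspace C k). \<forall>d \<in> topspace (op_tuples C k j).
        \<forall>e \<in> topspace (op_tuples C (\<Sum>s = 1..k. j s) l).
          opcomp C (\<Sum>s = 1..k. j s) l (opcomp C k j c d) e =
          opcomp C k (\<lambda>s\<in>{1..k}. \<Sum>r = 1..j s. l (block_pos j s r)) c
            (\<lambda>s\<in>{1..k}. opcomp C (j s) (\<lambda>r\<in>{1..j s}. l (block_pos j s r)) (d s)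
                          (\<lambda>r\<in>{1..j s}. e (block_pos j s r)))) \<and>
     (\<forall>n. \<forall>d \<in> topspace (opspace C n).
        opcomp C 1 (\<lambda>s\<in>{1..1}. n) (opunit C) (\<lambda>s\<in>{1..1}. d) = d) \<and>
     (\<forall>k. \<forall>c \<in> topspace (opspace C k).
        opcomp C k (\<lambda>s\<in>{1..k}. 1) c (\<lambda>s\<in>{1..k}. opunit C) = c) \<and>
     (\<forall>k. \<forall>j \<in> extensional {1..k}. \<forall>c \<in> topspace (opspace C k). \<forall>d \<in> topspace (op_tuples C k j).
        (\<forall>\<sigma> \<in> carrier (sym_group k).
           opcomp C k j (opact C k c \<sigma>) d =
           opact C (\<Sum>s = 1..k. j s)
             (opcomp C k (j \<circ> inv_into UNIV \<sigma>) c (d \<circ> inv_into UNIV \<sigma>)) (block_perm k j \<sigma>)) \<and>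
        (\<forall>\<tau>. (\<forall>s \<in> {1..k}. \<tau> s \<in> carrier (sym_group (j s))) \<longrightarrow>
           opcomp C k j c (\<lambda>s\<in>{1..k}. opact C (j s) (d s) (\<tau> s)) =
           opact C (\<Sum>s = 1..k. j s) (opcomp C k j c d) (block_sum k j \<tau>)))"

text \<open>
  HOL cannot quantify existentially over the carrier types of the CW complexes, so the type
  \<open>'z\<close> that carries them is a parameter.  In a theorem that assumes
  \<open>E_infinity_operad TYPE('z) C\<close> for a type variable \<open>'z\<close> not occurring elsewhere, the
  complexes are arbitrary.
\<close>

definition E_infinity_operad :: "'z itself \<Rightarrow> 'c operad \<Rightarrow> bool" where
  "E_infinity_operad TYPE('z) C \<longleftrightarrow> is_operad C \<and>
     (\<forall>n. topspace (opspace C n) \<noteq> {} \<and> contractible_space (opspace C n) \<and>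
        (\<forall>c \<in> topspace (opspace C n). \<forall>\<sigma> \<in> carrier (sym_group n). opact C n c \<sigma> = c \<longrightarrow> \<sigma> = id) \<and>
        (\<exists>(Z :: 'z topology) act. G_CW_complex (sym_group n) Z act \<and>
           equivariantly_homotopy_equivalent (sym_group n) (opspace C n) (opact C n) Z act))"

abbreviation tuples :: "'x topology \<Rightarrow> nat \<Rightarrow> (nat \<Rightarrow> 'x) topology" where
  "tuples X n \<equiv> product_topology (\<lambda>_. X) {1..n}"

text \<open>The left action of \<open>\<Sigma>\<^sub>n\<close> on \<open>X\<^sup>n\<close> is \<open>(\<sigma> x) i = x (\<sigma>\<^sup>-\<^sup>1 i)\<close>, so that \<open>\<theta>\<close> factors over
  \<open>C(n) \<times>\<^sub>\<Sigma> X\<^sup>n\<close> if and only if \<open>\<theta>(c \<sigma>; x) = \<theta>(c; \<sigma> x)\<close>.\<close>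

definition operad_algebra :: "'c operad \<Rightarrow> 'x topology \<Rightarrow> (nat \<Rightarrow> 'c \<Rightarrow> (nat \<Rightarrow> 'x) \<Rightarrow> 'x) \<Rightarrow> bool" where
  "operad_algebra C X \<theta> \<longleftrightarrow>
     CGWH X \<and>
     (\<forall>n. continuous_map (kprod (opspace C n) (tuples X n)) X (\<lambda>(c, x). \<theta> n c x)) \<and>
     (\<forall>k. \<forall>j \<in> extensional {1..k}. \<forall>c \<in> topspace (opspace C k). \<forall>d \<in> topspace (op_tuples C k j).
        \<forall>x \<in> topspace (tuples X (\<Sum>s = 1..k. j s)).
          \<theta> (\<Sum>s = 1..k. j s) (opcomp C k j c d) x =
          \<theta> k c (\<lambda>s\<in>{1..k}. \<theta> (j s) (d s) (\<lambda>r\<in>{1..j s}. x (block_pos j s r)))) \<and>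
     (\<forall>x \<in> topspace X. \<theta> 1 (opunit C) (\<lambda>i\<in>{1..1}. x) = x) \<and>
     (\<forall>n. \<forall>c \<in> topspace (opspace C n). \<forall>\<sigma> \<in> carrier (sym_group n). \<forall>x \<in> topspace (tuples X n).
        \<theta> n (opact C n c \<sigma>) x = \<theta> n c (x \<circ> inv_into UNIV \<sigma>))"

definition algebra_basepoint :: "'c operad \<Rightarrow> (nat \<Rightarrow> 'c \<Rightarrow> (nat \<Rightarrow> 'x) \<Rightarrow> 'x) \<Rightarrow> 'x" where
  "algebra_basepoint C \<theta> = \<theta> 0 (THE c. c \<in> topspace (opspace C 0)) (\<lambda>i\<in>{}. undefined)"

definition orbit :: "'c operad \<Rightarrow> nat \<Rightarrow> 'c \<Rightarrow> 'c set" where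
  "orbit C k c = opact C k c ` carrier (sym_group k)"

definition orbit_space :: "'c operad \<Rightarrow> nat \<Rightarrow> 'c set topology" where
  "orbit_space C k = quotient_topology (opspace C k) (orbit C k)"


section \<open>Loop spaces and suspensions\<close>

abbreviation circle :: "complex topology" where
  "circle \<equiv> top_of_set (sphere 0 1)"

definition loops :: "'a topology \<Rightarrow> 'a \<Rightarrow> (complex \<Rightarrow> 'a) set" where
  "loops Z z0 = {\<alpha> \<in> extensional (sphere 0 1). continuous_map circle Z \<alpha> \<and> \<alpha> 1 = z0}"

text \<open>The \<open>k\<close>-ification of the compact-open topology.\<close>

definition loop_space :: "'a topology \<Rightarrow> 'a \<Rightarrow> (complex \<Rightarrow> 'a) topology" where
  "loop_space Z z0 = kify (topology_generated_by
     {{\<alpha> \<in> loops Z z0. \<alpha> ` K \<subseteq> U} |K U. compactin circle K \<and> openin Z U})"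

definition const_loop :: "'a \<Rightarrow> complex \<Rightarrow> 'a" where
  "const_loop z0 = (\<lambda>t\<in>sphere 0 1. z0)"

definition loop_action ::
    "(nat \<Rightarrow> 'c \<Rightarrow> (nat \<Rightarrow> 'x) \<Rightarrow> 'x) \<Rightarrow> nat \<Rightarrow> 'c \<Rightarrow> (nat \<Rightarrow> complex \<Rightarrow> 'x) \<Rightarrow> complex \<Rightarrow> 'x" where
  "loop_action \<theta> n c \<alpha> = (\<lambda>t\<in>sphere 0 1. \<theta> n c (\<lambda>i\<in>{1..n}. \<alpha> i t))"

text \<open>Points of \<open>Y \<and> S\<^sup>1\<close> are the equivalence classes in \<open>Y \<times> S\<^sup>1\<close>.\<close>

definition smash_point :: "'a topology \<Rightarrow> 'a \<Rightarrow> 'a \<times> complex \<Rightarrow> ('a \<times> complex) set" where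
  "smash_point Y y0 = (\<lambda>(y, t).
     if y = y0 \<or> t = 1 then {y0} \<times> sphere 0 1 \<union> topspace Y \<times> {1} else {(y, t)})"

definition suspension :: "'a topology \<Rightarrow> 'a \<Rightarrow> ('a \<times> complex) set topology" where
  "suspension Y y0 = quotient_topology (kprod Y circle) (smash_point Y y0)"

definition suspension_basepoint :: "'a topology \<Rightarrow> 'a \<Rightarrow> ('a \<times> complex) set" where
  "suspension_basepoint Y y0 = smash_point Y y0 (y0, 1)"

definition loop_counit :: "((complex \<Rightarrow> 'a) \<times> complex) set \<Rightarrow> 'a" where
  "loop_counit Q = (case (SOME q. q \<in> Q) of (\<alpha>, t) \<Rightarrow> \<alpha> t)"


section \<open>Homology with coefficients in the prime field\<close>

text \<open>
  Homology of the chain complex \<open>S / p S\<close>, where \<open>S\<close> is the integral singular chain complex: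
  classes are represented by integral chains that are cycles modulo \<open>p\<close>.
\<close>

definition cycles_mod :: "nat \<Rightarrow> nat \<Rightarrow> 'a topology \<Rightarrow> 'a chain set" where
  "cycles_mod p n X = {c. singular_chain n X c \<and>
     (\<exists>d. singular_chain (n - 1) X d \<and> chain_boundary n c = frag_cmul (int p) d)}"

definition boundaries_mod :: "nat \<Rightarrow> nat \<Rightarrow> 'a topology \<Rightarrow> 'a chain set" where
  "boundaries_mod p n X = {chain_boundary (Suc n) e + frag_cmul (int p) d |e d.
     singular_chain (Suc n) X e \<and> singular_chain n X d}"

definition cycle_group_mod :: "nat \<Rightarrow> nat \<Rightarrow> 'a topology \<Rightarrow> 'a chain monoid" where
  "cycle_group_mod p n X = subgroup_generated (chain_group n X) (cycles_mod p n X)"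

definition homology_mod :: "nat \<Rightarrow> nat \<Rightarrow> 'a topology \<Rightarrow> 'a chain set monoid" where
  "homology_mod p n X = cycle_group_mod p n X Mod boundaries_mod p n X"

definition hom_class :: "nat \<Rightarrow> nat \<Rightarrow> 'a topology \<Rightarrow> 'a chain \<Rightarrow> 'a chain set" where
  "hom_class p n X c = boundaries_mod p n X #>\<^bsub>cycle_group_mod p n X\<^esub> c"

text \<open>In \<open>hom_map p n Y f\<close> the space \<open>Y\<close> is the codomain of \<open>f\<close>.\<close>

definition hom_map :: "nat \<Rightarrow> nat \<Rightarrow> 'b topology \<Rightarrow> ('a \<Rightarrow> 'b) \<Rightarrow> 'a chain set \<Rightarrow> 'b chain set" where
  "hom_map p n Y f A = hom_class p n Y (chain_map n f (SOME c. c \<in> A))"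

definition basepoint_homology :: "nat \<Rightarrow> nat \<Rightarrow> 'a topology \<Rightarrow> 'a \<Rightarrow> 'a chain set set" where
  "basepoint_homology p n Y y0 =
     hom_map p n Y id ` carrier (homology_mod p n (subtopology Y {y0}))"

definition red_homology :: "nat \<Rightarrow> nat \<Rightarrow> 'a topology \<Rightarrow> 'a \<Rightarrow> 'a chain set set monoid" where
  "red_homology p n Y y0 = homology_mod p n Y Mod basepoint_homology p n Y y0"

definition red_class :: "nat \<Rightarrow> nat \<Rightarrow> 'a topology \<Rightarrow> 'a \<Rightarrow> 'a chain set \<Rightarrow> 'a chain set set" where
  "red_class p n Y y0 A = basepoint_homology p n Y y0 #>\<^bsub>homology_mod p n Y\<^esub> A"

definition red_map ::
    "nat \<Rightarrow> nat \<Rightarrow> 'b topology \<Rightarrow> 'b \<Rightarrow> ('a \<Rightarrow> 'b) \<Rightarrow> 'a chain set set \<Rightarrow> 'b chain set set" where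
  "red_map p n Y y0 f B = red_class p n Y y0 (hom_map p n Y f (SOME A. A \<in> B))"


section \<open>Cross products\<close>

text \<open>
  The Eilenberg--MacLane shuffle map.  A set \<open>S \<subseteq> {..<m + n}\<close> with \<open>m\<close> elements stands for the
  \<open>(m, n)\<close>-shuffle, i.e. the monotone lattice path from \<open>(0, 0)\<close> to \<open>(m, n)\<close>, whose \<open>i\<close>-th step
  advances the first coordinate if \<open>i \<in> S\<close> and the second coordinate otherwise.
\<close>

definition vertex_map :: "nat \<Rightarrow> (nat \<Rightarrow> nat) \<Rightarrow> (nat \<Rightarrow> real) \<Rightarrow> nat \<Rightarrow> real" where
  "vertex_map N \<mu> x = (\<lambda>i. \<Sum>j \<in> {j. j \<le> N \<and> \<mu> j = i}. x j)"

definition shuffle_simplex ::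
    "nat \<Rightarrow> nat set \<Rightarrow> ((nat \<Rightarrow> real) \<Rightarrow> 'a) \<Rightarrow> ((nat \<Rightarrow> real) \<Rightarrow> 'b) \<Rightarrow> (nat \<Rightarrow> real) \<Rightarrow> 'a \<times> 'b" where
  "shuffle_simplex N S f g = (\<lambda>x\<in>standard_simplex N.
     (f (vertex_map N (\<lambda>j. card ({..<j} \<inter> S)) x), g (vertex_map N (\<lambda>j. card ({..<j} - S)) x)))"

definition shuffle_sign :: "nat \<Rightarrow> nat set \<Rightarrow> int" where
  "shuffle_sign N S = (-1) ^ card {(i, j). i < j \<and> j < N \<and> i \<notin> S \<and> j \<in> S}"

definition simplex_cross ::
    "nat \<Rightarrow> nat \<Rightarrow> ((nat \<Rightarrow> real) \<Rightarrow> 'a) \<Rightarrow> ((nat \<Rightarrow> real) \<Rightarrow> 'b) \<Rightarrow> ('a \<times> 'b) chain" where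
  "simplex_cross m n f g = (\<Sum>S \<in> {S. S \<subseteq> {..<m + n} \<and> card S = m}.
     frag_cmul (shuffle_sign (m + n) S) (frag_of (shuffle_simplex (m + n) S f g)))"

definition chain_cross :: "nat \<Rightarrow> nat \<Rightarrow> 'a chain \<Rightarrow> 'b chain \<Rightarrow> ('a \<times> 'b) chain" where
  "chain_cross m n a b = frag_extend (\<lambda>f. frag_extend (\<lambda>g. simplex_cross m n f g) b) a"

definition hom_cross ::
    "nat \<Rightarrow> nat \<Rightarrow> nat \<Rightarrow> 'a topology \<Rightarrow> 'b topology \<Rightarrow> 'a chain set \<Rightarrow> 'b chain set \<Rightarrow> ('a \<times> 'b) chain set" where
  "hom_cross p m n X Y A B =
     hom_class p (m + n) (kprod X Y) (chain_cross m n (SOME a. a \<in> A) (SOME b. b \<in> B))"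


section \<open>The homology suspension\<close>

definition circle_class :: "nat \<Rightarrow> complex chain set" where
  "circle_class p = hom_class p 1 circle (frag_of (\<lambda>x\<in>standard_simplex 1. cis (2 * pi * x 1)))"

text \<open>
  The suspension isomorphism is the cross product with the fundamental class of the circle,
  pushed forward to the smash product; the circle factor stands on the right, so that no sign
  appears when classes act from the left.  The map is defined for every pointed space (and is
  bijective if the basepoint is nondegenerate).
\<close>

definition suspension_iso :: "nat \<Rightarrow> nat \<Rightarrow> 'a topology \<Rightarrow> 'a \<Rightarrow> 'a chain set set \<Rightarrow> ('a \<times> complex) set chain set set" where
  "suspension_iso p n Y y0 B =
     red_class p (n + 1) (suspension Y y0) (suspension_basepoint Y y0)
       (hom_map p (n + 1) (suspension Y y0) (smash_point Y y0)
         (hom_cross p n 1 Y circle (SOME A. A \<in> B) (circle_class p)))"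

definition hom_suspension ::
    "nat \<Rightarrow> nat \<Rightarrow> 'a topology \<Rightarrow> 'a \<Rightarrow> (complex \<Rightarrow> 'a) chain set set \<Rightarrow> 'a chain set set" where
  "hom_suspension p n Z z0 B =
     red_map p (n + 1) Z z0 loop_counit (suspension_iso p n (loop_space Z z0) (const_loop z0) B)"

text \<open>On the direct sum over all degrees, raising degrees by one.\<close>

definition total_hom_suspension ::
    "nat \<Rightarrow> 'a topology \<Rightarrow> 'a \<Rightarrow> (nat \<Rightarrow> (complex \<Rightarrow> 'a) chain set set) \<Rightarrow> nat \<Rightarrow> 'a chain set set" where
  "total_hom_suspension p Z z0 x = (\<lambda>N. case N of
       0 \<Rightarrow> \<one>\<^bsub>red_homology p 0 Z z0\<^esub>
     | Suc n \<Rightarrow> hom_suspension p n Z z0 (x n))"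


section \<open>The ring of the homology of the symmetric groups\<close>

text \<open>
  \<open>\<sigma> \<times> \<tau>\<close> acting on \<open>{1..m} \<times> {1..n}\<close>, identified lexicographically with \<open>{1..m * n}\<close>.
\<close>

definition prod_perm :: "nat \<Rightarrow> nat \<Rightarrow> (nat \<Rightarrow> nat) \<Rightarrow> (nat \<Rightarrow> nat) \<Rightarrow> nat \<Rightarrow> nat" where
  "prod_perm m n \<sigma> \<tau> a =
     (if a \<in> {1..m * n}
      then (\<sigma> ((a - 1) div n + 1) - 1) * n + \<tau> ((a - 1) mod n + 1)
      else a)"

text \<open>
  \<open>C(k) \<rightarrow> C(k)/\<Sigma>\<^sub>k\<close> is a model for \<open>E\<Sigma>\<^sub>k \<rightarrow> B\<Sigma>\<^sub>k\<close>.  The map \<open>B\<Sigma>\<^sub>m \<times> B\<Sigma>\<^sub>n \<rightarrow> B\<Sigma>\<^sub>m\<^sub>n\<close>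
  induced by the homomorphism \<open>\<Sigma>\<^sub>m \<times> \<Sigma>\<^sub>n \<rightarrow> \<Sigma>\<^sub>m\<^sub>n\<close> is induced by any continuous map
  \<open>C(m) \<times> C(n) \<rightarrow> C(m n)\<close> that is equivariant along the homomorphism, for example
  \<open>(c, d) \<mapsto> \<gamma>(c; d, \<dots>, d)\<close>; such a map is unique up to equivariant homotopy.
\<close>

definition covers_prod_hom :: "'c operad \<Rightarrow> nat \<Rightarrow> nat \<Rightarrow> ('c \<times> 'c \<Rightarrow> 'c) \<Rightarrow> bool" where
  "covers_prod_hom C m n F \<longleftrightarrow>
     continuous_map (kprod (opspace C m) (opspace C n)) (opspace C (m * n)) F \<and>
     (\<forall>c \<in> topspace (opspace C m). \<forall>d \<in> topspace (opspace C n).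
      \<forall>\<sigma> \<in> carrier (sym_group m). \<forall>\<tau> \<in> carrier (sym_group n).
        F (opact C m c \<sigma>, opact C n d \<tau>) = opact C (m * n) (F (c, d)) (prod_perm m n \<sigma> \<tau>))"

definition classifying_prod :: "'c operad \<Rightarrow> nat \<Rightarrow> nat \<Rightarrow> 'c set \<times> 'c set \<Rightarrow> 'c set" where
  "classifying_prod C m n = (\<lambda>(P, Q).
     orbit C (m * n) ((SOME F. covers_prod_hom C m n F) (SOME c. c \<in> P, SOME d. d \<in> Q)))"

definition sym_circ ::
    "nat \<Rightarrow> 'c operad \<Rightarrow> nat \<times> nat \<Rightarrow> nat \<times> nat \<Rightarrow> 'c set chain set \<Rightarrow> 'c set chain set \<Rightarrow> 'c set chain set" where
  "sym_circ p C = (\<lambda>(k, m) (l, n) A B.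
     hom_map p (m + n) (orbit_space C (k * l)) (classifying_prod C k l)
       (hom_cross p m n (orbit_space C k) (orbit_space C l) A B))"

text \<open>
  Elements of the direct sum over \<open>k\<close> of the total homology of \<open>\<Sigma>\<^sub>k\<close> are families indexed by
  pairs \<open>(k, n)\<close>, where \<open>n\<close> is the homological degree.
\<close>

definition sym_homology :: "nat \<Rightarrow> 'c operad \<Rightarrow> nat \<times> nat \<Rightarrow> 'c set chain set monoid" where
  "sym_homology p C = (\<lambda>(k, n). homology_mod p n (orbit_space C k))"

definition sym_homology_ring :: "nat \<Rightarrow> 'c operad \<Rightarrow> (nat \<times> nat \<Rightarrow> 'c set chain set) ring" where
  "sym_homology_ring p C =
     (let G = sum_group UNIV (sym_homology p C) in
      \<lparr>carrier = carrier G,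
       monoid.mult = (\<lambda>r s (l, N). finprod (sym_homology p C (l, N)) (\<lambda>(i, j). sym_circ p C i j (r i) (s j))
                {(i, j). r i \<noteq> \<one>\<^bsub>sym_homology p C i\<^esub> \<and> s j \<noteq> \<one>\<^bsub>sym_homology p C j\<^esub> \<and>
                         fst i * fst j = l \<and> snd i + snd j = N}),
       one = (\<one>\<^bsub>G\<^esub>)((1, 0) := hom_class p 0 (orbit_space C 1)
                (frag_of (\<lambda>x\<in>standard_simplex 0. orbit C 1 (opunit C)))),
       zero = \<one>\<^bsub>G\<^esub>,
       add = monoid.mult G\<rparr>)"


section \<open>The modules\<close>

definition diagonal_action ::
    "(nat \<Rightarrow> 'c \<Rightarrow> (nat \<Rightarrow> 'y) \<Rightarrow> 'y) \<Rightarrow> nat \<Rightarrow> 'c set \<times> 'y \<Rightarrow> 'y" where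
  "diagonal_action \<theta> k = (\<lambda>(Q, y). \<theta> k (SOME c. c \<in> Q) (\<lambda>i\<in>{1..k}. y))"

definition hom_circ ::
    "nat \<Rightarrow> 'c operad \<Rightarrow> 'y topology \<Rightarrow> (nat \<Rightarrow> 'c \<Rightarrow> (nat \<Rightarrow> 'y) \<Rightarrow> 'y) \<Rightarrow>
     nat \<times> nat \<Rightarrow> nat \<Rightarrow> 'c set chain set \<Rightarrow> 'y chain set \<Rightarrow> 'y chain set" where
  "hom_circ p C Y \<theta> = (\<lambda>(k, m) n A B.
     hom_map p (m + n) Y (diagonal_action \<theta> k) (hom_cross p m n (orbit_space C k) Y A B))"

definition red_circ ::
    "nat \<Rightarrow> 'c operad \<Rightarrow> 'y topology \<Rightarrow> (nat \<Rightarrow> 'c \<Rightarrow> (nat \<Rightarrow> 'y) \<Rightarrow> 'y) \<Rightarrow>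
     nat \<times> nat \<Rightarrow> nat \<Rightarrow> 'c set chain set \<Rightarrow> 'y chain set set \<Rightarrow> 'y chain set set" where
  "red_circ p C Y \<theta> = (\<lambda>(k, m) n A B.
     red_class p (m + n) Y (algebra_basepoint C \<theta>) (hom_circ p C Y \<theta> (k, m) n A (SOME b. b \<in> B)))"

definition red_homology_module ::
    "nat \<Rightarrow> 'c operad \<Rightarrow> 'y topology \<Rightarrow> (nat \<Rightarrow> 'c \<Rightarrow> (nat \<Rightarrow> 'y) \<Rightarrow> 'y) \<Rightarrow>
     (nat \<times> nat \<Rightarrow> 'c set chain set, nat \<Rightarrow> 'y chain set set) module" where
  "red_homology_module p C Y \<theta> =
     (let H = (\<lambda>n. red_homology p n Y (algebra_basepoint C \<theta>)); G = sum_group UNIV H in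
      \<lparr>carrier = carrier G,
       monoid.mult = undefined, one = undefined,
       zero = \<one>\<^bsub>G\<^esub>,
       add = monoid.mult G,
       smult = (\<lambda>r x N. finprod (H N) (\<lambda>(i, n). red_circ p C Y \<theta> i n (r i) (x n))
                {(i, n). r i \<noteq> \<one>\<^bsub>sym_homology p C i\<^esub> \<and> x n \<noteq> \<one>\<^bsub>H n\<^esub> \<and> snd i + n = N})\<rparr>)"

text \<open>
  Only the additive structure and \<open>smult\<close> matter; \<open>mult\<close> and \<open>one\<close> are inherited from the type of ring records.
  The library's \<^locale>\<open>module\<close> is restricted to commutative rings, which is why it is not used here.
\<close>

definition module_map ::
    "('r, 'm) ring_scheme \<Rightarrow> ('r, 'a, 'k) module_scheme \<Rightarrow> ('r, 'b, 'l) module_scheme \<Rightarrow> ('a \<Rightarrow> 'b) \<Rightarrow> bool" where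
  "module_map R M N f \<longleftrightarrow>
     f \<in> carrier M \<rightarrow> carrier N \<and>
     (\<forall>x \<in> carrier M. \<forall>y \<in> carrier M. f (x \<oplus>\<^bsub>M\<^esub> y) = f x \<oplus>\<^bsub>N\<^esub> f y) \<and>
     (\<forall>r \<in> carrier R. \<forall>x \<in> carrier M. f (r \<odot>\<^bsub>M\<^esub> x) = r \<odot>\<^bsub>N\<^esub> f x)"

end

theory Submission
  imports Defs "HOL-Analysis.Analysis"
begin

text \<open>
  Let \<open>\<iota>\<close> be the fundamental cycle of the circle.  Both \<open>\<sigma>(r \<circ> x)\<close> and \<open>r \<circ> \<sigma>(x)\<close> are the
  push-forward of \<open>r \<times> x \<times> \<iota>\<close> along \<open>([c], \<alpha>, t) \<mapsto> \<theta>(c; \<alpha>(t), \<dots>, \<alpha>(t))\<close>.  They agree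
  already as chains, because the shuffle product is natural and strictly associative, and there
  is no sign, because the circle stands on the right.

  The rest of the argument is that all the operations are induced by chain maps.  Singular
  chains see a space only through maps from simplices, so continuity is needed only after pulling
  back to a compact Hausdorff space \<open>T\<close>.  There the \<open>k\<close>-products are ordinary products, provided
  that images of simplices are Hausdorff, and the tube lemma shows that the structure
  maps descend from \<open>C(k)\<close> to \<open>C(k)/\<Sigma>\<^sub>k\<close>.
\<close>

section \<open>Formal sums\<close>

text \<open>An acyclic-models argument would give associativity only up to chain homotopy. With
  signed sums of lattice paths it becomes an equality, and the Leibniz rule follows from the same
  recursion on the last vertex of a path. The operations choose representatives at three levels: a
  chain in a class, a class in a reduced class, a point in an orbit. Each is therefore first
  computed on explicit cycles. In a reduced class the choice leaves a cycle at the basepoint, which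
  disappears because evaluation of loops and the diagonal action carry the basepoint slice to the
  basepoint. The choice of a point in an orbit is the topological obstacle: a quotient map times an
  identity need not be a quotient map for the ordinary product, and the structure map is continuous
  only on the \<open>k\<close>-product. So the diagonal action is never claimed to be continuous; it
  is shown to carry singular simplices to singular simplices (\<open>singular_map\<close>). For the
  loop space the probe is a simplex times the circle, which is why probes more general than
  simplices occur.\<close>

lemma additive_frag_extend:
  fixes h :: "('b \<Rightarrow>\<^sub>0 int) \<Rightarrow> ('c \<Rightarrow>\<^sub>0 int)"
  assumes "\<And>a b. h (a - b) = h a - h b"
  shows "h (frag_extend f c) = frag_extend (\<lambda>x. h (f x)) c"
proof -
  have h0: "h 0 = 0" using assms[of 0 0] by simp
  show ?thesis
    using subset_UNIV[of "Poly_Mapping.keys c"]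
    by (induction c rule: frag_induction) (simp_all add: h0 assms frag_extend_diff)
qed

lemma frag_cmul_diff: "frag_cmul k (a - b) = frag_cmul k a - frag_cmul k b"
  by (rule poly_mapping_eqI) (simp add: lookup_minus algebra_simps)

lemma frag_extend_add_fun:
  "frag_extend (\<lambda>x. f x + g x) c = frag_extend f c + frag_extend g c"
  using subset_UNIV[of "Poly_Mapping.keys c"]
  by (induction c rule: frag_induction) (simp_all add: frag_extend_diff algebra_simps)

lemma frag_extend_cmul_fun:
  "frag_extend (\<lambda>x. frag_cmul k (f x)) c = frag_cmul k (frag_extend f c)"
  using subset_UNIV[of "Poly_Mapping.keys c"]
  by (induction c rule: frag_induction) (simp_all add: frag_extend_diff frag_cmul_diff)

lemma frag_extend_diff_fun:
  "frag_extend (\<lambda>x. f x - g x) c = frag_extend f c - frag_extend g c"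
  using frag_extend_add_fun[of "\<lambda>x. f x - g x" g c] by (simp add: algebra_simps)

lemma frag_extend_frag_extend:
  "frag_extend f (frag_extend g c) = frag_extend (\<lambda>x. frag_extend f (g x)) c"
  by (rule additive_frag_extend) (simp add: frag_extend_diff)

text \<open>Fubini for finite formal sums. It reconciles the order of summation in
  \<open>chain_cross\<close>, left factor outside, with that of nested paths, outer path
  outside.\<close>

lemma frag_extend_swap:
  "frag_extend (\<lambda>x. frag_extend (f x) b) a = frag_extend (\<lambda>y. frag_extend (\<lambda>x. f x y) a) b"
  using subset_UNIV[of "Poly_Mapping.keys a"]
proof (induction a rule: frag_induction)
  case (diff a b)
  then show ?case
    by (simp add: frag_extend_diff frag_extend_diff_fun)
next
  case zero
  then show ?case by (simp add: frag_extend_eq_0)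
qed simp

definition frag_map :: "('a \<Rightarrow> 'b) \<Rightarrow> ('a \<Rightarrow>\<^sub>0 int) \<Rightarrow> ('b \<Rightarrow>\<^sub>0 int)" where
  "frag_map f = frag_extend (\<lambda>x. frag_of (f x))"

lemma frag_map_0 [simp]: "frag_map f 0 = 0"
  and frag_map_of [simp]: "frag_map f (frag_of x) = frag_of (f x)"
  and frag_map_add: "frag_map f (a + b) = frag_map f a + frag_map f b"
  and frag_map_cmul: "frag_map f (frag_cmul k a) = frag_cmul k (frag_map f a)"
  by (simp_all add: frag_map_def frag_extend_add frag_extend_cmul)

lemma frag_map_sum: "frag_map f (\<Sum>i\<in>I. g i) = (\<Sum>i\<in>I. frag_map f (g i))"
  by (induction I rule: infinite_finite_induct) (simp_all add: frag_map_add)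

lemma frag_map_frag_map: "frag_map f (frag_map g c) = frag_map (\<lambda>x. f (g x)) c"
  by (simp add: frag_map_def frag_extend_frag_extend)

lemma frag_extend_frag_map: "frag_extend f (frag_map g c) = frag_extend (\<lambda>x. f (g x)) c"
  by (simp add: frag_map_def frag_extend_frag_extend)

lemma frag_map_frag_extend: "frag_map f (frag_extend g c) = frag_extend (\<lambda>x. frag_map f (g x)) c"
  by (simp add: frag_map_def frag_extend_frag_extend)

lemma frag_map_cong: "(\<And>x. x \<in> Poly_Mapping.keys c \<Longrightarrow> f x = g x) \<Longrightarrow> frag_map f c = frag_map g c"
  unfolding frag_map_def by (rule frag_extend_eq) simp

lemma frag_map_ident: "frag_map (\<lambda>x. x) c = c"
  by (simp add: frag_map_def flip: frag_expansion)

lemma keys_frag_map: "Poly_Mapping.keys (frag_map f c) \<subseteq> f ` Poly_Mapping.keys c"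
  unfolding frag_map_def using keys_frag_extend[of "\<lambda>x. frag_of (f x)" c] by auto

section \<open>Shuffles as chains of lattice paths\<close>

abbreviation frag_snoc :: "'a \<Rightarrow> ('a list \<Rightarrow>\<^sub>0 int) \<Rightarrow> ('a list \<Rightarrow>\<^sub>0 int)" where
  "frag_snoc v \<equiv> frag_map (\<lambda>L. L @ [v])"

text \<open>The recursion is on the last step. A last step that advances the first coordinate forms
  an inversion with each of the \<open>Suc n\<close> steps of the second coordinate, all of which
  come before it; hence the sign \<open>(-1) ^ Suc n\<close>.\<close>

fun shuffle_paths :: "nat \<Rightarrow> nat \<Rightarrow> (nat \<times> nat) list \<Rightarrow>\<^sub>0 int" where
  "shuffle_paths 0 0 = frag_of [(0, 0)]"
| "shuffle_paths (Suc m) 0 = frag_snoc (Suc m, 0) (shuffle_paths m 0)"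
| "shuffle_paths 0 (Suc n) = frag_snoc (0, Suc n) (shuffle_paths 0 n)"
| "shuffle_paths (Suc m) (Suc n) = frag_snoc (Suc m, Suc n)
     (shuffle_paths (Suc m) n + frag_cmul ((-1) ^ Suc n) (shuffle_paths m (Suc n)))"

definition paths_to :: "nat \<Rightarrow> nat \<Rightarrow> (nat \<times> nat) list set" where
  "paths_to m n = {L. length L = Suc (m + n) \<and> set L \<subseteq> {..m} \<times> {..n} \<and> L ! (m + n) = (m, n)}"

lemma keys_frag_snoc:
  assumes "Poly_Mapping.keys c \<subseteq> A" "\<And>L. L \<in> A \<Longrightarrow> L @ [v] \<in> B"
  shows "Poly_Mapping.keys (frag_snoc v c) \<subseteq> B"
  using keys_frag_map[of "\<lambda>L. L @ [v]" c] assms by blast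

lemma paths_to_snoc:
  assumes "L \<in> paths_to m n" "m \<le> m'" "n \<le> n'" "m' + n' = Suc (m + n)"
  shows "L @ [(m', n')] \<in> paths_to m' n'"
proof -
  have "{..m} \<times> {..n} \<subseteq> {..m'} \<times> {..n'}" using assms(2,3) by auto
  then show ?thesis using assms(1,4) by (auto simp: paths_to_def nth_append)
qed

lemma keys_shuffle_paths: "Poly_Mapping.keys (shuffle_paths m n) \<subseteq> paths_to m n"
proof (induction m n rule: shuffle_paths.induct)
  case 1
  then show ?case by (simp add: paths_to_def)
next
  case (2 m)
  then show ?case unfolding shuffle_paths.simps by (rule keys_frag_snoc) (rule paths_to_snoc, auto)
next
  case (3 n)
  then show ?case unfolding shuffle_paths.simps by (rule keys_frag_snoc) (rule paths_to_snoc, auto)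
next
  case (4 m n)
  let ?c = "shuffle_paths (Suc m) n + frag_cmul ((-1) ^ Suc n) (shuffle_paths m (Suc n))"
  have "Poly_Mapping.keys ?c \<subseteq> paths_to (Suc m) n \<union> paths_to m (Suc n)"
    using 4 keys_add[of "shuffle_paths (Suc m) n" "frag_cmul ((-1) ^ Suc n) (shuffle_paths m (Suc n))"]
      keys_cmul[of "(-1) ^ Suc n" "shuffle_paths m (Suc n)"] by blast
  then show ?case unfolding shuffle_paths.simps
    by (rule keys_frag_snoc) (auto elim: paths_to_snoc)
qed

lemma shuffle_pathsD:
  assumes "L \<in> Poly_Mapping.keys (shuffle_paths m n)"
  shows "length L = Suc (m + n)" "set L \<subseteq> {..m} \<times> {..n}" "L ! (m + n) = (m, n)"
  using subsetD[OF keys_shuffle_paths assms] unfolding paths_to_def by blast+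

text \<open>The alternating sum of vertex deletions. A single vertex has boundary 0, as
  \<open>chain_boundary\<close> has in degree 0; deleting it would leave the empty list.\<close>

definition path_boundary :: "('a list \<Rightarrow>\<^sub>0 int) \<Rightarrow> ('a list \<Rightarrow>\<^sub>0 int)" where
  "path_boundary = frag_extend (\<lambda>L. if length L \<le> 1 then 0
     else \<Sum>k<length L. frag_cmul ((-1) ^ k) (frag_of (take k L @ drop (Suc k) L)))"

lemma path_boundary_add: "path_boundary (a + b) = path_boundary a + path_boundary b"
  and path_boundary_cmul: "path_boundary (frag_cmul k a) = frag_cmul k (path_boundary a)"
  by (simp_all add: path_boundary_def frag_extend_add frag_extend_cmul)

text \<open>Deleting the new vertex gives back \<open>c\<close>; all other deletions commute with
  appending it. For \<open>N = 1\<close> this would fail: deleting the only old vertex leaves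
  \<open>[v]\<close>, whereas the boundary of \<open>c\<close> is 0 by convention. Paths with one
  edge are therefore computed directly in the induction below.\<close>

lemma path_boundary_snoc:
  assumes "\<And>L. L \<in> Poly_Mapping.keys c \<Longrightarrow> length L = N" "2 \<le> N"
  shows "path_boundary (frag_snoc v c) = frag_snoc v (path_boundary c) + frag_cmul ((-1) ^ N) c"
proof -
  have "frag_extend (\<lambda>L. if length (L @ [v]) \<le> 1 then 0
          else \<Sum>k<length (L @ [v]). frag_cmul ((-1) ^ k) (frag_of (take k (L @ [v]) @ drop (Suc k) (L @ [v])))) c
      = frag_extend (\<lambda>L. frag_snoc v (if length L \<le> 1 then 0
          else \<Sum>k<length L. frag_cmul ((-1) ^ k) (frag_of (take k L @ drop (Suc k) L)))
          + frag_cmul ((-1) ^ N) (frag_of L)) c"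
    (is "_ = frag_extend ?g c")
  proof (rule frag_extend_eq)
    fix L assume "L \<in> Poly_Mapping.keys c"
    then have L: "length L = N" by (rule assms)
    have "(\<Sum>k<N. frag_cmul ((-1) ^ k) (frag_of (take k (L @ [v]) @ drop (Suc k) (L @ [v]))))
        = frag_snoc v (\<Sum>k<N. frag_cmul ((-1) ^ k) (frag_of (take k L @ drop (Suc k) L)))"
      unfolding frag_map_sum by (rule sum.cong) (simp_all add: frag_map_cmul L)
    then show "(if length (L @ [v]) \<le> 1 then 0
          else \<Sum>k<length (L @ [v]). frag_cmul ((-1) ^ k) (frag_of (take k (L @ [v]) @ drop (Suc k) (L @ [v]))))
        = ?g L" using assms(2) L by simp
  qed
  also have "\<dots> = frag_snoc v (path_boundary c) + frag_cmul ((-1) ^ N) c"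
    unfolding frag_extend_add_fun path_boundary_def frag_map_frag_extend frag_extend_cmul_fun
    by (simp flip: frag_expansion)
  finally show ?thesis
    unfolding path_boundary_def frag_extend_frag_map .
qed

section \<open>Coface maps on lattice paths and signed sums of faces\<close>

definition skip :: "nat \<Rightarrow> nat \<Rightarrow> nat" where
  "skip i j = (if j < i then j else Suc j)"

abbreviation skip1 :: "nat \<Rightarrow> ((nat \<times> nat) list \<Rightarrow>\<^sub>0 int) \<Rightarrow> ((nat \<times> nat) list \<Rightarrow>\<^sub>0 int)" where
  "skip1 i \<equiv> frag_map (map (map_prod (skip i) id))"

abbreviation skip2 :: "nat \<Rightarrow> ((nat \<times> nat) list \<Rightarrow>\<^sub>0 int) \<Rightarrow> ((nat \<times> nat) list \<Rightarrow>\<^sub>0 int)" where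
  "skip2 i \<equiv> frag_map (map (map_prod id (skip i)))"

text \<open>The range of summation is a separate argument because the induction uses the sum
  truncated before the top face, and the top face behaves differently from the others.\<close>

definition alt_skip1 :: "nat \<Rightarrow> ((nat \<times> nat) list \<Rightarrow>\<^sub>0 int) \<Rightarrow> ((nat \<times> nat) list \<Rightarrow>\<^sub>0 int)" where
  "alt_skip1 m c = (\<Sum>i\<le>m. frag_cmul ((-1) ^ i) (skip1 i c))"

definition alt_skip2 :: "nat \<Rightarrow> ((nat \<times> nat) list \<Rightarrow>\<^sub>0 int) \<Rightarrow> ((nat \<times> nat) list \<Rightarrow>\<^sub>0 int)" where
  "alt_skip2 n c = (\<Sum>i\<le>n. frag_cmul ((-1) ^ i) (skip2 i c))"

text \<open>The path version of the boundary of the \<open>m\<close>-simplex times the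
  \<open>n\<close>-simplex. The guard keeps the truncated \<open>m - 1\<close> from producing a term
  for a 0-simplex.\<close>

definition faces1 :: "nat \<Rightarrow> nat \<Rightarrow> (nat \<times> nat) list \<Rightarrow>\<^sub>0 int" where
  "faces1 m n = (if m = 0 then 0 else alt_skip1 m (shuffle_paths (m - 1) n))"

definition faces2 :: "nat \<Rightarrow> nat \<Rightarrow> (nat \<times> nat) list \<Rightarrow>\<^sub>0 int" where
  "faces2 m n = (if n = 0 then 0 else alt_skip2 n (shuffle_paths m (n - 1)))"

lemma alt_skip_add:
  "alt_skip1 m (a + b) = alt_skip1 m a + alt_skip1 m b"
  "alt_skip2 m (a + b) = alt_skip2 m a + alt_skip2 m b"
  by (simp_all add: alt_skip1_def alt_skip2_def frag_map_add frag_cmul_distrib2 sum.distrib)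

lemma alt_skip_cmul:
  "alt_skip1 m (frag_cmul k a) = frag_cmul k (alt_skip1 m a)"
  "alt_skip2 m (frag_cmul k a) = frag_cmul k (alt_skip2 m a)"
  by (simp_all add: alt_skip1_def alt_skip2_def frag_map_cmul frag_cmul_sum mult.commute)

text \<open>Every \<open>skip i\<close> with \<open>i \<le> m\<close> sends \<open>m\<close> to
  \<open>Suc m\<close>, so the whole truncated sum shares one new end vertex. The top face would
  keep \<open>m\<close> fixed.\<close>

lemma alt_skip1_snoc: "alt_skip1 m (frag_snoc (m, n) c) = frag_snoc (Suc m, n) (alt_skip1 m c)"
  unfolding alt_skip1_def frag_map_sum
  by (intro sum.cong) (auto simp: frag_map_cmul frag_map_frag_map skip_def)

lemma alt_skip2_snoc: "alt_skip2 n (frag_snoc (m, n) c) = frag_snoc (m, Suc n) (alt_skip2 n c)"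
  unfolding alt_skip2_def frag_map_sum
  by (intro sum.cong) (auto simp: frag_map_cmul frag_map_frag_map skip_def)

text \<open>The top coface fixes all coordinates up to \<open>m\<close>, so on paths inside the
  rectangle it is the identity.\<close>

lemma faces1_Suc:
  "faces1 (Suc m) n = alt_skip1 m (shuffle_paths m n) + frag_cmul ((-1) ^ Suc m) (shuffle_paths m n)"
proof -
  have "skip1 (Suc m) (shuffle_paths m n) = frag_map (\<lambda>L. L) (shuffle_paths m n)"
    using shuffle_pathsD(2)[of _ m n]
    by (intro frag_map_cong map_idI) (fastforce simp: skip_def)
  then show ?thesis by (simp add: faces1_def alt_skip1_def frag_map_ident)
qed

lemma faces2_Suc:
  "faces2 m (Suc n) = alt_skip2 n (shuffle_paths m n) + frag_cmul ((-1) ^ Suc n) (shuffle_paths m n)"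
proof -
  have "skip2 (Suc n) (shuffle_paths m n) = frag_map (\<lambda>L. L) (shuffle_paths m n)"
    using shuffle_pathsD(2)[of _ m n]
    by (intro frag_map_cong map_idI) (fastforce simp: skip_def)
  then show ?thesis by (simp add: faces2_def alt_skip2_def frag_map_ident)
qed

text \<open>The recursion of \<open>shuffle_paths\<close> carried through the truncated sum. For
  \<open>m = 0\<close> the recursion has only one predecessor, and the guard in
  \<open>faces1\<close> makes the other term 0.\<close>

lemma alt_skip1_shuffle_paths:
  "alt_skip1 m (shuffle_paths m (Suc n)) =
     frag_snoc (Suc m, Suc n) (alt_skip1 m (shuffle_paths m n) + frag_cmul ((-1) ^ Suc n) (faces1 m (Suc n)))"
  by (cases m) (simp_all only: shuffle_paths.simps alt_skip1_snoc faces1_def,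
      simp_all add: alt_skip_add alt_skip_cmul)

lemma alt_skip2_shuffle_paths:
  "alt_skip2 n (shuffle_paths (Suc m) n) =
     frag_snoc (Suc m, Suc n) (faces2 (Suc m) n + frag_cmul ((-1) ^ n) (alt_skip2 n (shuffle_paths m n)))"
  by (cases n) (simp_all only: shuffle_paths.simps alt_skip2_snoc faces2_def,
      simp_all add: alt_skip_add alt_skip_cmul)

text \<open>
  The faces of a path at a corner occur twice with opposite signs; the recursion on the last vertex
  makes this a cancellation of two terms in the inductive step.
\<close>

proposition path_boundary_shuffle_paths:
  "path_boundary (shuffle_paths m n) = faces1 m n + frag_cmul ((-1) ^ m) (faces2 m n)"
proof (induction m n rule: shuffle_paths.induct)
  case 1
  then show ?case by (simp add: path_boundary_def faces1_def faces2_def)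
next
  case (2 m)
  show ?case
  proof (cases m)
    case 0
    then show ?thesis
      by (simp add: path_boundary_def faces2_def faces1_def alt_skip1_def skip_def)
  next
    case (Suc m')
    then have "0 < m" by simp
    have "path_boundary (shuffle_paths (Suc m) 0) =
        frag_snoc (Suc m, 0) (path_boundary (shuffle_paths m 0)) + frag_cmul ((-1) ^ Suc m) (shuffle_paths m 0)"
      unfolding shuffle_paths.simps
      by (rule path_boundary_snoc) (use \<open>0 < m\<close> in \<open>simp_all add: shuffle_pathsD\<close>)
    also have "\<dots> = faces1 (Suc m) 0"
      unfolding 2 unfolding faces1_Suc unfolding Suc shuffle_paths.simps alt_skip1_snoc
      by (simp add: faces2_def faces1_def frag_map_add frag_map_cmul)
    finally show ?thesis by (simp add: faces2_def)
  qed
next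
  case (3 n)
  show ?case
  proof (cases n)
    case 0
    then show ?thesis
      by (simp add: path_boundary_def faces2_def faces1_def alt_skip2_def skip_def)
  next
    case (Suc n')
    then have "0 < n" by simp
    have "path_boundary (shuffle_paths 0 (Suc n)) =
        frag_snoc (0, Suc n) (path_boundary (shuffle_paths 0 n)) + frag_cmul ((-1) ^ Suc n) (shuffle_paths 0 n)"
      unfolding shuffle_paths.simps
      by (rule path_boundary_snoc) (use \<open>0 < n\<close> in \<open>simp_all add: shuffle_pathsD\<close>)
    also have "\<dots> = faces2 0 (Suc n)"
      unfolding 3 unfolding faces2_Suc unfolding Suc shuffle_paths.simps alt_skip2_snoc
      by (simp add: faces2_def faces1_def frag_map_add frag_map_cmul)
    finally show ?thesis by (simp add: faces1_def)
  qed
next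
  case (4 m n)
  let ?c = "shuffle_paths (Suc m) n + frag_cmul ((-1) ^ Suc n) (shuffle_paths m (Suc n))"
  let ?v = "(Suc m, Suc n)"
  have "length L = Suc (Suc (m + n))" if "L \<in> Poly_Mapping.keys ?c" for L
    using that keys_add[of "shuffle_paths (Suc m) n" "frag_cmul ((-1) ^ Suc n) (shuffle_paths m (Suc n))"]
      keys_cmul[of "(-1) ^ Suc n" "shuffle_paths m (Suc n)"]
      shuffle_pathsD(1)[of L "Suc m" n] shuffle_pathsD(1)[of L m "Suc n"] by fastforce
  then have "path_boundary (shuffle_paths (Suc m) (Suc n)) =
      frag_snoc ?v (path_boundary ?c) + frag_cmul ((-1) ^ Suc (Suc (m + n))) ?c"
    unfolding shuffle_paths.simps by (rule path_boundary_snoc) auto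
  \<comment> \<open>The top faces of the two predecessors are both multiples of
    \<open>shuffle_paths m n\<close>: these are the paths with the last corner cut off from either
    side. Their signs \<open>(-1) ^ Suc m\<close> and \<open>(-1) ^ m\<close> cancel.\<close>
  also have "path_boundary ?c = alt_skip1 m (shuffle_paths m n)
      + frag_cmul ((-1) ^ Suc n) (faces1 m (Suc n))
      + frag_cmul ((-1) ^ Suc m) (faces2 (Suc m) n + frag_cmul ((-1) ^ n) (alt_skip2 n (shuffle_paths m n)))"
    unfolding path_boundary_add path_boundary_cmul 4 faces1_Suc faces2_Suc
    by (rule poly_mapping_eqI) (simp add: lookup_add algebra_simps power_add flip: power_mult_distrib)
  also have "frag_snoc ?v \<dots> = alt_skip1 m (shuffle_paths m (Suc n))
      + frag_cmul ((-1) ^ Suc m) (alt_skip2 n (shuffle_paths (Suc m) n))"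
    unfolding alt_skip1_shuffle_paths alt_skip2_shuffle_paths frag_map_add frag_map_cmul by (simp add: add.assoc)
  \<comment> \<open>Deleting the last vertex supplies exactly the two top faces that the truncated
    sums lack.\<close>
  also have "\<dots> + frag_cmul ((-1) ^ Suc (Suc (m + n))) ?c
      = faces1 (Suc m) (Suc n) + frag_cmul ((-1) ^ Suc m) (faces2 (Suc m) (Suc n))"
    unfolding faces1_Suc faces2_Suc
    by (rule poly_mapping_eqI) (simp add: lookup_add algebra_simps power_add flip: power_mult_distrib)
  finally show ?case .
qed

section \<open>Cross products of chains\<close>

lemma vertex_map_in_standard_simplex:
  assumes "x \<in> standard_simplex N" "\<And>j. j \<le> N \<Longrightarrow> \<mu> j \<le> m"
  shows "vertex_map N \<mu> x \<in> standard_simplex m"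
proof -
  have x: "\<And>i. 0 \<le> x i" "(\<Sum>i\<le>N. x i) = 1"
    using assms(1) by (auto simp: standard_simplex_def)
  have "(\<Sum>i\<le>m. vertex_map N \<mu> x i) = (\<Sum>i\<le>m. \<Sum>j\<in>{j \<in> {..N}. \<mu> j = i}. x j)"
    by (simp add: vertex_map_def)
  also have "\<dots> = (\<Sum>j\<le>N. x j)"
    by (rule sum.group) (use assms(2) in auto)
  finally have 1: "(\<Sum>i\<le>m. vertex_map N \<mu> x i) = 1" using x by simp
  have "vertex_map N \<mu> x i \<le> (\<Sum>j\<le>N. x j)" for i
    unfolding vertex_map_def by (rule sum_mono2) (auto simp: x)
  moreover have "vertex_map N \<mu> x i = 0" if "i > m" for i
  proof -
    have "{j. j \<le> N \<and> \<mu> j = i} = {}" using that assms(2) by (metis (mono_tags, lifting) empty_Collect_eq leD)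
    then show ?thesis by (simp only: vertex_map_def sum.empty)
  qed
  ultimately show ?thesis
    using 1 x by (auto simp: standard_simplex_def vertex_map_def intro: sum_nonneg)
qed

lemma continuous_map_vertex_map:
  "continuous_map (powertop_real UNIV) (powertop_real UNIV) (vertex_map N \<mu>)"
  unfolding vertex_map_def
  by (auto simp: continuous_map_componentwise_UNIV
      intro!: continuous_map_sum continuous_map_product_projection)

lemma vertex_map_cong:
  "(\<And>j. j \<le> N \<Longrightarrow> \<mu> j = \<nu> j) \<Longrightarrow> vertex_map N \<mu> x = vertex_map N \<nu> x"
  unfolding vertex_map_def by (intro ext sum.cong) auto

lemma vertex_map_vertex_map:
  assumes "\<And>j. j \<le> N \<Longrightarrow> \<nu> j \<le> M"
  shows "vertex_map M \<mu> (vertex_map N \<nu> x) = vertex_map N (\<lambda>j. \<mu> (\<nu> j)) x"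
proof
  fix i
  have "vertex_map M \<mu> (vertex_map N \<nu> x) i =
      (\<Sum>k\<in>{k. k \<le> M \<and> \<mu> k = i}. \<Sum>j\<in>{j \<in> {j. j \<le> N \<and> \<mu> (\<nu> j) = i}. \<nu> j = k}. x j)"
    unfolding vertex_map_def by (intro sum.cong) auto
  also have "\<dots> = (\<Sum>j\<in>{j. j \<le> N \<and> \<mu> (\<nu> j) = i}. x j)"
    by (rule sum.group) (use assms in auto)
  finally show "vertex_map M \<mu> (vertex_map N \<nu> x) i = vertex_map N (\<lambda>j. \<mu> (\<nu> j)) x i"
    by (simp add: vertex_map_def)
qed

text \<open>Turns face operators into relabellings of vertices, so that identities between simplices
  become compositions of index maps. It holds on the simplex only, since \<open>vertex_map N\<close>
  ignores coordinates beyond \<open>N\<close>.\<close>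

lemma simplical_face_eq_vertex_map:
  assumes "x \<in> standard_simplex N"
  shows "simplical_face k x = vertex_map N (skip k) x"
proof
  fix i
  have x: "x j = 0" if "j > N" for j using assms that by (auto simp: standard_simplex_def)
  consider "i < k" | "i = k" | "k < i" by linarith
  then show "simplical_face k x i = vertex_map N (skip k) x i"
  proof cases
    case 1
    then have "{j. j \<le> N \<and> skip k j = i} = (if i \<le> N then {i} else {})" by (auto simp: skip_def)
    then show ?thesis using 1 x by (simp add: simplical_face_def vertex_map_def)
  next
    case 2
    then have "{j. j \<le> N \<and> skip k j = i} = {}" by (auto simp: skip_def)
    then show ?thesis using 2 by (simp only: simplical_face_def vertex_map_def sum.empty less_irrefl if_False refl if_True)
  next
    case 3
    then have "{j. j \<le> N \<and> skip k j = i} = (if i - 1 \<le> N then {i - 1} else {})" by (auto simp: skip_def)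
    then show ?thesis using 3 x[of "i - 1"] by (simp add: simplical_face_def vertex_map_def)
  qed
qed

text \<open>Any list of vertices is allowed because the faces of a shuffle are no longer shuffles:
  deleting a corner leaves a diagonal step.\<close>

definition path_simplex ::
    "nat \<Rightarrow> ((nat \<Rightarrow> real) \<Rightarrow> 'a) \<Rightarrow> ((nat \<Rightarrow> real) \<Rightarrow> 'b) \<Rightarrow> (nat \<times> nat) list \<Rightarrow> (nat \<Rightarrow> real) \<Rightarrow> 'a \<times> 'b" where
  "path_simplex N f g L = (\<lambda>x\<in>standard_simplex N.
     (f (vertex_map N (\<lambda>j. fst (L ! j)) x), g (vertex_map N (\<lambda>j. snd (L ! j)) x)))"

section \<open>Shuffles given by subsets agree with the recursive chain of paths\<close>

definition step_path :: "nat \<Rightarrow> nat set \<Rightarrow> (nat \<times> nat) list" where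
  "step_path N S = map (\<lambda>j. (card ({..<j} \<inter> S), card ({..<j} - S))) [0..<Suc N]"

lemma shuffle_simplex_eq_path_simplex: "shuffle_simplex N S f g = path_simplex N f g (step_path N S)"
proof -
  have "vertex_map N (\<lambda>j. fst (step_path N S ! j)) x = vertex_map N (\<lambda>j. card ({..<j} \<inter> S)) x"
    "vertex_map N (\<lambda>j. snd (step_path N S ! j)) x = vertex_map N (\<lambda>j. card ({..<j} - S)) x" for x
    by (rule vertex_map_cong; simp add: step_path_def nth_append del: upt_Suc)+
  then show ?thesis by (simp add: shuffle_simplex_def path_simplex_def)
qed

lemma step_path_Suc:
  assumes "S \<subseteq> {..<Suc N}"
  shows "step_path (Suc N) S = step_path N (S - {N}) @ [(card S, Suc N - card S)]"
proof -
  have fin: "finite S" using assms finite_subset by blast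
  have "card ({..<Suc N} \<inter> S) = card S" "card ({..<Suc N} - S) = Suc N - card S"
    using assms by (simp_all add: Int_absorb1 card_Diff_subset fin)
  moreover have "card ({..<j} \<inter> (S - {N})) = card ({..<j} \<inter> S)" "card ({..<j} - (S - {N})) = card ({..<j} - S)"
    if "j \<le> N" for j
    by (rule arg_cong[where f=card], use that in auto)+
  ultimately show ?thesis by (auto simp: step_path_def)
qed

lemma finite_inversions: "finite {(i, j). i < j \<and> j < (N::nat) \<and> P i j}"
  by (rule finite_subset[of _ "{..<N} \<times> {..<N}"]) auto

text \<open>A new last step in \<open>S\<close> is inverted with each of the
  \<open>N - card S\<close> earlier steps outside \<open>S\<close>; a new last step outside
  \<open>S\<close> is inverted with none. This is the source of the sign in
  \<open>shuffle_paths\<close>.\<close>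

lemma shuffle_sign_Suc:
  assumes "S \<subseteq> {..<N}"
  shows "shuffle_sign (Suc N) S = shuffle_sign N S"
    and "shuffle_sign (Suc N) (insert N S) = (-1) ^ (N - card S) * shuffle_sign N S"
proof -
  have "{(i, j). i < j \<and> j < Suc N \<and> i \<notin> S \<and> j \<in> S} = {(i, j). i < j \<and> j < N \<and> i \<notin> S \<and> j \<in> S}"
    using assms by force
  then show "shuffle_sign (Suc N) S = shuffle_sign N S" by (simp add: shuffle_sign_def)
  let ?I = "{(i, j). i < j \<and> j < N \<and> i \<notin> S \<and> j \<in> S}"
  have "{(i, j). i < j \<and> j < Suc N \<and> i \<notin> insert N S \<and> j \<in> insert N S} = ({..<N} - S) \<times> {N} \<union> ?I"
    using assms by (auto simp: less_Suc_eq)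
  moreover have "card (({..<N} - S) \<times> {N} \<union> ?I) = card (({..<N} - S) \<times> {N}) + card ?I"
    by (rule card_Un_disjoint) (auto simp: finite_inversions)
  moreover have "card (({..<N} - S) \<times> {N}) = N - card S"
    using assms by (simp add: card_cartesian_product card_Diff_subset finite_subset)
  ultimately show "shuffle_sign (Suc N) (insert N S) = (-1) ^ (N - card S) * shuffle_sign N S"
    by (simp add: shuffle_sign_def power_add)
qed

definition k_subsets :: "nat \<Rightarrow> nat \<Rightarrow> nat set set" where
  "k_subsets N m = {S. S \<subseteq> {..<N} \<and> card S = m}"

definition step_chain :: "nat \<Rightarrow> nat \<Rightarrow> (nat \<times> nat) list \<Rightarrow>\<^sub>0 int" where
  "step_chain m n = (\<Sum>S\<in>k_subsets (m + n) m. frag_cmul (shuffle_sign (m + n) S) (frag_of (step_path (m + n) S)))"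

lemma finite_k_subsets: "finite (k_subsets N m)"
  unfolding k_subsets_def by (rule finite_subset[of _ "Pow {..<N}"]) auto

lemma k_subsetsD:
  assumes "S \<in> k_subsets N m" shows "S \<subseteq> {..<N}" "card S = m" "finite S" "N \<notin> S"
  using assms finite_subset[of S "{..<N}"] by (auto simp: k_subsets_def)

text \<open>Pascal's rule for sets: the shuffles are split by the direction of their last
  step.\<close>

lemma k_subsets_Suc:
  "k_subsets (Suc N) (Suc m) = k_subsets N (Suc m) \<union> insert N ` k_subsets N m" (is "?A = ?B")
proof
  have "insert N S \<in> ?A" if "S \<in> k_subsets N m" for S
    using k_subsetsD[OF that] by (auto simp: k_subsets_def less_Suc_eq)
  moreover have "S \<in> ?A" if "S \<in> k_subsets N (Suc m)" for S
    using k_subsetsD[OF that] by (auto simp: k_subsets_def less_Suc_eq)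
  ultimately show "?B \<subseteq> ?A" by blast
  show "?A \<subseteq> ?B"
  proof
    fix S assume "S \<in> ?A"
    note S = k_subsetsD[OF this]
    show "S \<in> ?B"
    proof (cases "N \<in> S")
      case True
      then have "S = insert N (S - {N})" "S - {N} \<in> k_subsets N m"
        using S by (auto simp: less_Suc_eq k_subsets_def)
      then show ?thesis by blast
    next
      case False
      then have "S \<subseteq> {..<N}" using S(1) by (auto simp: less_Suc_eq)
      then show ?thesis using S(2) by (simp add: k_subsets_def)
    qed
  qed
qed

lemma k_subsets_0: "k_subsets N 0 = {{}}"
proof
  show "k_subsets N 0 \<subseteq> {{}}" using k_subsetsD[of _ N 0] by auto
qed (simp add: k_subsets_def)

lemma k_subsets_large: "N < m \<Longrightarrow> k_subsets N m = {}"
proof (rule equals0I)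
  fix S assume "N < m" "S \<in> k_subsets N m"
  then show False using k_subsetsD(1,2)[of S N m] card_mono[of "{..<N}" S] by simp
qed

lemma step_chain_keep:
  "(\<Sum>S\<in>k_subsets N m. frag_cmul (shuffle_sign (Suc N) S) (frag_of (step_path (Suc N) S)))
   = frag_snoc (m, Suc N - m) (\<Sum>S\<in>k_subsets N m. frag_cmul (shuffle_sign N S) (frag_of (step_path N S)))"
  unfolding frag_map_sum
proof (rule sum.cong[OF refl])
  fix S assume S: "S \<in> k_subsets N m"
  note k = k_subsetsD[OF S]
  then have "S \<subseteq> {..<Suc N}" "S - {N} = S" by auto
  then show "frag_cmul (shuffle_sign (Suc N) S) (frag_of (step_path (Suc N) S))
      = frag_snoc (m, Suc N - m) (frag_cmul (shuffle_sign N S) (frag_of (step_path N S)))"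
    using k by (simp add: frag_map_cmul step_path_Suc shuffle_sign_Suc)
qed

lemma step_chain_insert:
  "(\<Sum>S\<in>insert N ` k_subsets N m. frag_cmul (shuffle_sign (Suc N) S) (frag_of (step_path (Suc N) S)))
   = frag_snoc (Suc m, N - m) (frag_cmul ((-1) ^ (N - m))
       (\<Sum>S\<in>k_subsets N m. frag_cmul (shuffle_sign N S) (frag_of (step_path N S))))"
proof -
  have inj: "inj_on (insert N) (k_subsets N m)"
    using k_subsetsD(4) by (intro inj_onI) (metis Diff_insert_absorb)
  show ?thesis
    unfolding sum.reindex[OF inj] frag_cmul_sum frag_map_sum comp_def
  proof (rule sum.cong[OF refl])
    fix S assume S: "S \<in> k_subsets N m"
    note k = k_subsetsD[OF S]
    then have "insert N S \<subseteq> {..<Suc N}" "insert N S - {N} = S" "card (insert N S) = Suc m"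
      by (auto simp: less_Suc_eq)
    then show "frag_cmul (shuffle_sign (Suc N) (insert N S)) (frag_of (step_path (Suc N) (insert N S)))
      = frag_snoc (Suc m, N - m) (frag_cmul ((-1) ^ (N - m)) (frag_cmul (shuffle_sign N S) (frag_of (step_path N S))))"
      using k by (simp add: frag_map_cmul step_path_Suc shuffle_sign_Suc)
  qed
qed

text \<open>Both sides satisfy the same recursion by Pascal's rule and the count of new inversions.
  From here on, subsets and inversions are replaced by paths.\<close>

lemma step_chain_eq: "step_chain m n = shuffle_paths m n"
proof (induction m n rule: shuffle_paths.induct)
  case 1
  then show ?case by (simp add: step_chain_def k_subsets_0 shuffle_sign_def step_path_def)
next
  case (2 m)
  have "k_subsets (Suc m) (Suc m) = insert m ` k_subsets m m"
    unfolding k_subsets_Suc by (simp add: k_subsets_large)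
  then show ?case using step_chain_insert[of m m] 2 by (simp add: step_chain_def)
next
  case (3 n)
  have "k_subsets (Suc n) 0 = k_subsets n 0" by (simp only: k_subsets_0)
  then show ?case using step_chain_keep[of n 0] 3 by (simp add: step_chain_def)
next
  case (4 m n)
  let ?N = "Suc (m + n)"
  let ?A = "k_subsets ?N (Suc m)" and ?B = "insert ?N ` k_subsets ?N m"
  have disj: "?A \<inter> ?B = {}" using k_subsetsD(4) by blast
  have fin: "finite ?A" "finite ?B" by (simp_all add: finite_k_subsets)
  have split: "k_subsets (Suc m + Suc n) (Suc m) = ?A \<union> ?B"
    using k_subsets_Suc[of ?N m] by simp
  have N: "Suc m + Suc n = Suc ?N" by simp
  have k: "Suc ?N - Suc m = Suc n" "?N - m = Suc n" by auto
  have 1: "step_chain (Suc m) (Suc n) =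
      (\<Sum>S\<in>k_subsets ?N (Suc m). frag_cmul (shuffle_sign (Suc ?N) S) (frag_of (step_path (Suc ?N) S)))
      + (\<Sum>S\<in>insert ?N ` k_subsets ?N m. frag_cmul (shuffle_sign (Suc ?N) S) (frag_of (step_path (Suc ?N) S)))"
    unfolding step_chain_def split sum.union_disjoint[OF fin disj] unfolding N ..
  have 2: "\<dots> = frag_snoc (Suc m, Suc n) (step_chain (Suc m) n)
      + frag_snoc (Suc m, Suc n) (frag_cmul ((-1) ^ Suc n) (step_chain m (Suc n)))"
    using step_chain_keep[of ?N "Suc m"] step_chain_insert[of ?N m] unfolding k
    by (simp only: step_chain_def add_Suc add_Suc_right)
  show ?case
    unfolding shuffle_paths.simps frag_map_add 4[symmetric] by (rule trans[OF 1 2])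
qed

lemma simplex_cross_eq_paths:
  "simplex_cross m n f g = frag_map (path_simplex (m + n) f g) (shuffle_paths m n)"
proof -
  have "frag_map (path_simplex (m + n) f g) (step_chain m n) = (\<Sum>S\<in>k_subsets (m + n) m.
      frag_map (path_simplex (m + n) f g) (frag_cmul (shuffle_sign (m + n) S) (frag_of (step_path (m + n) S))))"
    unfolding step_chain_def by (rule frag_map_sum)
  also have "\<dots> = simplex_cross m n f g"
    unfolding simplex_cross_def k_subsets_def
    by (rule sum.cong) (simp_all only: frag_map_cmul frag_map_of shuffle_simplex_eq_path_simplex)
  finally show ?thesis
    unfolding step_chain_eq by (rule sym)
qed

lemma frag_linear_eqI:
  fixes H K :: "('a \<Rightarrow>\<^sub>0 int) \<Rightarrow> ('b \<Rightarrow>\<^sub>0 int)"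
  assumes "\<And>a b. H (a - b) = H a - H b" "\<And>a b. K (a - b) = K a - K b"
    and "\<And>x. x \<in> Poly_Mapping.keys c \<Longrightarrow> H (frag_of x) = K (frag_of x)"
  shows "H c = K c"
proof -
  have "H c = frag_extend (\<lambda>x. H (frag_of x)) c"
    using additive_frag_extend[of H, OF assms(1), of frag_of c] by (simp flip: frag_expansion)
  also have "\<dots> = frag_extend (\<lambda>x. K (frag_of x)) c"
    by (rule frag_extend_eq) (rule assms(3))
  also have "\<dots> = K c"
    using additive_frag_extend[of K, OF assms(2), of frag_of c] by (simp flip: frag_expansion)
  finally show ?thesis .
qed

section \<open>Bilinearity, Leibniz rule and naturality\<close>

lemma chain_cross_0 [simp]: "chain_cross m n 0 b = 0" "chain_cross m n a 0 = 0"
  by (simp_all add: chain_cross_def frag_extend_eq_0)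

lemma chain_cross_of: "chain_cross m n (frag_of f) (frag_of g) = simplex_cross m n f g"
  by (simp add: chain_cross_def)

lemma chain_cross_diff:
  "chain_cross m n (a - a') b = chain_cross m n a b - chain_cross m n a' b"
  "chain_cross m n a (b - b') = chain_cross m n a b - chain_cross m n a b'"
  by (simp_all add: chain_cross_def frag_extend_diff frag_extend_diff_fun)

lemma chain_cross_add:
  "chain_cross m n (a + a') b = chain_cross m n a b + chain_cross m n a' b"
  "chain_cross m n a (b + b') = chain_cross m n a b + chain_cross m n a b'"
  by (simp_all add: chain_cross_def frag_extend_add frag_extend_add_fun)

lemma chain_cross_cmul:
  "chain_cross m n (frag_cmul k a) b = frag_cmul k (chain_cross m n a b)"
  "chain_cross m n a (frag_cmul k b) = frag_cmul k (chain_cross m n a b)"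
  by (simp_all add: chain_cross_def frag_extend_cmul frag_extend_cmul_fun)

lemma chain_cross_sum_left: "chain_cross m n (\<Sum>i\<in>I. a i) b = (\<Sum>i\<in>I. chain_cross m n (a i) b)"
  by (induction I rule: infinite_finite_induct) (simp_all add: chain_cross_add)

lemma chain_cross_sum_right: "chain_cross m n a (\<Sum>i\<in>I. b i) = (\<Sum>i\<in>I. chain_cross m n a (b i))"
  by (induction I rule: infinite_finite_induct) (simp_all add: chain_cross_add)

lemma nth_in_rectangle:
  assumes "length L = Suc N" "set L \<subseteq> {..m} \<times> {..n}" "j \<le> N"
  shows "fst (L ! j) \<le> m" "snd (L ! j) \<le> n"
proof -
  have "L ! j \<in> {..m} \<times> {..n}"
    using assms nth_mem[of j L] by (metis less_Suc_eq_le subsetD)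
  then show "fst (L ! j) \<le> m" "snd (L ! j) \<le> n" by auto
qed

lemma singular_chain_simplex_cross:
  assumes f: "singular_simplex m X f" and g: "singular_simplex n Y g"
  shows "singular_chain (m + n) (prod_topology X Y) (simplex_cross m n f g)"
proof -
  let ?P = "powertop_real UNIV"
  have "singular_simplex (m + n) (prod_topology X Y) (path_simplex (m + n) f g L)"
    if "L \<in> Poly_Mapping.keys (shuffle_paths m n)" for L
  proof -
    have L: "fst (L ! j) \<le> m" "snd (L ! j) \<le> n" if "j \<le> m + n" for j
      by (rule nth_in_rectangle[OF shuffle_pathsD(1,2)[OF \<open>L \<in> _\<close>] that])+
    have "continuous_map (subtopology ?P (standard_simplex (m + n))) (subtopology ?P (standard_simplex m))
            (vertex_map (m + n) (\<lambda>j. fst (L ! j)))"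
      "continuous_map (subtopology ?P (standard_simplex (m + n))) (subtopology ?P (standard_simplex n))
            (vertex_map (m + n) (\<lambda>j. snd (L ! j)))"
      unfolding continuous_map_in_subtopology
      using L by (auto intro: vertex_map_in_standard_simplex continuous_map_from_subtopology
          continuous_map_vertex_map)
    from this[THEN continuous_map_compose] f g
    have "continuous_map (subtopology ?P (standard_simplex (m + n))) X (\<lambda>x. f (vertex_map (m + n) (\<lambda>j. fst (L ! j)) x))"
      "continuous_map (subtopology ?P (standard_simplex (m + n))) Y (\<lambda>x. g (vertex_map (m + n) (\<lambda>j. snd (L ! j)) x))"
      by (auto simp: singular_simplex_def comp_def)
    then have "continuous_map (subtopology ?P (standard_simplex (m + n))) (prod_topology X Y)
      (\<lambda>x. (f (vertex_map (m + n) (\<lambda>j. fst (L ! j)) x), g (vertex_map (m + n) (\<lambda>j. snd (L ! j)) x)))"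
      by (simp add: continuous_map_paired)
    then have "continuous_map (subtopology ?P (standard_simplex (m + n))) (prod_topology X Y) (path_simplex (m + n) f g L)"
      by (rule continuous_map_eq) (simp add: path_simplex_def)
    then show ?thesis by (simp add: singular_simplex_def path_simplex_def)
  qed
  then show ?thesis
    unfolding simplex_cross_eq_paths frag_map_def
    by (intro singular_chain_extend) (simp add: singular_chain_of)
qed

text \<open>The ordinary product topology suffices here; \<open>singular_simplex_kprod\<close> later
  identifies its singular simplices with those of the \<open>k\<close>-product.\<close>

lemma singular_chain_chain_cross:
  assumes "singular_chain m X a" "singular_chain n Y b"
  shows "singular_chain (m + n) (prod_topology X Y) (chain_cross m n a b)"
  using assms unfolding chain_cross_def singular_chain_def[of m] singular_chain_def[of n]
  by (blast intro: singular_chain_extend singular_chain_simplex_cross)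

text \<open>Composing the indexing of \<open>L\<close> with \<open>skip k\<close> amounts to
  deleting the entry at position \<open>k\<close>.\<close>

lemma singular_face_path_simplex:
  assumes L: "length L = Suc (Suc N)" and k: "k \<le> Suc N"
  shows "singular_face (Suc N) k (path_simplex (Suc N) f g L) = path_simplex N f g (take k L @ drop (Suc k) L)"
proof
  fix x
  have nth: "(take k L @ drop (Suc k) L) ! j = L ! skip k j" if "j \<le> N" for j
    using that L k by (auto simp: nth_append skip_def)
  have vm: "vertex_map (Suc N) \<mu> (simplical_face k x) = vertex_map N (\<lambda>j. \<mu> (skip k j)) x"
    if "x \<in> standard_simplex N" for \<mu>
    unfolding simplical_face_eq_vertex_map[OF that]
    by (rule vertex_map_vertex_map) (simp add: skip_def)
  have "vertex_map N (\<lambda>j. fst ((take k L @ drop (Suc k) L) ! j)) x = vertex_map N (\<lambda>j. fst (L ! skip k j)) x"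
    "vertex_map N (\<lambda>j. snd ((take k L @ drop (Suc k) L) ! j)) x = vertex_map N (\<lambda>j. snd (L ! skip k j)) x"
    by (rule vertex_map_cong; simp only: nth)+
  then show "singular_face (Suc N) k (path_simplex (Suc N) f g L) x
      = path_simplex N f g (take k L @ drop (Suc k) L) x"
    using simplical_face_in_standard_simplex[of "Suc N" k x] k
    by (simp add: singular_face_def path_simplex_def vm)
qed

lemma chain_boundary_path_simplex:
  assumes "\<And>L. L \<in> Poly_Mapping.keys c \<Longrightarrow> length L = Suc (Suc N)"
  shows "chain_boundary (Suc N) (frag_map (path_simplex (Suc N) f g) c) =
    frag_map (path_simplex N f g) (path_boundary c)"
  unfolding chain_boundary_def path_boundary_def frag_extend_frag_map frag_map_frag_extend
    if_not_P[OF Suc_not_Zero]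
proof (rule frag_extend_eq)
  fix L assume "L \<in> Poly_Mapping.keys c"
  then have L: "length L = Suc (Suc N)" by (rule assms)
  then show "(\<Sum>k\<le>Suc N. frag_cmul ((-1) ^ k) (frag_of (singular_face (Suc N) k (path_simplex (Suc N) f g L))))
      = frag_map (path_simplex N f g) (if length L \<le> 1 then 0
          else \<Sum>k<length L. frag_cmul ((-1) ^ k) (frag_of (take k L @ drop (Suc k) L)))"
    by (simp add: frag_map_sum frag_map_cmul singular_face_path_simplex lessThan_Suc_atMost del: sum.atMost_Suc sum.lessThan_Suc)
qed

text \<open>A coface on the coordinates is absorbed into the simplex \<open>f\<close> as a face.
  This translates \<open>faces1\<close> into the boundary of the left factor.\<close>

lemma path_simplex_skip1:
  assumes L: "length L = Suc N" "set L \<subseteq> {..m} \<times> {..n}"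
  shows "path_simplex N f g (map (map_prod (skip i) id) L) = path_simplex N (singular_face (Suc m) i f) g L"
proof
  fix x
  have "fst (L ! j) \<le> m" if "j \<le> N" for j
    by (rule nth_in_rectangle[OF L that])
  moreover have "vertex_map N (\<lambda>j. fst (map (map_prod (skip i) id) L ! j)) x = vertex_map N (\<lambda>j. skip i (fst (L ! j))) x"
    "vertex_map N (\<lambda>j. snd (map (map_prod (skip i) id) L ! j)) x = vertex_map N (\<lambda>j. snd (L ! j)) x"
    by (rule vertex_map_cong; simp add: L)+
  ultimately show "path_simplex N f g (map (map_prod (skip i) id) L) x = path_simplex N (singular_face (Suc m) i f) g L x"
    by (simp add: path_simplex_def singular_face_def vertex_map_in_standard_simplex
        simplical_face_eq_vertex_map[of _ m] vertex_map_vertex_map)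
qed

lemma path_simplex_skip2:
  assumes L: "length L = Suc N" "set L \<subseteq> {..m} \<times> {..n}"
  shows "path_simplex N f g (map (map_prod id (skip i)) L) = path_simplex N f (singular_face (Suc n) i g) L"
proof
  fix x
  have "snd (L ! j) \<le> n" if "j \<le> N" for j
    by (rule nth_in_rectangle[OF L that])
  moreover have "vertex_map N (\<lambda>j. snd (map (map_prod id (skip i)) L ! j)) x = vertex_map N (\<lambda>j. skip i (snd (L ! j))) x"
    "vertex_map N (\<lambda>j. fst (map (map_prod id (skip i)) L ! j)) x = vertex_map N (\<lambda>j. fst (L ! j)) x"
    by (rule vertex_map_cong; simp add: L)+
  ultimately show "path_simplex N f g (map (map_prod id (skip i)) L) x = path_simplex N f (singular_face (Suc n) i g) L x"
    by (simp add: path_simplex_def singular_face_def vertex_map_in_standard_simplex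
        simplical_face_eq_vertex_map[of _ n] vertex_map_vertex_map)
qed

lemma path_simplex_faces1:
  "frag_map (path_simplex (m + n - 1) f g) (faces1 m n) =
     chain_cross (m - 1) n (chain_boundary m (frag_of f)) (frag_of g)"
proof (cases m)
  case (Suc m')
  have "frag_map (path_simplex (m' + n) f g) (skip1 i (shuffle_paths m' n)) =
      simplex_cross m' n (singular_face (Suc m') i f) g" for i
    unfolding simplex_cross_eq_paths frag_map_frag_map
    by (rule frag_map_cong) (rule path_simplex_skip1, (erule shuffle_pathsD)+)
  then show ?thesis
    by (simp add: Suc faces1_def alt_skip1_def frag_map_sum frag_map_cmul chain_boundary_of
        chain_cross_sum_left chain_cross_cmul chain_cross_of del: sum.atMost_Suc)
qed (simp add: faces1_def chain_boundary_def)

lemma path_simplex_faces2: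
  "frag_map (path_simplex (m + n - 1) f g) (faces2 m n) =
     chain_cross m (n - 1) (frag_of f) (chain_boundary n (frag_of g))"
proof (cases n)
  case (Suc n')
  have "frag_map (path_simplex (m + n') f g) (skip2 i (shuffle_paths m n')) =
      simplex_cross m n' f (singular_face (Suc n') i g)" for i
    unfolding simplex_cross_eq_paths frag_map_frag_map
    by (rule frag_map_cong) (rule path_simplex_skip2, (erule shuffle_pathsD)+)
  then show ?thesis
    by (simp add: Suc faces2_def alt_skip2_def frag_map_sum frag_map_cmul chain_boundary_of
        chain_cross_sum_right chain_cross_cmul chain_cross_of del: sum.atMost_Suc)
qed (simp add: faces2_def chain_boundary_def)

lemma chain_boundary_simplex_cross:
  "chain_boundary (m + n) (simplex_cross m n f g) =
     chain_cross (m - 1) n (chain_boundary m (frag_of f)) (frag_of g)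
     + frag_cmul ((-1) ^ m) (chain_cross m (n - 1) (frag_of f) (chain_boundary n (frag_of g)))"
proof (cases "m + n")
  case 0
  then show ?thesis by (simp add: chain_boundary_def)
next
  case (Suc N)
  have "chain_boundary (m + n) (simplex_cross m n f g) =
      frag_map (path_simplex N f g) (path_boundary (shuffle_paths m n))"
    unfolding simplex_cross_eq_paths Suc
    by (rule chain_boundary_path_simplex) (metis Suc shuffle_pathsD(1))
  moreover have "N = m + n - 1" using Suc by simp
  ultimately show ?thesis
    by (simp only: path_boundary_shuffle_paths frag_map_add frag_map_cmul path_simplex_faces1 path_simplex_faces2)
qed

text \<open>The Leibniz rule needs no side condition on degrees: where \<open>m - 1\<close> or
  \<open>n - 1\<close> is truncated, the boundary in degree 0 is 0. It is an identity of formal sums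
  of arbitrary functions, so topology does not enter.\<close>

proposition chain_boundary_chain_cross:
  "chain_boundary (m + n) (chain_cross m n a b) =
     chain_cross (m - 1) n (chain_boundary m a) b
     + frag_cmul ((-1) ^ m) (chain_cross m (n - 1) a (chain_boundary n b))"
proof (rule frag_linear_eqI[of _ _ a])
  fix f
  show "chain_boundary (m + n) (chain_cross m n (frag_of f) b) =
     chain_cross (m - 1) n (chain_boundary m (frag_of f)) b
     + frag_cmul ((-1) ^ m) (chain_cross m (n - 1) (frag_of f) (chain_boundary n b))"
    by (rule frag_linear_eqI[of _ _ b])
      (simp_all add: chain_boundary_simplex_cross[simplified] chain_cross_of chain_boundary_diff chain_cross_diff frag_cmul_diff)
qed (simp_all add: chain_boundary_diff chain_cross_diff frag_cmul_diff)

text \<open>Both sides evaluate the same path simplices pointwise, so \<open>\<phi>\<close> and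
  \<open>\<psi>\<close> may be any functions. The diagonal action can thus be inserted without
  knowing it to be continuous.\<close>

lemma chain_cross_chain_map:
  "chain_cross m n (chain_map m \<phi> a) (chain_map n \<psi> b) = chain_map (m + n) (map_prod \<phi> \<psi>) (chain_cross m n a b)"
proof (rule frag_linear_eqI[of _ _ a])
  fix f
  show "chain_cross m n (chain_map m \<phi> (frag_of f)) (chain_map n \<psi> b) =
      chain_map (m + n) (map_prod \<phi> \<psi>) (chain_cross m n (frag_of f) b)"
  proof (rule frag_linear_eqI[of _ _ b])
    fix g
    have "path_simplex (m + n) (simplex_map m \<phi> f) (simplex_map n \<psi> g) L =
        simplex_map (m + n) (map_prod \<phi> \<psi>) (path_simplex (m + n) f g L)"
      if L: "L \<in> Poly_Mapping.keys (shuffle_paths m n)" for L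
    proof
      fix x
      have "fst (L ! j) \<le> m" "snd (L ! j) \<le> n" if "j \<le> m + n" for j
        by (rule nth_in_rectangle[OF shuffle_pathsD(1,2)[OF L] that])+
      then show "path_simplex (m + n) (simplex_map m \<phi> f) (simplex_map n \<psi> g) L x =
        simplex_map (m + n) (map_prod \<phi> \<psi>) (path_simplex (m + n) f g L) x"
        by (simp add: path_simplex_def simplex_map_def vertex_map_in_standard_simplex)
    qed
    then show "chain_cross m n (chain_map m \<phi> (frag_of f)) (chain_map n \<psi> (frag_of g)) =
      chain_map (m + n) (map_prod \<phi> \<psi>) (chain_cross m n (frag_of f) (frag_of g))"
      unfolding chain_map_of chain_cross_of simplex_cross_eq_paths frag_map_def
      unfolding chain_map_def frag_extend_frag_extend
      by (intro frag_extend_eq) simp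
  qed (simp_all add: chain_map_diff chain_cross_diff)
qed (simp_all add: chain_map_diff chain_cross_diff)

section \<open>Associativity of the cross product\<close>

text \<open>The first coordinate of a vertex of \<open>R\<close> is a position in the path
  \<open>S\<close>; looking it up yields a path in the three-dimensional lattice. This is the effect
  on vertices of one \<open>path_simplex\<close> nested in another. In \<open>right_paths\<close>
  the roles are mirrored.\<close>

definition left_paths :: "((nat \<times> nat) list \<Rightarrow>\<^sub>0 int) \<Rightarrow> ((nat \<times> nat) list \<Rightarrow>\<^sub>0 int) \<Rightarrow> (nat \<times> nat \<times> nat) list \<Rightarrow>\<^sub>0 int" where
  "left_paths A B = frag_extend (\<lambda>R. frag_map (\<lambda>S. map (\<lambda>(k, z). (fst (S ! k), snd (S ! k), z)) R) A) B"

definition right_paths :: "((nat \<times> nat) list \<Rightarrow>\<^sub>0 int) \<Rightarrow> ((nat \<times> nat) list \<Rightarrow>\<^sub>0 int) \<Rightarrow> (nat \<times> nat \<times> nat) list \<Rightarrow>\<^sub>0 int" where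
  "right_paths A B = frag_extend (\<lambda>R. frag_map (\<lambda>S. map (\<lambda>(x, k). (x, S ! k)) R) A) B"

lemma left_paths_add: "left_paths (A + A') B = left_paths A B + left_paths A' B"
    "left_paths A (B + B') = left_paths A B + left_paths A B'"
  and left_paths_cmul: "left_paths (frag_cmul k A) B = frag_cmul k (left_paths A B)"
    "left_paths A (frag_cmul k B) = frag_cmul k (left_paths A B)"
  and left_paths_0: "left_paths 0 B = 0" "left_paths A 0 = 0"
  by (simp_all add: left_paths_def frag_map_add frag_map_cmul frag_extend_add_fun frag_extend_cmul_fun
      frag_extend_add frag_extend_cmul frag_extend_eq_0)

lemma right_paths_add: "right_paths (A + A') B = right_paths A B + right_paths A' B"
    "right_paths A (B + B') = right_paths A B + right_paths A B'"
  and right_paths_cmul: "right_paths (frag_cmul k A) B = frag_cmul k (right_paths A B)"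
    "right_paths A (frag_cmul k B) = frag_cmul k (right_paths A B)"
  and right_paths_0: "right_paths 0 B = 0" "right_paths A 0 = 0"
  by (simp_all add: right_paths_def frag_map_add frag_map_cmul frag_extend_add_fun frag_extend_cmul_fun
      frag_extend_add frag_extend_cmul frag_extend_eq_0)

lemma left_paths_if: "left_paths A (if P then 0 else B) = (if P then 0 else left_paths A B)"
  by (simp add: left_paths_0)

lemma left_paths_snoc_right:
  assumes "\<And>S. S \<in> Poly_Mapping.keys A \<Longrightarrow> S ! k = v"
  shows "left_paths A (frag_snoc (k, z) B) = frag_snoc (fst v, snd v, z) (left_paths A B)"
  unfolding left_paths_def frag_extend_frag_map frag_map_frag_extend frag_map_frag_map
  by (intro frag_extend_eq frag_map_cong) (simp add: assms)

lemma right_paths_if: "right_paths A (if P then 0 else B) = (if P then 0 else right_paths A B)"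
  by (simp add: right_paths_0)

lemma right_paths_snoc_right:
  assumes "\<And>S. S \<in> Poly_Mapping.keys A \<Longrightarrow> S ! k = v"
  shows "right_paths A (frag_snoc (x, k) B) = frag_snoc (x, v) (right_paths A B)"
  unfolding right_paths_def frag_extend_frag_map frag_map_frag_extend frag_map_frag_map
  by (intro frag_extend_eq frag_map_cong) (simp add: assms)

text \<open>A path \<open>R\<close> that never refers to position \<open>N\<close> does not see a
  vertex appended to \<open>S\<close>. This applies when \<open>R\<close> ends before the last
  position, and it then shortens \<open>S\<close> to its predecessors.\<close>

lemma left_paths_snoc_left:
  assumes "\<And>S. S \<in> Poly_Mapping.keys A \<Longrightarrow> length S = N"
    "\<And>R. R \<in> Poly_Mapping.keys B \<Longrightarrow> fst ` set R \<subseteq> {..<N}"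
  shows "left_paths (frag_snoc v A) B = left_paths A B"
  unfolding left_paths_def frag_map_frag_map
proof (intro frag_extend_eq frag_map_cong map_cong refl)
  fix R S kz assume "R \<in> Poly_Mapping.keys B" "S \<in> Poly_Mapping.keys A" "kz \<in> set R"
  then have "fst kz < length S" using assms by fastforce
  then show "(\<lambda>(k, z). (fst ((S @ [v]) ! k), snd ((S @ [v]) ! k), z)) kz = (\<lambda>(k, z). (fst (S ! k), snd (S ! k), z)) kz"
    by (simp add: nth_append case_prod_unfold)
qed

lemma right_paths_snoc_left:
  assumes "\<And>S. S \<in> Poly_Mapping.keys A \<Longrightarrow> length S = N"
    "\<And>R. R \<in> Poly_Mapping.keys B \<Longrightarrow> snd ` set R \<subseteq> {..<N}"
  shows "right_paths (frag_snoc v A) B = right_paths A B"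
  unfolding right_paths_def frag_map_frag_map
proof (intro frag_extend_eq frag_map_cong map_cong refl)
  fix R S kz assume "R \<in> Poly_Mapping.keys B" "S \<in> Poly_Mapping.keys A" "kz \<in> set R"
  then have "snd kz < length S" using assms by fastforce
  then show "(\<lambda>(x, k). (x, (S @ [v]) ! k)) kz = (\<lambda>(x, k). (x, S ! k)) kz"
    by (simp add: nth_append case_prod_unfold)
qed

text \<open>The clauses of \<open>shuffle_paths\<close> in one formula: guards for the coordinate
  axes take the place of a case distinction.\<close>

definition prev_paths :: "nat \<Rightarrow> nat \<Rightarrow> (nat \<times> nat) list \<Rightarrow>\<^sub>0 int" where
  "prev_paths m n = (if n = 0 then 0 else shuffle_paths m (n - 1))
     + frag_cmul ((-1) ^ n) (if m = 0 then 0 else shuffle_paths (m - 1) n)"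

lemma shuffle_paths_rec: "m + n > 0 \<Longrightarrow> shuffle_paths m n = frag_snoc (m, n) (prev_paths m n)"
  by (cases m; cases n) (simp_all add: prev_paths_def)

lemma prev_paths_length:
  assumes "L \<in> Poly_Mapping.keys (prev_paths m n)" shows "length L = m + n"
proof -
  have "L \<in> Poly_Mapping.keys (if n = 0 then 0 else shuffle_paths m (n - 1)) \<union>
      Poly_Mapping.keys (if m = 0 then 0 else shuffle_paths (m - 1) n)"
    by (rule subsetD[OF order_trans[OF keys_add Un_mono[OF order_refl keys_cmul]] assms[unfolded prev_paths_def]])
  then show ?thesis
    by (auto split: if_splits dest: shuffle_pathsD(1))
qed

text \<open>Both sides satisfy the recursion on the last vertex of a path in the three-dimensional lattice.\<close>

lemma shuffle_paths_assoc:
  "left_paths (shuffle_paths m n) (shuffle_paths (m + n) l) =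
   right_paths (shuffle_paths n l) (shuffle_paths m (n + l))"
proof (induction "m + n + l" arbitrary: m n l rule: less_induct)
  case less
  let ?L = "\<lambda>m n l. left_paths (shuffle_paths m n) (shuffle_paths (m + n) l)"
  let ?R = "\<lambda>m n l. right_paths (shuffle_paths n l) (shuffle_paths m (n + l))"
  show ?case
  proof (cases "m + n + l = 0")
    case True
    then show ?thesis by (simp add: left_paths_def right_paths_def)
  next
    case False
    have L2: "left_paths (shuffle_paths m n) (shuffle_paths (m + n - 1) l) =
        (if n = 0 then 0 else ?L m (n - 1) l) + frag_cmul ((-1) ^ n) (if m = 0 then 0 else ?L (m - 1) n l)"
      if "m + n > 0"
    proof -
      have "left_paths (shuffle_paths m n) (shuffle_paths (m + n - 1) l) =
          left_paths (prev_paths m n) (shuffle_paths (m + n - 1) l)"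
        unfolding shuffle_paths_rec[OF that]
      proof (rule left_paths_snoc_left)
        show "length S = m + n" if "S \<in> Poly_Mapping.keys (prev_paths m n)" for S
          using that by (rule prev_paths_length)
        show "fst ` set R \<subseteq> {..<m + n}" if "R \<in> Poly_Mapping.keys (shuffle_paths (m + n - 1) l)" for R
        proof
          fix k assume "k \<in> fst ` set R"
          then have "k \<le> m + n - 1" using subsetD[OF shuffle_pathsD(2)[OF that]] by auto
          then show "k \<in> {..<m + n}" using \<open>m + n > 0\<close> unfolding lessThan_iff by linarith
        qed
      qed
      then show ?thesis
        by (simp add: prev_paths_def left_paths_add left_paths_cmul left_paths_0)
    qed
    have R2: "right_paths (shuffle_paths n l) (shuffle_paths m (n + l - 1)) =
        (if l = 0 then 0 else ?R m n (l - 1)) + frag_cmul ((-1) ^ l) (if n = 0 then 0 else ?R m (n - 1) l)"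
      if "n + l > 0"
    proof -
      have "right_paths (shuffle_paths n l) (shuffle_paths m (n + l - 1)) =
          right_paths (prev_paths n l) (shuffle_paths m (n + l - 1))"
        unfolding shuffle_paths_rec[OF that]
      proof (rule right_paths_snoc_left)
        show "length S = n + l" if "S \<in> Poly_Mapping.keys (prev_paths n l)" for S
          using that by (rule prev_paths_length)
        show "snd ` set R \<subseteq> {..<n + l}" if "R \<in> Poly_Mapping.keys (shuffle_paths m (n + l - 1))" for R
        proof
          fix k assume "k \<in> snd ` set R"
          then have "k \<le> n + l - 1" using subsetD[OF shuffle_pathsD(2)[OF that]] by auto
          then show "k \<in> {..<n + l}" using \<open>n + l > 0\<close> unfolding lessThan_iff by linarith
        qed
      qed
      then show ?thesis
        by (simp add: prev_paths_def right_paths_add right_paths_cmul right_paths_0)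
    qed
    have L2': "(if m + n = 0 then 0 else left_paths (shuffle_paths m n) (shuffle_paths (m + n - 1) l)) =
        (if n = 0 then 0 else ?L m (n - 1) l) + frag_cmul ((-1) ^ n) (if m = 0 then 0 else ?L (m - 1) n l)"
      using L2 by (cases "m + n = 0") simp_all
    have R2': "(if n + l = 0 then 0 else right_paths (shuffle_paths n l) (shuffle_paths m (n + l - 1))) =
        (if l = 0 then 0 else ?R m n (l - 1)) + frag_cmul ((-1) ^ l) (if n = 0 then 0 else ?R m (n - 1) l)"
      using R2 by (cases "n + l = 0") simp_all
    have IH: "(if l = 0 then 0 else ?L m n (l - 1)) = (if l = 0 then 0 else ?R m n (l - 1))"
      "(if n = 0 then 0 else ?L m (n - 1) l) = (if n = 0 then 0 else ?R m (n - 1) l)"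
      "(if m = 0 then 0 else ?L (m - 1) n l) = (if m = 0 then 0 else ?R (m - 1) n l)"
      by (rule if_cong[OF refl refl], rule less, simp)+
    have "?L m n l = frag_snoc (m, n, l) (left_paths (shuffle_paths m n) (prev_paths (m + n) l))"
      unfolding shuffle_paths_rec[of "m + n" l, OF False[unfolded neq0_conv]]
      using left_paths_snoc_right[of "shuffle_paths m n" "m + n" "(m, n)"] shuffle_pathsD(3) by simp
    \<comment> \<open>A last step in the third, second or first direction carries the sign 1,
      \<open>(-1) ^ l\<close> or \<open>(-1) ^ (n + l)\<close>. The right-hand nesting gives the
      same three signs.\<close>
    also have "left_paths (shuffle_paths m n) (prev_paths (m + n) l) =
        (if l = 0 then 0 else ?L m n (l - 1))
        + frag_cmul ((-1) ^ l) ((if n = 0 then 0 else ?L m (n - 1) l)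
            + frag_cmul ((-1) ^ n) (if m = 0 then 0 else ?L (m - 1) n l))"
      unfolding prev_paths_def left_paths_add left_paths_cmul
      using L2' by (simp only: left_paths_if)
    also have "\<dots> = (if l = 0 then 0 else ?R m n (l - 1))
        + frag_cmul ((-1) ^ l) ((if n = 0 then 0 else ?R m (n - 1) l)
            + frag_cmul ((-1) ^ n) (if m = 0 then 0 else ?R (m - 1) n l))"
      by (simp only: IH)
    also have "\<dots> = right_paths (shuffle_paths n l) (prev_paths m (n + l))"
      unfolding prev_paths_def right_paths_add right_paths_cmul
      unfolding right_paths_if R2' by (simp add: frag_cmul_distrib2 power_add add.assoc mult.commute)
    also have "frag_snoc (m, n, l) \<dots> = ?R m n l"
      unfolding shuffle_paths_rec[of m "n + l", OF False[unfolded neq0_conv add.assoc]]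
      using right_paths_snoc_right[of "shuffle_paths n l" "n + l" "(n, l)"] shuffle_pathsD(3) by simp
    finally show ?thesis .
  qed
qed

section \<open>From three-dimensional paths to simplices of a triple product\<close>

definition triple_simplex ::
    "nat \<Rightarrow> ((nat \<Rightarrow> real) \<Rightarrow> 'a) \<Rightarrow> ((nat \<Rightarrow> real) \<Rightarrow> 'b) \<Rightarrow> ((nat \<Rightarrow> real) \<Rightarrow> 'c) \<Rightarrow>
     (nat \<times> nat \<times> nat) list \<Rightarrow> (nat \<Rightarrow> real) \<Rightarrow> 'a \<times> 'b \<times> 'c" where
  "triple_simplex N f g h L = (\<lambda>x\<in>standard_simplex N.
     (f (vertex_map N (\<lambda>j. fst (L ! j)) x), g (vertex_map N (\<lambda>j. fst (snd (L ! j))) x),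
      h (vertex_map N (\<lambda>j. snd (snd (L ! j))) x)))"

abbreviation reassoc :: "('a \<times> 'b) \<times> 'c \<Rightarrow> 'a \<times> 'b \<times> 'c" where
  "reassoc \<equiv> \<lambda>((x, y), z). (x, y, z)"

lemma path_simplex_left:
  assumes R: "length R = Suc N" "set R \<subseteq> {..M} \<times> {..l}"
  shows "simplex_map N reassoc (path_simplex N (path_simplex M f g S) h R) =
    triple_simplex N f g h (map (\<lambda>(k, z). (fst (S ! k), snd (S ! k), z)) R)"
proof
  fix x
  let ?T = "map (\<lambda>(k, z). (fst (S ! k), snd (S ! k), z)) R"
  have nth: "?T ! j = (fst (S ! fst (R ! j)), snd (S ! fst (R ! j)), snd (R ! j))" if "j \<le> N" for j
    using that R(1) by (simp add: case_prod_unfold)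
  have "vertex_map N (\<lambda>j. fst (?T ! j)) x = vertex_map N (\<lambda>j. fst (S ! fst (R ! j))) x"
    "vertex_map N (\<lambda>j. fst (snd (?T ! j))) x = vertex_map N (\<lambda>j. snd (S ! fst (R ! j))) x"
    "vertex_map N (\<lambda>j. snd (snd (?T ! j))) x = vertex_map N (\<lambda>j. snd (R ! j)) x"
    by (rule vertex_map_cong; simp only: nth fst_conv snd_conv)+
  moreover have "fst (R ! j) \<le> M" if "j \<le> N" for j
    by (rule nth_in_rectangle[OF R that])
  ultimately show "simplex_map N reassoc (path_simplex N (path_simplex M f g S) h R) x = triple_simplex N f g h ?T x"
    by (simp add: path_simplex_def triple_simplex_def simplex_map_def vertex_map_in_standard_simplex vertex_map_vertex_map)
qed

lemma path_simplex_right: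
  assumes R: "length R = Suc N" "set R \<subseteq> {..m} \<times> {..M}"
  shows "path_simplex N f (path_simplex M g h S) R =
    triple_simplex N f g h (map (\<lambda>(x, k). (x, S ! k)) R)"
proof
  fix x
  let ?T = "map (\<lambda>(x, k). (x, S ! k)) R"
  have nth: "?T ! j = (fst (R ! j), S ! snd (R ! j))" if "j \<le> N" for j
    using that R(1) by (simp add: case_prod_unfold)
  have "vertex_map N (\<lambda>j. fst (?T ! j)) x = vertex_map N (\<lambda>j. fst (R ! j)) x"
    "vertex_map N (\<lambda>j. fst (snd (?T ! j))) x = vertex_map N (\<lambda>j. fst (S ! snd (R ! j))) x"
    "vertex_map N (\<lambda>j. snd (snd (?T ! j))) x = vertex_map N (\<lambda>j. snd (S ! snd (R ! j))) x"
    by (rule vertex_map_cong; simp only: nth fst_conv snd_conv)+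
  moreover have "snd (R ! j) \<le> M" if "j \<le> N" for j
    by (rule nth_in_rectangle[OF R that])
  ultimately show "path_simplex N f (path_simplex M g h S) R x = triple_simplex N f g h ?T x"
    by (simp add: path_simplex_def triple_simplex_def vertex_map_in_standard_simplex vertex_map_vertex_map)
qed

proposition chain_cross_assoc:
  "chain_map (m + n + l) reassoc (chain_cross (m + n) l (chain_cross m n a b) c) =
   chain_cross m (n + l) a (chain_cross n l b c)"
proof (rule frag_linear_eqI[of _ _ a])
  fix f
  show "chain_map (m + n + l) reassoc (chain_cross (m + n) l (chain_cross m n (frag_of f) b) c) =
      chain_cross m (n + l) (frag_of f) (chain_cross n l b c)"
  proof (rule frag_linear_eqI[of _ _ b])
    fix g
    show "chain_map (m + n + l) reassoc (chain_cross (m + n) l (chain_cross m n (frag_of f) (frag_of g)) c) =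
        chain_cross m (n + l) (frag_of f) (chain_cross n l (frag_of g) c)"
    proof (rule frag_linear_eqI[of _ _ c])
      fix h
      let ?N = "m + n + l"
      have "chain_map ?N reassoc (chain_cross (m + n) l (simplex_cross m n f g) (frag_of h)) =
          frag_extend (\<lambda>S. frag_extend (\<lambda>R.
            frag_of (simplex_map ?N reassoc (path_simplex ?N (path_simplex (m + n) f g S) h R)))
            (shuffle_paths (m + n) l)) (shuffle_paths m n)"
        unfolding chain_cross_def simplex_cross_eq_paths frag_extend_frag_map frag_extend_of
        unfolding chain_map_def frag_map_def frag_extend_frag_extend frag_extend_of comp_def ..
      \<comment> \<open>The cross product has the inner path \<open>S\<close> outside, since it
        belongs to the left factor; \<open>left_paths\<close> has the outer path \<open>R\<close>
        outside.\<close>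
      also have "\<dots> = frag_extend (\<lambda>R. frag_extend (\<lambda>S.
            frag_of (simplex_map ?N reassoc (path_simplex ?N (path_simplex (m + n) f g S) h R)))
            (shuffle_paths m n)) (shuffle_paths (m + n) l)"
        by (rule frag_extend_swap)
      also have "\<dots> = frag_map (triple_simplex ?N f g h) (left_paths (shuffle_paths m n) (shuffle_paths (m + n) l))"
        unfolding left_paths_def frag_map_frag_extend frag_map_frag_map unfolding frag_map_def
        using shuffle_pathsD[of _ "m + n" l]
        by (intro frag_extend_eq arg_cong[where f=frag_of] path_simplex_left) auto
      also have "\<dots> = frag_map (triple_simplex ?N f g h) (right_paths (shuffle_paths n l) (shuffle_paths m (n + l)))"
        by (simp only: shuffle_paths_assoc)
      also have "\<dots> = frag_extend (\<lambda>R. frag_extend (\<lambda>S.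
            frag_of (path_simplex ?N f (path_simplex (n + l) g h S) R))
            (shuffle_paths n l)) (shuffle_paths m (n + l))"
        unfolding right_paths_def frag_map_frag_extend frag_map_frag_map unfolding frag_map_def
        using shuffle_pathsD[of _ m "n + l"]
        by (intro frag_extend_eq arg_cong[where f=frag_of] path_simplex_right[symmetric]) (auto simp: add.assoc)
      also have "\<dots> = frag_extend (\<lambda>S. frag_extend (\<lambda>R.
            frag_of (path_simplex ?N f (path_simplex (n + l) g h S) R))
            (shuffle_paths m (n + l))) (shuffle_paths n l)"
        by (rule frag_extend_swap)
      also have "\<dots> = chain_cross m (n + l) (frag_of f) (simplex_cross n l g h)"
        unfolding chain_cross_def simplex_cross_eq_paths frag_extend_frag_map frag_extend_of
        unfolding frag_map_def add.assoc ..
      finally show "chain_map ?N reassoc (chain_cross (m + n) l (chain_cross m n (frag_of f) (frag_of g)) (frag_of h)) =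
          chain_cross m (n + l) (frag_of f) (chain_cross n l (frag_of g) (frag_of h))"
        by (simp only: chain_cross_of)
    qed (simp_all add: chain_map_diff chain_cross_diff)
  qed (simp_all add: chain_map_diff chain_cross_diff)
qed (simp_all add: chain_map_diff chain_cross_diff)

section \<open>Compact Hausdorff probes\<close>

lemma quotient_map_quotient_topology: "quotient_map X (quotient_topology X q) q"
proof -
  have "openin (quotient_topology X q) (q ` topspace X)"
  proof -
    have "{x \<in> topspace X. q x \<in> q ` topspace X} = topspace X" by auto
    then show ?thesis by (simp only: openin_quotient_topology openin_topspace order_refl simp_thms)
  qed
  moreover have "topspace (quotient_topology X q) \<subseteq> q ` topspace X"
    using openin_topspace[of "quotient_topology X q"] by (simp only: openin_quotient_topology)
  ultimately have "topspace (quotient_topology X q) = q ` topspace X"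
    using openin_subset by blast
  then show ?thesis by (simp add: quotient_map_def openin_quotient_topology)
qed

lemma topspace_quotient_topology: "topspace (quotient_topology X q) = q ` topspace X"
  using quotient_map_quotient_topology[of X q] by (simp add: quotient_map_def)

text \<open>
  Compact Hausdorff spaces on arbitrary types may be used as test spaces: a section of \<open>f\<close>
  has compact closure \<open>K1\<close>, and a point of \<open>K1\<close> is determined by the sets in whose image
  under the section it is adherent.
\<close>

lemma weak_Hausdorff_closedin_image:
  fixes K :: "'k topology" and X :: "'a topology"
  assumes X: "weak_Hausdorff X" and K: "compact_space K" "Hausdorff_space K"
    and f: "continuous_map K X f"
  shows "closedin X (f ` topspace K)"
proof -
  define s where "s b = (SOME k. k \<in> topspace K \<and> f k = b)" for b
  have s: "s b \<in> topspace K \<and> f (s b) = b" if "b \<in> f ` topspace K" for b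
    unfolding s_def by (rule someI_ex) (use that in auto)
  define B where "B = f ` topspace K"
  define K1 where "K1 = K closure_of (s ` B)"
  define L where "L = subtopology K K1"
  have sB: "s ` B \<subseteq> topspace K" using s B_def by auto
  have K1: "closedin K K1" "K1 \<subseteq> topspace K" "s ` B \<subseteq> K1"
    using sB by (auto simp: K1_def closure_of_subset closure_of_subset_topspace)
  have L: "compact_space L" "Hausdorff_space L" "topspace L = K1"
    using K K1 by (auto simp: L_def Hausdorff_space_subtopology closedin_compact_space compact_space_subtopology)
  define e where "e k = {A. A \<subseteq> B \<and> k \<in> K closure_of (s ` A)}" for k
  have "inj_on e K1"
  proof (rule inj_onI, rule ccontr)
    fix k k' assume k: "k \<in> K1" "k' \<in> K1" "e k = e k'" "k \<noteq> k'"
    then obtain U V where UV: "openin K U" "openin K V" "k \<in> U" "k' \<in> V" "disjnt U V"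
      using K(2) K1(2) unfolding Hausdorff_space_def by (metis subsetD)
    \<comment> \<open>The chosen points are dense in \<open>K1\<close>, so \<open>k\<close> is
      adherent to those over \<open>A\<close>; the neighbourhood \<open>V\<close> keeps
      \<open>k'\<close> away from them. Hence \<open>A\<close> tells \<open>e k\<close> from
      \<open>e k'\<close>.\<close>
    define A where "A = {b \<in> B. s b \<in> U}"
    have "k \<in> K closure_of (s ` A)"
      unfolding in_closure_of
    proof (intro conjI allI impI)
      show "k \<in> topspace K" using k(1) K1(2) by auto
      fix T assume T: "k \<in> T \<and> openin K T"
      then have "k \<in> T \<inter> U" "openin K (T \<inter> U)" using UV by auto
      then obtain y where "y \<in> s ` B" "y \<in> T \<inter> U"
        using k(1) unfolding K1_def in_closure_of by blast
      then show "\<exists>y. y \<in> s ` A \<and> y \<in> T" by (auto simp: A_def)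
    qed
    then have "A \<in> e k'" using k(3) by (auto simp: e_def A_def)
    then obtain y where "y \<in> s ` A" "y \<in> V"
      using UV(2,4) unfolding e_def in_closure_of by blast
    then show False using UV(5) by (auto simp: A_def disjnt_iff)
  qed
  then have inj: "inj_on e (topspace L)" using L by simp
  \<comment> \<open>Transports \<open>L\<close> along the injection \<open>e\<close> to the type
    over which \<open>weak_Hausdorff\<close> quantifies.\<close>
  define E where "E = quotient_topology L e"
  have q: "quotient_map L E e" unfolding E_def by (rule quotient_map_quotient_topology)
  have "homeomorphic_map L E e"
    using q inj by (simp add: homeomorphic_map_def)
  then have LE: "L homeomorphic_space E" by (rule homeomorphic_map_imp_homeomorphic_space)
  define g where "g = f \<circ> inv_into (topspace L) e"
  have ge: "g (e k) = f k" if "k \<in> topspace L" for k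
    using that inj by (simp add: g_def)
  have "continuous_map L X f" unfolding L_def by (intro continuous_map_from_subtopology f)
  then have "continuous_map L X (g \<circ> e)" by (rule continuous_map_eq) (simp add: ge)
  with q have "continuous_map E X g" by (rule continuous_compose_quotient_map)
  moreover have "compact_space E" "Hausdorff_space E"
    using L LE homeomorphic_compact_space homeomorphic_Hausdorff_space by blast+
  ultimately have "closedin X (g ` topspace E)"
    using X unfolding weak_Hausdorff_def by blast
  also have "g ` topspace E = f ` topspace L"
    unfolding quotient_imp_surjective_map[OF q, symmetric] image_image by (rule image_cong) (simp_all add: ge)
  also have "\<dots> = f ` topspace K"
  proof
    show "f ` topspace L \<subseteq> f ` topspace K" using L K1 by auto
    show "f ` topspace K \<subseteq> f ` topspace L"
    proof
      fix b assume "b \<in> f ` topspace K"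
      then have "b = f (s b)" "s b \<in> topspace L" using s K1(3) L(3) B_def by auto
      then show "b \<in> f ` topspace L" by blast
    qed
  qed
  finally show ?thesis .
qed

text \<open>A compact Hausdorff space is normal, and a closed continuous surjection passes normality
  and closed points on. Closedness of images is a hypothesis because it has different sources for
  weak Hausdorff spaces and for orbit spaces.\<close>

lemma Hausdorff_image_of_closed_images:
  assumes K: "compact_space K" "Hausdorff_space K" and f: "continuous_map K X f"
    and closed: "\<And>C. closedin K C \<Longrightarrow> closedin X (f ` C)"
  shows "Hausdorff_space (subtopology X (f ` topspace K))"
proof -
  let ?Y = "subtopology X (f ` topspace K)"
  have sub: "f ` topspace K \<subseteq> topspace X" using f by (auto simp: continuous_map_def)
  have "closed_map K ?Y f"
    unfolding closed_map_def
    using closed closedin_subset by (fastforce intro: closedin_subset_topspace)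
  moreover have "continuous_map K ?Y f"
    using f by (simp add: continuous_map_in_subtopology)
  moreover have "f ` topspace K = topspace ?Y" using sub by auto
  moreover have "normal_space K"
    using K compact_Hausdorff_or_regular_imp_normal_space by blast
  ultimately show ?thesis
    using normal_Hausdorff_space_closed_continuous_map_image[of K ?Y f] K(2) by blast
qed

lemma weak_Hausdorff_Hausdorff_image:
  assumes X: "weak_Hausdorff X" and K: "compact_space K" "Hausdorff_space K"
    and f: "continuous_map K X f"
  shows "Hausdorff_space (subtopology X (f ` topspace K))"
proof (rule Hausdorff_image_of_closed_images[OF K f])
  fix C assume C: "closedin K C"
  then have "compact_space (subtopology K C)" "topspace (subtopology K C) = C"
    using K(1) closedin_compact_space compact_space_subtopology closedin_subset by fastforce+
  moreover have "Hausdorff_space (subtopology K C)"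
    using K(2) by (rule Hausdorff_space_subtopology)
  ultimately show "closedin X (f ` C)"
    using weak_Hausdorff_closedin_image[OF X, of "subtopology K C" f] f
    by (simp add: continuous_map_from_subtopology)
qed

section \<open>Maps out of and into a \<open>k\<close>-ification\<close>

lemma continuous_map_from_kify:
  assumes "continuous_map Y Z f"
  shows "continuous_map (kify Y) Z f"
proof -
  have "openin (kify Y) U" if "openin Y U" for U
    using that unfolding openin_kify
    by (auto simp: openin_subset Int_commute intro: openin_subtopology_Int2)
  then show ?thesis using assms by (simp add: continuous_map_def)
qed

text \<open>If the image of the compact space \<open>T\<close> is Hausdorff, it is itself one of the
  subspaces on which \<open>k\<close>-open sets are tested.\<close>

lemma continuous_map_into_kify:
  assumes T: "compact_space T" and f: "continuous_map T Y f"
    and haus: "Hausdorff_space (subtopology Y (f ` topspace T))"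
  shows "continuous_map T (kify Y) f"
  unfolding continuous_map_def
proof (intro conjI allI impI)
  show "f \<in> topspace T \<rightarrow> topspace (kify Y)" using f by (auto simp: continuous_map_def)
  fix U assume U: "openin (kify Y) U"
  let ?K = "f ` topspace T"
  have "compactin Y ?K" using T f unfolding compact_space_def by (rule image_compactin)
  then have "openin (subtopology Y ?K) (U \<inter> ?K)"
    using U haus unfolding openin_kify by blast
  moreover have "continuous_map T (subtopology Y ?K) f"
    using f by (simp add: continuous_map_in_subtopology)
  ultimately have "openin T {x \<in> topspace T. f x \<in> U \<inter> ?K}"
    by (intro openin_continuous_map_preimage)
  then show "openin T {x \<in> topspace T. f x \<in> U}"
    by (rule back_subst[where P="openin T"]) auto
qed

text \<open>The tube lemma: the complement is the projection of a closed set along a compact factor,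
  and such projections are closed maps.\<close>

lemma openin_forall_compactin:
  assumes V: "openin (prod_topology X Y) V" and N: "compactin Y N"
  shows "openin X {x \<in> topspace X. \<forall>y\<in>N. (x, y) \<in> V}"
proof -
  have NY: "N \<subseteq> topspace Y" using N compactin_subset_topspace by blast
  have "closed_map (prod_topology X (subtopology Y N)) X fst"
    by (rule Abstract_Topological_Spaces.closed_map_fst) (simp add: N compact_space_subtopology)
  moreover have "closedin (prod_topology X (subtopology Y N)) (topspace X \<times> N - V)"
  proof -
    have "openin (prod_topology X (subtopology Y N)) (V \<inter> (topspace X \<times> N))"
      unfolding prod_topology_subtopology(2) using V by (rule openin_subtopology_Int)
    moreover have "topspace (prod_topology X (subtopology Y N)) = topspace X \<times> N" using NY by auto
    moreover have "topspace X \<times> N - V = topspace X \<times> N - V \<inter> (topspace X \<times> N)" by blast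
    ultimately show ?thesis by (metis openin_closedin_eq closedin_def openin_subset Diff_Diff_Int inf.absorb_iff2 closedin_diff closedin_topspace)
  qed
  ultimately have "closedin X (fst ` (topspace X \<times> N - V))" unfolding closed_map_def by blast
  moreover have "{x \<in> topspace X. \<forall>y\<in>N. (x, y) \<in> V} = topspace X - fst ` (topspace X \<times> N - V)"
    by force
  ultimately show ?thesis by (simp add: openin_diff)
qed

text \<open>The separation property that makes \<open>kify\<close> invisible to singular chains. It
  follows from weak Hausdorffness and passes to ordinary products, for which only the images of the
  coordinates have to be inspected.\<close>

definition simplex_Hausdorff :: "'a topology \<Rightarrow> bool" where
  "simplex_Hausdorff X \<longleftrightarrow> (\<forall>n s. singular_simplex n X s \<longrightarrow>
     Hausdorff_space (subtopology X (s ` standard_simplex n)))"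

abbreviation simplex_space :: "nat \<Rightarrow> (nat \<Rightarrow> real) topology" where
  "simplex_space n \<equiv> subtopology (powertop_real UNIV) (standard_simplex n)"

lemma simplex_space: "compact_space (simplex_space n)" "Hausdorff_space (simplex_space n)"
  using compactin_standard_simplex[of n]
  by (auto simp: compact_space_subtopology Hausdorff_space_subtopology Hausdorff_space_product_topology)

lemma singular_simplex_restrict:
  "continuous_map (simplex_space n) X s \<Longrightarrow> singular_simplex n X (restrict s (standard_simplex n))"
  by (simp add: singular_simplex_def)

lemma weak_Hausdorff_simplex_Hausdorff: "weak_Hausdorff X \<Longrightarrow> simplex_Hausdorff X"
  unfolding simplex_Hausdorff_def singular_simplex_def
  using weak_Hausdorff_Hausdorff_image[OF _ simplex_space] by (metis topspace_standard_simplex)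

lemma Hausdorff_simplex_Hausdorff: "Hausdorff_space X \<Longrightarrow> simplex_Hausdorff X"
  by (simp add: simplex_Hausdorff_def Hausdorff_space_subtopology)

lemma simplex_Hausdorff_prod:
  assumes "simplex_Hausdorff X" "simplex_Hausdorff Y"
  shows "simplex_Hausdorff (prod_topology X Y)"
  unfolding simplex_Hausdorff_def
proof (intro allI impI)
  fix n s assume s: "singular_simplex n (prod_topology X Y) s"
  let ?D = "standard_simplex n"
  let ?f = "restrict (fst \<circ> s) ?D" and ?g = "restrict (snd \<circ> s) ?D"
  have "singular_simplex n X ?f" "singular_simplex n Y ?g"
    using s by (auto simp: singular_simplex_def continuous_map_pairwise)
  then have "Hausdorff_space (subtopology X (?f ` ?D))" "Hausdorff_space (subtopology Y (?g ` ?D))"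
    using assms unfolding simplex_Hausdorff_def by blast+
  then have "Hausdorff_space (subtopology (prod_topology X Y) (?f ` ?D \<times> ?g ` ?D))"
    unfolding subtopology_Times Hausdorff_space_prod_topology by blast
  then have "Hausdorff_space (subtopology (subtopology (prod_topology X Y) (?f ` ?D \<times> ?g ` ?D)) (s ` ?D))"
    by (rule Hausdorff_space_subtopology)
  moreover have "?f ` ?D \<times> ?g ` ?D \<inter> s ` ?D = s ` ?D"
    by (auto simp: image_iff split: prod.splits) (metis fst_conv snd_conv)+
  ultimately show "Hausdorff_space (subtopology (prod_topology X Y) (s ` ?D))"
    by (simp only: subtopology_subtopology)
qed

lemma singular_simplex_kify:
  assumes "simplex_Hausdorff X"
  shows "singular_simplex n (kify X) s \<longleftrightarrow> singular_simplex n X s"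
proof
  assume "singular_simplex n (kify X) s"
  moreover have "continuous_map (kify X) X id" by (intro continuous_map_from_kify continuous_map_id)
  ultimately show "singular_simplex n X s"
    unfolding singular_simplex_def using continuous_map_compose[of _ "kify X" s X id] by (simp add: id_comp)
next
  assume s: "singular_simplex n X s"
  then have "Hausdorff_space (subtopology X (s ` standard_simplex n))"
    using assms by (simp add: simplex_Hausdorff_def)
  with s show "singular_simplex n (kify X) s"
    using continuous_map_into_kify[OF simplex_space(1)[of n], of X s] by (simp add: singular_simplex_def)
qed

lemma singular_simplex_kprod:
  assumes "simplex_Hausdorff X" "simplex_Hausdorff Y"
  shows "singular_simplex n (kprod X Y) s \<longleftrightarrow> singular_simplex n (prod_topology X Y) s"
  unfolding kprod_def by (rule singular_simplex_kify[OF simplex_Hausdorff_prod[OF assms]])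

lemma CGWH_closedin:
  assumes X: "CGWH X" and A: "A \<subseteq> topspace X"
    and "\<And>K. compactin X K \<Longrightarrow> Hausdorff_space (subtopology X K) \<Longrightarrow> closedin (subtopology X K) (A \<inter> K)"
  shows "closedin X A"
  using assms unfolding CGWH_def k_closed_def by blast

lemma CGWH_openin:
  assumes X: "CGWH X" and A: "A \<subseteq> topspace X"
    and "\<And>K. compactin X K \<Longrightarrow> Hausdorff_space (subtopology X K) \<Longrightarrow> openin (subtopology X K) (A \<inter> K)"
  shows "openin X A"
proof -
  have "k_closed X (topspace X - A)" using k_closed_compl[OF A] assms(3) by blast
  then show ?thesis using X A by (simp add: CGWH_def openin_closedin_eq)
qed

section \<open>Orbit spaces\<close>

locale finite_right_action = group G for G (structure) +
  fixes X :: "'x topology" and act :: "'x \<Rightarrow> 'a \<Rightarrow> 'x"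
  assumes action: "right_action G X act" and finite: "finite (carrier G)"
begin

abbreviation orb :: "'x \<Rightarrow> 'x set" where "orb x \<equiv> act x ` carrier G"

abbreviation Q :: "'x set topology" where "Q \<equiv> quotient_topology X orb"

lemma act_closed: "x \<in> topspace X \<Longrightarrow> g \<in> carrier G \<Longrightarrow> act x g \<in> topspace X"
  using action by (auto simp: right_action_def continuous_map_def)

lemma act_one: "x \<in> topspace X \<Longrightarrow> act x \<one> = x"
  and act_act: "x \<in> topspace X \<Longrightarrow> g \<in> carrier G \<Longrightarrow> h \<in> carrier G \<Longrightarrow> act (act x g) h = act x (g \<otimes> h)"
  and act_continuous: "g \<in> carrier G \<Longrightarrow> continuous_map X X (\<lambda>x. act x g)"
  using action by (auto simp: right_action_def)

lemma in_orb: "x \<in> topspace X \<Longrightarrow> x \<in> orb x"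
  using act_one[of x] by (metis image_eqI one_closed)

lemma orb_act:
  assumes "x \<in> topspace X" "g \<in> carrier G" shows "orb (act x g) = orb x"
proof
  show "orb (act x g) \<subseteq> orb x" using assms by (auto simp: act_act)
  show "orb x \<subseteq> orb (act x g)"
  proof (rule image_subsetI)
    fix h assume h: "h \<in> carrier G"
    then have "act x h = act (act x g) (inv g \<otimes> h)"
      using assms by (simp add: act_act m_assoc[symmetric])
    then show "act x h \<in> orb (act x g)" using h assms(2) by (metis image_eqI inv_closed m_closed)
  qed
qed

lemma orb_eq_iff:
  assumes "x \<in> topspace X" "y \<in> topspace X"
  shows "orb x = orb y \<longleftrightarrow> y \<in> orb x"
proof
  assume "orb x = orb y"
  then show "y \<in> orb x" using in_orb[OF assms(2)] by simp
next
  assume "y \<in> orb x"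
  then obtain g where "g \<in> carrier G" "y = act x g" by blast
  then show "orb x = orb y" using orb_act[OF assms(1)] by simp
qed

text \<open>The preimage of the image is the union of the translates of \<open>A\<close>, a finite
  union because the group is finite.\<close>

lemma closedin_orb_image:
  assumes A: "closedin X A" shows "closedin Q (orb ` A)"
proof -
  have sub: "A \<subseteq> topspace X" using A closedin_subset by blast
  have "{x \<in> topspace X. orb x \<in> orb ` A} = (\<Union>g\<in>carrier G. {x \<in> topspace X. act x g \<in> A})"
  proof (intro subset_antisym subsetI)
    fix x assume "x \<in> {x \<in> topspace X. orb x \<in> orb ` A}"
    then obtain a where "x \<in> topspace X" "a \<in> A" "orb x = orb a" by blast
    then show "x \<in> (\<Union>g\<in>carrier G. {x \<in> topspace X. act x g \<in> A})"
      using orb_eq_iff[of x a] sub by blast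
  next
    fix x assume "x \<in> (\<Union>g\<in>carrier G. {x \<in> topspace X. act x g \<in> A})"
    then obtain g where "g \<in> carrier G" "x \<in> topspace X" "act x g \<in> A" by blast
    then show "x \<in> {x \<in> topspace X. orb x \<in> orb ` A}" using orb_act[of x g] by (metis (mono_tags, lifting) imageI mem_Collect_eq)
  qed
  moreover have "closedin X (\<Union>g\<in>carrier G. {x \<in> topspace X. act x g \<in> A})"
    using finite closedin_continuous_map_preimage[OF act_continuous A] by (intro closedin_Union) auto
  moreover have "orb ` A \<subseteq> topspace Q" using sub by (auto simp: topspace_quotient_topology)
  then have "closedin X {x \<in> topspace X. orb x \<in> orb ` A} = closedin Q (orb ` A)"
    using quotient_map_quotient_topology[of X orb] unfolding quotient_map_closedin by blast
  ultimately show ?thesis by (simp only:)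
qed

text \<open>Weak Hausdorffness of the orbit space. The preimage in \<open>X\<close> is tested on a
  compact Hausdorff \<open>K\<close>: there only the closed part \<open>T0\<close> of
  \<open>T\<close> lying over the image of \<open>K\<close> matters, and its image is compact in a
  Hausdorff space, hence closed.\<close>

lemma closedin_image_in_orbit_space:
  fixes T :: "'t topology"
  assumes X: "CGWH X" and T: "compact_space T" "Hausdorff_space T" and f: "continuous_map T Q f"
  shows "closedin Q (f ` topspace T)"
proof -
  note q = quotient_map_quotient_topology[of X orb]
  have wh: "weak_Hausdorff X" using X by (simp add: CGWH_def)
  define A where "A = {x \<in> topspace X. orb x \<in> f ` topspace T}"
  have "closedin X A"
  proof (rule CGWH_closedin[OF X])
    show "A \<subseteq> topspace X" by (auto simp: A_def)
    fix K assume K: "compactin X K" "Hausdorff_space (subtopology X K)"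
    let ?K = "subtopology X K"
    have KX: "K \<subseteq> topspace X" "topspace ?K = K" using K(1) compactin_subset_topspace by fastforce+
    have cK: "compact_space ?K" using K(1) by (rule compact_space_subtopology)
    have contK: "continuous_map ?K Q orb"
      using quotient_imp_continuous_map[OF q] by (rule continuous_map_from_subtopology)
    have closedK: "closedin Q (orb ` C)" if "closedin ?K C" for C
    proof (rule closedin_orb_image)
      have "C \<subseteq> K" using that KX closedin_subset by fastforce
      moreover have "compactin ?K C" using cK that by (rule closedin_compact_space)
      ultimately have "compact_space (subtopology X C)" "topspace (subtopology X C) = C"
        using KX by (auto simp: compactin_subtopology compact_space_subtopology)
      moreover have "Hausdorff_space (subtopology X C)"
        using K(2) \<open>C \<subseteq> K\<close> Hausdorff_space_subtopology[of ?K C]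
        by (simp add: subtopology_subtopology inf.absorb2)
      ultimately show "closedin X C"
        using weak_Hausdorff_closedin_image[OF wh, of "subtopology X C" id]
        by (simp add: continuous_map_from_subtopology)
    qed
    have haus: "Hausdorff_space (subtopology Q (orb ` K))"
      using Hausdorff_image_of_closed_images[OF cK K(2) contK closedK] KX by simp
    have cl: "closedin Q (orb ` K)" using closedK[of K] KX by (metis closedin_topspace)
    define T0 where "T0 = {t \<in> topspace T. f t \<in> orb ` K}"
    have "closedin T T0" unfolding T0_def using f cl by (rule closedin_continuous_map_preimage)
    then have "compactin Q (f ` T0)"
      using T(1) f by (meson closedin_compact_space image_compactin)
    then have "compactin (subtopology Q (orb ` K)) (f ` T0)"
      by (auto simp: compactin_subtopology T0_def)
    then have "closedin (subtopology Q (orb ` K)) (f ` T0)"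
      using haus by (intro compactin_imp_closedin)
    then have "closedin Q (f ` T0)" using cl by (rule closedin_trans_full)
    then have "closedin ?K {x \<in> topspace ?K. orb x \<in> f ` T0}"
      using contK by (intro closedin_continuous_map_preimage)
    moreover have "{x \<in> topspace ?K. orb x \<in> f ` T0} = A \<inter> K"
    proof (intro subset_antisym subsetI)
      fix x assume "x \<in> A \<inter> K"
      then obtain t where "t \<in> topspace T" "orb x = f t" "x \<in> K" by (auto simp: A_def)
      then have "t \<in> T0" by (auto simp: T0_def image_iff intro: bexI[of _ x])
      then show "x \<in> {x \<in> topspace ?K. orb x \<in> f ` T0}" using \<open>orb x = f t\<close> \<open>x \<in> K\<close> KX by auto
    qed (use KX in \<open>auto simp: A_def T0_def\<close>)
    ultimately show "closedin ?K (A \<inter> K)" by simp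
  qed
  moreover have "f ` topspace T \<subseteq> topspace Q" using f by (auto simp: continuous_map_def)
  ultimately show ?thesis
    using q by (simp add: quotient_map_closedin A_def)
qed

lemma simplex_Hausdorff_orbit_space:
  assumes X: "CGWH X" shows "simplex_Hausdorff Q"
  unfolding simplex_Hausdorff_def
proof (intro allI impI)
  fix n s assume "singular_simplex n Q s"
  then have s: "continuous_map (simplex_space n) Q s" by (simp add: singular_simplex_def)
  have "closedin Q (s ` C)" if "closedin (simplex_space n) C" for C
  proof -
    have "compact_space (subtopology (simplex_space n) C)" "topspace (subtopology (simplex_space n) C) = C"
      using that simplex_space(1)[of n] closedin_compact_space compact_space_subtopology closedin_subset by fastforce+
    then show ?thesis
      using closedin_image_in_orbit_space[OF X, of "subtopology (simplex_space n) C" s] s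
        Hausdorff_space_subtopology[OF simplex_space(2)] by (simp add: continuous_map_from_subtopology)
  qed
  then show "Hausdorff_space (subtopology Q (s ` standard_simplex n))"
    using Hausdorff_image_of_closed_images[OF simplex_space[of n] s] by simp
qed

text \<open>
  The quotient map times the identity is a quotient map for the \<open>k\<close>-product; this is the
  instance of that fact in which the second factor is probed by a compact Hausdorff space \<open>T\<close>.
\<close>

lemma continuous_map_descends:
  fixes T :: "'t topology"
  assumes X: "CGWH X" and T: "compact_space T" "Hausdorff_space T"
    and f: "continuous_map T Q f"
    and F: "\<And>K. compactin X K \<Longrightarrow> Hausdorff_space (subtopology X K) \<Longrightarrow>
      continuous_map (prod_topology (subtopology X K) T) Z (\<lambda>(x, t). F x t)"
    and inv: "\<And>x g t. x \<in> topspace X \<Longrightarrow> g \<in> carrier G \<Longrightarrow> t \<in> topspace T \<Longrightarrow> F (act x g) t = F x t"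
  shows "continuous_map T Z (\<lambda>t. F (SOME x. x \<in> f t) t)"
proof -
  note q = quotient_map_quotient_topology[of X orb]
  have rep: "(SOME x. x \<in> f t) \<in> topspace X \<and> orb (SOME x. x \<in> f t) = f t" if "t \<in> topspace T" for t
  proof -
    have "f t \<in> orb ` topspace X"
      using f that by (auto simp: continuous_map_def topspace_quotient_topology)
    then obtain x where x: "x \<in> topspace X" "f t = orb x" by blast
    then have "(SOME x. x \<in> f t) \<in> orb x" using in_orb[of x] by (metis someI)
    then obtain g where "g \<in> carrier G" "(SOME x. x \<in> f t) = act x g" by blast
    then show ?thesis using x act_closed[of x g] orb_act[of x g] by simp
  qed
  have Frep: "F (SOME x. x \<in> f t) t = F x t" if t: "t \<in> topspace T" "x \<in> topspace X" "f t = orb x" for x t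
  proof -
    obtain g where "g \<in> carrier G" "(SOME x. x \<in> f t) = act x g"
      using rep[OF t(1)] orb_eq_iff[of x "SOME x. x \<in> f t"] t(2,3) by auto
    then show ?thesis using inv t by simp
  qed
  \<comment> \<open>Continuity in \<open>t\<close> for a fixed \<open>x\<close> is the hypothesis on
    \<open>F\<close> for a one-point subspace.\<close>
  have sing: "compactin X {x}" "Hausdorff_space (subtopology X {x})" if "x \<in> topspace X" for x
    using that by (auto simp: Hausdorff_space_def)
  have Fx: "continuous_map T Z (F x)" if x: "x \<in> topspace X" for x
  proof -
    have "continuous_map T (prod_topology (subtopology X {x}) T) (\<lambda>t. (x, t))"
      using x by (simp add: continuous_map_pairedI continuous_map_const)
    from continuous_map_compose[OF this F[OF sing[OF x]]] show ?thesis by (simp add: comp_def)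
  qed
  show ?thesis
    unfolding continuous_map_def
  proof (intro conjI allI impI)
    show "(\<lambda>t. F (SOME x. x \<in> f t) t) \<in> topspace T \<rightarrow> topspace Z"
      using rep Fx by (auto simp: continuous_map_def)
    fix U assume U: "openin Z U"
    let ?P = "{t \<in> topspace T. F (SOME x. x \<in> f t) t \<in> U}"
    show "openin T ?P"
    proof (subst openin_subopen, rule ballI)
      fix t0 assume t0: "t0 \<in> ?P"
      define x0 where "x0 = (SOME x. x \<in> f t0)"
      have x0: "x0 \<in> topspace X" "orb x0 = f t0" using rep[of t0] t0 by (auto simp: x0_def)
      have "openin T {t \<in> topspace T. F x0 t \<in> U}"
        using Fx[OF x0(1)] U by (rule openin_continuous_map_preimage)
      moreover have "t0 \<in> {t \<in> topspace T. F x0 t \<in> U}" using t0 by (simp add: x0_def)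
      moreover have "neighbourhood_base_of (closedin T) T"
        unfolding neighbourhood_base_of_closedin using T by (rule compact_Hausdorff_imp_regular_space)
      then have "\<exists>V N. openin T V \<and> closedin T N \<and> t \<in> V \<and> V \<subseteq> N \<and> N \<subseteq> W" if "openin T W" "t \<in> W" for W t
        using that unfolding neighbourhood_base_of by blast
      ultimately obtain V N where V: "openin T V" "closedin T N" "t0 \<in> V" "V \<subseteq> N"
          "N \<subseteq> {t \<in> topspace T. F x0 t \<in> U}"
        by meson
      have N: "compactin T N" using T(1) V(2) by (rule closedin_compact_space)
      \<comment> \<open>The points that work for the whole compact neighbourhood \<open>N\<close>.
        The set is open by the tube lemma on each test subspace, and saturated because
        \<open>F\<close> is invariant; so its image is open in the orbit space.\<close>
      define A where "A = {x \<in> topspace X. \<forall>t\<in>N. F x t \<in> U}"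
      have NT: "N \<subseteq> topspace T" using V(2) closedin_subset by blast
      have "openin X A"
      proof (rule CGWH_openin[OF X])
        show "A \<subseteq> topspace X" by (auto simp: A_def)
        fix K assume K: "compactin X K" "Hausdorff_space (subtopology X K)"
        let ?V = "{z \<in> topspace (prod_topology (subtopology X K) T). (\<lambda>(x, t). F x t) z \<in> U}"
        have "openin (prod_topology (subtopology X K) T) ?V"
          using F[OF K] U by (rule openin_continuous_map_preimage)
        then have "openin (subtopology X K) {x \<in> topspace (subtopology X K). \<forall>t\<in>N. (x, t) \<in> ?V}"
          using N by (rule openin_forall_compactin)
        moreover have "{x \<in> topspace (subtopology X K). \<forall>t\<in>N. (x, t) \<in> ?V} = A \<inter> K"
          using NT by (auto simp: A_def)
        ultimately show "openin (subtopology X K) (A \<inter> K)" by simp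
      qed
      have sat: "x \<in> A" if x: "x \<in> topspace X" "orb x \<in> orb ` A" for x
      proof -
        obtain a where "a \<in> A" "orb x = orb a" using x(2) by blast
        then obtain g where g: "g \<in> carrier G" "x = act a g"
          using orb_eq_iff[of a x] x(1) A_def by auto
        then show ?thesis using \<open>a \<in> A\<close> x(1) NT inv by (auto simp: A_def)
      qed
      then have "{x \<in> topspace X. orb x \<in> orb ` A} = A" by (auto simp: A_def)
      then have "openin Q (orb ` A)"
        using \<open>openin X A\<close> by (auto simp: openin_quotient_topology A_def)
      then have "openin T {t \<in> topspace T. f t \<in> orb ` A}"
        using f by (intro openin_continuous_map_preimage)
      then have "openin T (V \<inter> {t \<in> topspace T. f t \<in> orb ` A})" using V(1) by (rule openin_Int[rotated])
      moreover have "x0 \<in> A" using V(5) x0 by (auto simp: A_def)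
      then have "t0 \<in> V \<inter> {t \<in> topspace T. f t \<in> orb ` A}" using V(3) t0 x0 by auto
      moreover have "V \<inter> {t \<in> topspace T. f t \<in> orb ` A} \<subseteq> ?P"
      proof
        fix t assume t: "t \<in> V \<inter> {t \<in> topspace T. f t \<in> orb ` A}"
        then obtain a where a: "a \<in> A" "f t = orb a" by blast
        then have "F (SOME x. x \<in> f t) t = F a t" using Frep[of t a] t by (auto simp: A_def)
        then show "t \<in> ?P" using a t V(4) by (auto simp: A_def)
      qed
      ultimately show "\<exists>S. openin T S \<and> t0 \<in> S \<and> S \<subseteq> ?P" by blast
    qed
  qed
qed

end

section \<open>Loop spaces\<close>

text \<open>The loop topology before \<open>k\<close>-ification, kept apart because the arguments
  with subbasic sets take place here.\<close>

definition compact_open :: "'a topology \<Rightarrow> 'a \<Rightarrow> (complex \<Rightarrow> 'a) topology" where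
  "compact_open Z z0 = topology_generated_by
     {{\<alpha> \<in> loops Z z0. \<alpha> ` K \<subseteq> U} |K U. compactin circle K \<and> openin Z U}"

lemma loop_space_eq: "loop_space Z z0 = kify (compact_open Z z0)"
  by (simp add: loop_space_def compact_open_def)

lemma topspace_compact_open: "topspace (compact_open Z z0) = loops Z z0"
proof -
  have "loops Z z0 = {\<alpha> \<in> loops Z z0. \<alpha> ` {} \<subseteq> {}}" by simp
  moreover have "compactin circle {}" "openin Z {}" by simp_all
  ultimately have "loops Z z0 \<in> {{\<alpha> \<in> loops Z z0. \<alpha> ` K \<subseteq> U} |K U. compactin circle K \<and> openin Z U}"
    by blast
  then show ?thesis unfolding compact_open_def topology_generated_by_topspace by blast
qed

lemma topspace_loop_space: "topspace (loop_space Z z0) = loops Z z0"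
  by (simp add: loop_space_eq topspace_compact_open)

lemma openin_compact_open:
  "compactin circle K \<Longrightarrow> openin Z U \<Longrightarrow> openin (compact_open Z z0) {\<alpha> \<in> loops Z z0. \<alpha> ` K \<subseteq> U}"
  unfolding compact_open_def by (rule topology_generated_by_Basis) blast

lemma loops_continuous: "\<alpha> \<in> loops Z z0 \<Longrightarrow> continuous_map circle Z \<alpha>"
  and loops_base: "\<alpha> \<in> loops Z z0 \<Longrightarrow> \<alpha> 1 = z0"
  and loops_extensional: "\<alpha> \<in> loops Z z0 \<Longrightarrow> \<alpha> \<in> extensional (sphere 0 1)"
  by (simp_all add: loops_def)

lemma circle_compact: "compact_space circle" "Hausdorff_space circle"
  by (auto simp: compact_space_subtopology Hausdorff_space_subtopology)

text \<open>Regularity of the circle gives a closed, hence compact, neighbourhood \<open>N\<close>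
  of \<open>t\<close> that \<open>\<alpha>\<close> maps into \<open>U\<close>. All loops mapping
  \<open>N\<close> into \<open>U\<close> then evaluate into \<open>U\<close> near
  \<open>t\<close>.\<close>

lemma continuous_map_eval_compact_open:
  "continuous_map (prod_topology (compact_open Z z0) circle) Z (\<lambda>(\<alpha>, t). \<alpha> t)"
  unfolding continuous_map_def
proof (intro conjI allI impI)
  show "(\<lambda>(\<alpha>, t). \<alpha> t) \<in> topspace (prod_topology (compact_open Z z0) circle) \<rightarrow> topspace Z"
    using loops_continuous by (fastforce simp: topspace_compact_open continuous_map_def Pi_iff)
  fix U assume U: "openin Z U"
  let ?P = "{q \<in> topspace (prod_topology (compact_open Z z0) circle). (\<lambda>(\<alpha>, t). \<alpha> t) q \<in> U}"
  show "openin (prod_topology (compact_open Z z0) circle) ?P"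
  proof (subst openin_subopen, rule ballI)
    fix q assume qP: "q \<in> ?P"
    obtain \<alpha> t where "q = (\<alpha>, t)" by (cases q)
    with qP have q: "q = (\<alpha>, t)" "\<alpha> \<in> loops Z z0" "t \<in> topspace circle" "\<alpha> t \<in> U"
      by (simp_all add: topspace_compact_open)
    have W: "openin circle {t \<in> topspace circle. \<alpha> t \<in> U}"
      using loops_continuous[OF q(2)] U by (rule openin_continuous_map_preimage)
    have "neighbourhood_base_of (closedin circle) circle"
      unfolding neighbourhood_base_of_closedin using circle_compact by (rule compact_Hausdorff_imp_regular_space)
    then have "\<exists>V N. openin circle V \<and> closedin circle N \<and> t \<in> V \<and> V \<subseteq> N \<and> N \<subseteq> {t \<in> topspace circle. \<alpha> t \<in> U}"
      using W q unfolding neighbourhood_base_of by blast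
    then obtain V N where V: "openin circle V" "closedin circle N" "t \<in> V" "V \<subseteq> N"
          "N \<subseteq> {t \<in> topspace circle. \<alpha> t \<in> U}"
      by meson
    let ?S = "{\<beta> \<in> loops Z z0. \<beta> ` N \<subseteq> U} \<times> V"
    have "compactin circle N" using circle_compact(1) V(2) by (rule closedin_compact_space)
    then have "openin (prod_topology (compact_open Z z0) circle) ?S"
      using U V(1) by (simp add: openin_prod_Times_iff openin_compact_open)
    moreover have "q \<in> ?S" using q V by auto
    moreover have "?S \<subseteq> ?P"
    proof
      fix r assume "r \<in> ?S"
      then obtain \<beta> u where "r = (\<beta>, u)" "\<beta> \<in> loops Z z0" "\<beta> ` N \<subseteq> U" "u \<in> V" by blast
      moreover from this have "u \<in> topspace circle" "\<beta> u \<in> U" using V by blast+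
      ultimately show "r \<in> ?P" by (simp add: topspace_compact_open)
    qed
    ultimately show "\<exists>S. openin (prod_topology (compact_open Z z0) circle) S \<and> q \<in> S \<and> S \<subseteq> ?P" by blast
  qed
qed

lemma continuous_map_loop_space_compact_open: "continuous_map (loop_space Z z0) (compact_open Z z0) (\<lambda>\<alpha>. \<alpha>)"
  unfolding loop_space_eq using continuous_map_from_kify[OF continuous_map_id[of "compact_open Z z0"]]
  by (simp add: id_def)

lemma continuous_map_eval:
  "continuous_map (prod_topology (loop_space Z z0) circle) Z (\<lambda>(\<alpha>, t). \<alpha> t)"
proof -
  have "continuous_map (prod_topology (loop_space Z z0) circle) (prod_topology (compact_open Z z0) circle) (\<lambda>(\<alpha>, t). (\<alpha>, t))"
    by (intro continuous_map_prod_top[THEN iffD2] disjI2 conjI continuous_map_loop_space_compact_open)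
       (simp add: id_def[symmetric] continuous_map_id)
  from continuous_map_compose[OF this continuous_map_eval_compact_open]
  show ?thesis by (simp add: comp_def case_prod_unfold)
qed

text \<open>As \<open>Z\<close> is only weak Hausdorff, the separation is found on the image: two
  distinct loops differ at some \<open>t\<close>, evaluation at \<open>t\<close> maps the compact
  space onto a Hausdorff subspace of \<open>Z\<close>, and disjoint neighbourhoods pull back from
  there.\<close>

lemma Hausdorff_image_compact_open:
  assumes Z: "weak_Hausdorff Z" and T: "compact_space T" "Hausdorff_space T"
    and s: "continuous_map T (compact_open Z z0) s"
  shows "Hausdorff_space (subtopology (compact_open Z z0) (s ` topspace T))"
  unfolding Hausdorff_space_def
proof (intro allI impI, elim conjE)
  let ?L = "s ` topspace T"
  have L: "?L \<subseteq> loops Z z0" using s by (auto simp: continuous_map_def topspace_compact_open)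
  fix \<alpha> \<beta> assume "\<alpha> \<in> topspace (subtopology (compact_open Z z0) ?L)"
    "\<beta> \<in> topspace (subtopology (compact_open Z z0) ?L)" and ne: "\<alpha> \<noteq> \<beta>"
  then have ab: "\<alpha> \<in> ?L" "\<beta> \<in> ?L" by auto
  then have "\<exists>t \<in> sphere 0 1. \<alpha> t \<noteq> \<beta> t"
    using ne L loops_extensional by (meson extensionalityI subsetD)
  then obtain t where t: "t \<in> sphere 0 1" "\<alpha> t \<noteq> \<beta> t" by blast
  have "continuous_map T (prod_topology (compact_open Z z0) circle) (\<lambda>x. (s x, t))"
    using s t by (simp add: continuous_map_pairedI continuous_map_const)
  from continuous_map_compose[OF this continuous_map_eval_compact_open]
  have st: "continuous_map T Z (\<lambda>x. s x t)" by (simp add: comp_def)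
  let ?M = "(\<lambda>x. s x t) ` topspace T"
  have "Hausdorff_space (subtopology Z ?M)"
    using weak_Hausdorff_Hausdorff_image[OF Z T st] .
  moreover have "\<alpha> t \<in> topspace (subtopology Z ?M)" "\<beta> t \<in> topspace (subtopology Z ?M)"
    using ab st by (auto simp: continuous_map_def)
  ultimately obtain U V where "openin (subtopology Z ?M) U" "openin (subtopology Z ?M) V"
      "\<alpha> t \<in> U" "\<beta> t \<in> V" "disjnt U V"
    using t(2) unfolding Hausdorff_space_def by meson
  then obtain U V where UV: "openin Z U" "openin Z V" "\<alpha> t \<in> U" "\<beta> t \<in> V" "disjnt (U \<inter> ?M) (V \<inter> ?M)"
    unfolding openin_subtopology by blast
  let ?U = "{\<gamma> \<in> loops Z z0. \<gamma> ` {t} \<subseteq> U}" and ?V = "{\<gamma> \<in> loops Z z0. \<gamma> ` {t} \<subseteq> V}"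
  have "compactin circle {t}" using t by simp
  then have "openin (compact_open Z z0) ?U" "openin (compact_open Z z0) ?V"
    using UV by (simp_all only: openin_compact_open)
  then have "openin (subtopology (compact_open Z z0) ?L) (?U \<inter> ?L)"
    "openin (subtopology (compact_open Z z0) ?L) (?V \<inter> ?L)"
    by (simp_all only: openin_subtopology_Int)
  moreover have "\<alpha> \<in> ?U \<inter> ?L" "\<beta> \<in> ?V \<inter> ?L" using ab L UV by auto
  moreover have "disjnt (?U \<inter> ?L) (?V \<inter> ?L)" using UV(5) by (force simp: disjnt_iff)
  ultimately show "\<exists>U V. openin (subtopology (compact_open Z z0) ?L) U \<and>
      openin (subtopology (compact_open Z z0) ?L) V \<and> \<alpha> \<in> U \<and> \<beta> \<in> V \<and> disjnt U V" by blast
qed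

text \<open>Half of the exponential law, for a compact Hausdorff \<open>T\<close>. The tube lemma
  handles the subbasic sets; compactness of \<open>T\<close> and the Hausdorff image lift the result
  to the \<open>k\<close>-ified topology.\<close>

lemma continuous_map_into_loop_space:
  assumes Z: "weak_Hausdorff Z" and T: "compact_space T" "Hausdorff_space T"
    and F: "continuous_map (prod_topology T circle) Z (\<lambda>(x, t). F x t)"
    and base: "\<And>x. x \<in> topspace T \<Longrightarrow> F x 1 = z0"
  shows "continuous_map T (loop_space Z z0) (\<lambda>x. \<lambda>t\<in>sphere 0 1. F x t)"
proof -
  let ?f = "\<lambda>x. \<lambda>t\<in>sphere 0 1. F x t"
  have loop: "?f x \<in> loops Z z0" if x: "x \<in> topspace T" for x
  proof -
    have "continuous_map circle (prod_topology T circle) (\<lambda>t. (x, t))"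
      using x by (simp add: continuous_map_pairedI continuous_map_const)
    from continuous_map_compose[OF this F] have "continuous_map circle Z (F x)" by (simp add: comp_def)
    then have "continuous_map circle Z (?f x)" by (rule continuous_map_eq) simp
    then show ?thesis using base[OF x] by (simp add: loops_def)
  qed
  have "continuous_map T (compact_open Z z0) ?f"
    unfolding compact_open_def
  proof (rule continuous_on_generated_topo)
    show "?f ` topspace T \<subseteq> \<Union> {{\<alpha> \<in> loops Z z0. \<alpha> ` K \<subseteq> U} |K U. compactin circle K \<and> openin Z U}"
      using loop topspace_compact_open[of Z z0] unfolding compact_open_def topology_generated_by_topspace by auto
    fix S assume "S \<in> {{\<alpha> \<in> loops Z z0. \<alpha> ` K \<subseteq> U} |K U. compactin circle K \<and> openin Z U}"
    then obtain K U where S: "S = {\<alpha> \<in> loops Z z0. \<alpha> ` K \<subseteq> U}" "compactin circle K" "openin Z U" by blast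
    have K: "K \<subseteq> sphere 0 1" using compactin_subset_topspace[OF S(2)] by simp
    let ?V = "{z \<in> topspace (prod_topology T circle). (\<lambda>(x, t). F x t) z \<in> U}"
    have "openin (prod_topology T circle) ?V"
      using F S(3) by (rule openin_continuous_map_preimage)
    then have "openin T {x \<in> topspace T. \<forall>t\<in>K. (x, t) \<in> ?V}"
      using S(2) by (rule openin_forall_compactin)
    moreover have "{x \<in> topspace T. \<forall>t\<in>K. (x, t) \<in> ?V} = ?f -` S \<inter> topspace T"
    proof (intro subset_antisym subsetI)
      fix x assume "x \<in> {x \<in> topspace T. \<forall>t\<in>K. (x, t) \<in> ?V}"
      then have "x \<in> topspace T" "\<forall>t\<in>K. F x t \<in> U" by auto
      then show "x \<in> ?f -` S \<inter> topspace T" using loop K by (auto simp: S(1))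
    next
      fix x assume "x \<in> ?f -` S \<inter> topspace T"
      then have x: "x \<in> topspace T" "?f x ` K \<subseteq> U" by (auto simp: S(1))
      have "F x t \<in> U" if "t \<in> K" for t
        using subsetD[OF x(2) imageI[OF that]] subsetD[OF K that] by simp
      then show "x \<in> {x \<in> topspace T. \<forall>t\<in>K. (x, t) \<in> ?V}" using K x(1) by auto
    qed
    ultimately show "openin T (?f -` S \<inter> topspace T)" by simp
  qed
  then show ?thesis
    unfolding loop_space_eq using T Z
    by (intro continuous_map_into_kify Hausdorff_image_compact_open)
qed

text \<open>Simplices of the loop space are continuous for the compact-open topology, where their
  images are Hausdorff; refining the topology keeps the separating open sets.\<close>

lemma simplex_Hausdorff_loop_space:
  assumes "weak_Hausdorff Z"
  shows "simplex_Hausdorff (loop_space Z z0)"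
  unfolding simplex_Hausdorff_def
proof (intro allI impI)
  fix n s assume "singular_simplex n (loop_space Z z0) s"
  then have "continuous_map (simplex_space n) (loop_space Z z0) s"
    by (simp add: singular_simplex_def)
  from continuous_map_compose[OF this continuous_map_loop_space_compact_open]
  have "continuous_map (simplex_space n) (compact_open Z z0) s" by (simp add: comp_def)
  from Hausdorff_image_compact_open[OF assms simplex_space this]
  have haus: "Hausdorff_space (subtopology (compact_open Z z0) (s ` standard_simplex n))" by simp
  have finer: "openin (loop_space Z z0) U" if "openin (compact_open Z z0) U" for U
    using openin_continuous_map_preimage[OF continuous_map_loop_space_compact_open that]
      openin_subset[OF that] by (simp add: topspace_loop_space topspace_compact_open Collect_conj_eq inf.absorb2)
  have "openin (subtopology (loop_space Z z0) S) U" if "openin (subtopology (compact_open Z z0) S) U" for S U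
    using that finer unfolding openin_subtopology by blast
  then show "Hausdorff_space (subtopology (loop_space Z z0) (s ` standard_simplex n))"
    using haus unfolding Hausdorff_space_def topspace_subtopology topspace_loop_space topspace_compact_open
    by (meson)
qed

section \<open>The diagonal action on simplices\<close>

lemma algebra_weak_Hausdorff: "operad_algebra C X \<theta> \<Longrightarrow> weak_Hausdorff X"
  by (simp add: operad_algebra_def CGWH_def)

lemma operad_finite_right_action:
  assumes "is_operad C"
  shows "finite_right_action (sym_group k) (opspace C k) (opact C k)"
proof -
  interpret group "sym_group k" by (rule sym_group_is_group)
  have "finite (carrier (sym_group k))"
    unfolding sym_group_def using finite_permutations[of "{1..k}"] by simp
  moreover have "right_action (sym_group k) (opspace C k) (opact C k)"
    using assms unfolding is_operad_def by blast
  ultimately show ?thesis by unfold_locales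
qed

lemma simplex_Hausdorff_operad_orbit_space:
  assumes "is_operad C" shows "simplex_Hausdorff (orbit_space C k)"
proof -
  interpret finite_right_action "sym_group k" "opspace C k" "opact C k"
    by (rule operad_finite_right_action[OF assms])
  have "CGWH (opspace C k)" using assms by (simp add: is_operad_def)
  from simplex_Hausdorff_orbit_space[OF this] show ?thesis
    by (simp add: orbit_space_def orbit_def[abs_def])
qed

section \<open>Basepoints and the diagonal action\<close>

lemma algebra_basepoint_in_space:
  assumes "is_operad C" "operad_algebra C X \<theta>"
  shows "algebra_basepoint C \<theta> \<in> topspace X"
proof -
  obtain c0 where c0: "topspace (opspace C 0) = {c0}" using assms(1) by (auto simp: is_operad_def)
  have "continuous_map (kprod (opspace C 0) (tuples X 0)) X (\<lambda>(c, x). \<theta> 0 c x)"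
    using assms(2) unfolding operad_algebra_def by blast
  moreover have "(c0, \<lambda>i\<in>{}. undefined) \<in> topspace (kprod (opspace C 0) (tuples X 0))"
    by (simp add: kprod_def c0)
  ultimately have "\<theta> 0 c0 (\<lambda>i\<in>{}. undefined) \<in> topspace X"
    by (auto simp: continuous_map_def Pi_iff split: prod.splits)
  then show ?thesis by (simp add: algebra_basepoint_def c0)
qed

text \<open>The associativity axiom with all inner arities 0: the composite operation lies in the
  one-point space \<open>C(0)\<close>.\<close>

lemma algebra_basepoint_fixed:
  assumes C: "is_operad C" and X: "operad_algebra C X \<theta>" and c: "c \<in> topspace (opspace C k)"
  shows "\<theta> k c (\<lambda>i\<in>{1..k}. algebra_basepoint C \<theta>) = algebra_basepoint C \<theta>"
proof -
  obtain c0 where c0: "topspace (opspace C 0) = {c0}" using C by (auto simp: is_operad_def)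
  define j :: "nat \<Rightarrow> nat" where "j = (\<lambda>s\<in>{1..k}. 0)"
  define d where "d = (\<lambda>s\<in>{1..k}. c0)"
  define x :: "nat \<Rightarrow> 'b" where "x = (\<lambda>i\<in>{}. undefined)"
  have j: "j \<in> extensional {1..k}" "(\<Sum>s = 1..k. j s) = 0" by (auto simp: j_def)
  have d: "d \<in> topspace (op_tuples C k j)" by (simp add: d_def j_def c0)
  have x: "x \<in> topspace (tuples X (\<Sum>s = 1..k. j s))"
    unfolding j(2) by (simp add: x_def PiE_def extensional_def)
  have "continuous_map (kprod (opspace C k) (op_tuples C k j)) (opspace C (\<Sum>s = 1..k. j s)) (\<lambda>(c, d). opcomp C k j c d)"
    using C j(1) unfolding is_operad_def by blast
  moreover have "(c, d) \<in> topspace (kprod (opspace C k) (op_tuples C k j))"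
    using c d by (simp add: kprod_def)
  ultimately have "opcomp C k j c d \<in> topspace (opspace C 0)"
    unfolding j(2) by (auto simp: continuous_map_def Pi_iff split: prod.splits)
  then have oc: "opcomp C k j c d = c0" by (simp add: c0)
  have "\<theta> (\<Sum>s = 1..k. j s) (opcomp C k j c d) x =
      \<theta> k c (\<lambda>s\<in>{1..k}. \<theta> (j s) (d s) (\<lambda>r\<in>{1..j s}. x (block_pos j s r)))"
    using X c d x j(1) unfolding operad_algebra_def by blast
  moreover have "(\<lambda>s\<in>{1..k}. \<theta> (j s) (d s) (\<lambda>r\<in>{1..j s}. x (block_pos j s r))) = (\<lambda>s\<in>{1..k}. \<theta> 0 c0 x)"
    by (rule restrict_ext) (simp add: j_def d_def x_def restrict_def)
  ultimately have "\<theta> 0 c0 x = \<theta> k c (\<lambda>s\<in>{1..k}. \<theta> 0 c0 x)"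
    unfolding oc j(2) by (simp only:)
  moreover have "algebra_basepoint C \<theta> = \<theta> 0 c0 x"
    by (simp add: algebra_basepoint_def c0 x_def)
  ultimately show ?thesis by (simp only:)
qed

lemma algebra_basepoint_loop_action:
  "algebra_basepoint C (loop_action \<theta>) = const_loop (algebra_basepoint C \<theta>)"
  by (simp add: algebra_basepoint_def loop_action_def const_loop_def restrict_def)

lemma const_loop_in_loops: "z0 \<in> topspace Z \<Longrightarrow> const_loop z0 \<in> loops Z z0"
  by (simp add: const_loop_def loops_def continuous_map_eq[OF continuous_map_const[THEN iffD2]])

text \<open>Before passing to orbits the map is continuous by the algebra structure, and a constant
  tuple is fixed by every permutation, so \<open>continuous_map_descends\<close> applies. The
  compact Hausdorff space \<open>T\<close> is general because simplices times the circle are used as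
  well.\<close>

lemma continuous_map_diagonal_action:
  fixes T :: "'t topology"
  assumes C: "is_operad C" and X: "operad_algebra C X \<theta>" and T: "compact_space T" "Hausdorff_space T"
    and f: "continuous_map T (orbit_space C k) f" and h: "continuous_map T X h"
  shows "continuous_map T X (\<lambda>t. diagonal_action \<theta> k (f t, h t))"
proof -
  interpret finite_right_action "sym_group k" "opspace C k" "opact C k"
    by (rule operad_finite_right_action[OF C])
  have wh: "weak_Hausdorff X" using X by (rule algebra_weak_Hausdorff)
  have "continuous_map T X (\<lambda>t. \<theta> k (SOME c. c \<in> f t) (\<lambda>i\<in>{1..k}. h t))"
  proof (rule continuous_map_descends[OF _ T, where F="\<lambda>c t. \<theta> k c (\<lambda>i\<in>{1..k}. h t)"])
    show "CGWH (opspace C k)" using C by (simp add: is_operad_def)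
    show "continuous_map T Q f" using f by (simp add: orbit_space_def orbit_def[abs_def])
    show "\<theta> k (opact C k c \<sigma>) (\<lambda>i\<in>{1..k}. h t) = \<theta> k c (\<lambda>i\<in>{1..k}. h t)"
      if "c \<in> topspace (opspace C k)" "\<sigma> \<in> carrier (sym_group k)" "t \<in> topspace T" for c \<sigma> t
    proof -
      have "(\<lambda>i\<in>{1..k}. h t) \<in> topspace (tuples X k)" using that(3) h by (auto simp: continuous_map_def)
      then have "\<theta> k (opact C k c \<sigma>) (\<lambda>i\<in>{1..k}. h t) = \<theta> k c ((\<lambda>i\<in>{1..k}. h t) \<circ> inv_into UNIV \<sigma>)"
        using X that unfolding operad_algebra_def by blast
      moreover have "inv_into UNIV \<sigma> permutes {1..k}"
        using that(2) by (simp add: sym_group_carrier permutes_inv)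
      then have "(\<lambda>i\<in>{1..k}. h t) \<circ> inv_into UNIV \<sigma> = (\<lambda>i\<in>{1..k}. h t)"
        using permutes_in_image by (fastforce simp: fun_eq_iff restrict_def)
      ultimately show ?thesis by simp
    qed
    fix K assume K: "compactin (opspace C k) K" "Hausdorff_space (subtopology (opspace C k) K)"
    let ?K = "subtopology (opspace C k) K" and ?M = "h ` topspace T"
    have KC: "K \<subseteq> topspace (opspace C k)" using K(1) compactin_subset_topspace by blast
    let ?f = "\<lambda>(c, t). (c, \<lambda>i\<in>{1..k}. h t)"
    have MX: "Hausdorff_space (subtopology X ?M)" using wh T h by (rule weak_Hausdorff_Hausdorff_image)
    have "continuous_map (prod_topology ?K T) X (\<lambda>z. h (snd z))"
      using continuous_map_compose[OF continuous_map_snd h] by (simp add: comp_def)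
    then have "continuous_map (prod_topology ?K T) (tuples X k) (\<lambda>z. \<lambda>i\<in>{1..k}. h (snd z))"
      unfolding continuous_map_componentwise by (simp add: image_subset_iff)
    moreover have "continuous_map (prod_topology ?K T) (opspace C k) fst"
      using continuous_map_fst by (rule continuous_map_into_fulltopology)
    ultimately have cont: "continuous_map (prod_topology ?K T) (prod_topology (opspace C k) (tuples X k)) ?f"
      by (simp add: continuous_map_pairedI case_prod_unfold)
    \<comment> \<open>The structure map is continuous for the \<open>k\<close>-product. To lift
      \<open>?f\<close> there, its image is enclosed in \<open>K\<close> times a power of the image
      of \<open>h\<close>, a product of Hausdorff spaces.\<close>
    have "Hausdorff_space (prod_topology ?K (product_topology (\<lambda>_. subtopology X ?M) {1..k}))"
      using K(2) MX by (simp add: Hausdorff_space_prod_topology Hausdorff_space_product_topology)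
    then have "Hausdorff_space (subtopology (prod_topology (opspace C k) (tuples X k)) (K \<times> ({1..k} \<rightarrow>\<^sub>E ?M)))"
      by (simp add: subtopology_Times subtopology_product_topology)
    then have "Hausdorff_space (subtopology (subtopology (prod_topology (opspace C k) (tuples X k)) (K \<times> ({1..k} \<rightarrow>\<^sub>E ?M)))
        (?f ` topspace (prod_topology ?K T)))"
      by (rule Hausdorff_space_subtopology)
    moreover have "K \<times> ({1..k} \<rightarrow>\<^sub>E ?M) \<inter> ?f ` topspace (prod_topology ?K T) = ?f ` topspace (prod_topology ?K T)"
      using KC by auto
    ultimately have "Hausdorff_space (subtopology (prod_topology (opspace C k) (tuples X k)) (?f ` topspace (prod_topology ?K T)))"
      by (simp only: subtopology_subtopology)
    moreover have "compact_space (prod_topology ?K T)"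
      using K(1) T(1) by (simp add: compact_space_prod_topology compact_space_subtopology)
    ultimately have "continuous_map (prod_topology ?K T) (kprod (opspace C k) (tuples X k)) ?f"
      unfolding kprod_def using cont by (intro continuous_map_into_kify)
    moreover have "continuous_map (kprod (opspace C k) (tuples X k)) X (\<lambda>(c, x). \<theta> k c x)"
      using X unfolding operad_algebra_def by blast
    ultimately have "continuous_map (prod_topology ?K T) X ((\<lambda>(c, x). \<theta> k c x) \<circ> ?f)"
      by (rule continuous_map_compose)
    then show "continuous_map (prod_topology ?K T) X (\<lambda>(c, t). \<theta> k c (\<lambda>i\<in>{1..k}. h t))"
      by (simp add: comp_def case_prod_unfold)
  qed
  then show ?thesis by (simp add: diagonal_action_def)
qed

text \<open>Exactly what a function needs to induce a map of singular chains. The diagonal action,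
  viewed on an ordinary product with an orbit space, is handled in this form.\<close>

definition singular_map :: "'a topology \<Rightarrow> 'b topology \<Rightarrow> ('a \<Rightarrow> 'b) \<Rightarrow> bool" where
  "singular_map X Y f \<longleftrightarrow> (\<forall>n s. singular_simplex n X s \<longrightarrow> singular_simplex n Y (simplex_map n f s))"

lemma singular_map_continuous: "continuous_map X Y f \<Longrightarrow> singular_map X Y f"
  by (simp add: singular_map_def singular_simplex_simplex_map)

lemma singular_map_diagonal_action:
  assumes C: "is_operad C" and X: "operad_algebra C X \<theta>"
  shows "singular_map (prod_topology (orbit_space C k) X) X (diagonal_action \<theta> k)"
  unfolding singular_map_def
proof (intro allI impI)
  fix n s assume "singular_simplex n (prod_topology (orbit_space C k) X) s"
  then have "continuous_map (simplex_space n) (orbit_space C k) (fst \<circ> s)" "continuous_map (simplex_space n) X (snd \<circ> s)"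
    by (simp_all add: singular_simplex_def continuous_map_pairwise)
  from continuous_map_diagonal_action[OF C X simplex_space this]
  show "singular_simplex n X (simplex_map n (diagonal_action \<theta> k) s)"
    unfolding simplex_map_def by (intro singular_simplex_restrict) (simp add: comp_def)
qed

text \<open>By adjunction: a simplex of loops is evaluated on the simplex times the circle, which is
  again a compact Hausdorff probe; the action on \<open>X\<close> is applied there, and the result
  is turned back into loops. The base condition holds because the operations fix the
  basepoint.\<close>

lemma singular_map_diagonal_loop_action:
  assumes C: "is_operad C" and X: "operad_algebra C X \<theta>"
  defines "z0 \<equiv> algebra_basepoint C \<theta>"
  shows "singular_map (prod_topology (orbit_space C k) (loop_space X z0)) (loop_space X z0)
    (diagonal_action (loop_action \<theta>) k)"
  unfolding singular_map_def
proof (intro allI impI)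
  fix n s assume "singular_simplex n (prod_topology (orbit_space C k) (loop_space X z0)) s"
  then have f: "continuous_map (simplex_space n) (orbit_space C k) (fst \<circ> s)"
    and g: "continuous_map (simplex_space n) (loop_space X z0) (snd \<circ> s)"
    by (simp_all add: singular_simplex_def continuous_map_pairwise)
  interpret finite_right_action "sym_group k" "opspace C k" "opact C k"
    by (rule operad_finite_right_action[OF C])
  let ?T = "prod_topology (simplex_space n) circle"
  have T: "compact_space ?T" "Hausdorff_space ?T"
    using simplex_space[of n] circle_compact by (auto simp: compact_space_prod_topology Hausdorff_space_prod_topology)
  have f': "continuous_map ?T (orbit_space C k) (\<lambda>z. fst (s (fst z)))"
    using continuous_map_compose[OF continuous_map_fst f] by (simp add: comp_def)
  have "continuous_map ?T (loop_space X z0) (\<lambda>z. snd (s (fst z)))"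
    using continuous_map_compose[OF continuous_map_fst g] by (simp add: comp_def)
  then have "continuous_map ?T (prod_topology (loop_space X z0) circle) (\<lambda>z. (snd (s (fst z)), snd z))"
    by (intro continuous_map_pairedI continuous_map_snd)
  from continuous_map_compose[OF this continuous_map_eval]
  have h': "continuous_map ?T X (\<lambda>z. snd (s (fst z)) (snd z))" by (simp add: comp_def)
  let ?F = "\<lambda>x t. diagonal_action \<theta> k (fst (s x), snd (s x) t)"
  have "continuous_map ?T X (\<lambda>(x, t). ?F x t)"
    using continuous_map_diagonal_action[OF C X T f' h'] by (simp add: case_prod_unfold)
  moreover have "?F x 1 = z0" if x: "x \<in> topspace (simplex_space n)" for x
  proof -
    have "snd (s x) \<in> loops X z0" "fst (s x) \<in> topspace (orbit_space C k)"
      using f g x by (auto simp: continuous_map_def topspace_loop_space Pi_iff)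
    then obtain c where c: "c \<in> topspace (opspace C k)" "fst (s x) = orbit C k c" and "snd (s x) 1 = z0"
      using loops_base by (fastforce simp: orbit_space_def topspace_quotient_topology)
    have "c \<in> fst (s x)" using in_orb[OF c(1)] c(2) by (simp add: orbit_def)
    then have "(SOME c. c \<in> fst (s x)) \<in> orbit C k c" using c(2) by (metis someI)
    then have "(SOME c. c \<in> fst (s x)) \<in> topspace (opspace C k)"
      using act_closed[OF c(1)] by (auto simp: orbit_def)
    then show ?thesis
      using algebra_basepoint_fixed[OF C X] \<open>snd (s x) 1 = z0\<close> by (simp add: diagonal_action_def z0_def)
  qed
  ultimately have "continuous_map (simplex_space n) (loop_space X z0) (\<lambda>x. \<lambda>t\<in>sphere 0 1. ?F x t)"
    by (rule continuous_map_into_loop_space[OF algebra_weak_Hausdorff[OF X] simplex_space])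
  moreover have "(\<lambda>t\<in>sphere 0 1. ?F x t) = diagonal_action (loop_action \<theta>) k (s x)" for x
    by (auto simp: diagonal_action_def loop_action_def case_prod_unfold intro!: restrict_ext arg_cong[where f="\<theta> k _"])
  ultimately show "singular_simplex n (loop_space X z0) (simplex_map n (diagonal_action (loop_action \<theta>) k) s)"
    unfolding simplex_map_def by (intro singular_simplex_restrict) (simp add: comp_def)
qed

section \<open>Homology classes\<close>

lemma cycles_modI:
  "singular_chain n X c \<Longrightarrow> singular_chain (n - 1) X d \<Longrightarrow> chain_boundary n c = frag_cmul (int p) d \<Longrightarrow> c \<in> cycles_mod p n X"
  by (auto simp: cycles_mod_def)

lemma boundaries_modI:
  "singular_chain (Suc n) X e \<Longrightarrow> singular_chain n X d \<Longrightarrow> chain_boundary (Suc n) e + frag_cmul (int p) d \<in> boundaries_mod p n X"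
  by (auto simp: boundaries_mod_def)

lemma cycles_mod_chain: "c \<in> cycles_mod p n X \<Longrightarrow> singular_chain n X c"
  by (simp add: cycles_mod_def)

lemma cycles_mod_0: "0 \<in> cycles_mod p n X"
  by (rule cycles_modI[where d=0]) simp_all

lemma cycles_mod_add:
  assumes "c \<in> cycles_mod p n X" "c' \<in> cycles_mod p n X" shows "c + c' \<in> cycles_mod p n X"
proof -
  obtain d d' where "singular_chain n X c" "singular_chain (n - 1) X d" "chain_boundary n c = frag_cmul (int p) d"
    "singular_chain n X c'" "singular_chain (n - 1) X d'" "chain_boundary n c' = frag_cmul (int p) d'"
    using assms by (auto simp: cycles_mod_def)
  then show ?thesis
    by (intro cycles_modI[where d="d + d'"])
      (simp_all add: singular_chain_add chain_boundary_add frag_cmul_distrib2)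
qed

lemma cycles_mod_cmul:
  assumes "c \<in> cycles_mod p n X" shows "frag_cmul k c \<in> cycles_mod p n X"
proof -
  obtain d where "singular_chain n X c" "singular_chain (n - 1) X d" "chain_boundary n c = frag_cmul (int p) d"
    using assms by (auto simp: cycles_mod_def)
  then show ?thesis
    by (intro cycles_modI[where d="frag_cmul k d"])
      (simp_all add: singular_chain_cmul chain_boundary_cmul mult.commute)
qed

lemma cycles_mod_minus: "c \<in> cycles_mod p n X \<Longrightarrow> - c \<in> cycles_mod p n X"
  using cycles_mod_cmul[of c p n X "-1"] by simp

lemma boundaries_mod_0: "0 \<in> boundaries_mod p n X"
  using boundaries_modI[of n X 0 0 p] by simp

lemma boundaries_mod_add:
  assumes "c \<in> boundaries_mod p n X" "c' \<in> boundaries_mod p n X" shows "c + c' \<in> boundaries_mod p n X"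
proof -
  obtain e d e' d' where "singular_chain (Suc n) X e" "singular_chain n X d" "c = chain_boundary (Suc n) e + frag_cmul (int p) d"
    "singular_chain (Suc n) X e'" "singular_chain n X d'" "c' = chain_boundary (Suc n) e' + frag_cmul (int p) d'"
    using assms by (auto simp: boundaries_mod_def)
  then show ?thesis
    using boundaries_modI[of n X "e + e'" "d + d'" p]
    by (simp add: singular_chain_add chain_boundary_add frag_cmul_distrib2 algebra_simps)
qed

lemma boundaries_mod_cmul:
  assumes "c \<in> boundaries_mod p n X" shows "frag_cmul k c \<in> boundaries_mod p n X"
proof -
  obtain e d where "singular_chain (Suc n) X e" "singular_chain n X d" "c = chain_boundary (Suc n) e + frag_cmul (int p) d"
    using assms by (auto simp: boundaries_mod_def)
  then show ?thesis
    using boundaries_modI[of n X "frag_cmul k e" "frag_cmul k d" p]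
    by (simp add: singular_chain_cmul chain_boundary_cmul frag_cmul_distrib2 mult.commute)
qed

lemma boundaries_mod_minus: "c \<in> boundaries_mod p n X \<Longrightarrow> - c \<in> boundaries_mod p n X"
  using boundaries_mod_cmul[of c p n X "-1"] by simp

lemma boundaries_mod_subset_cycles_mod: "boundaries_mod p n X \<subseteq> cycles_mod p n X"
proof
  fix c assume "c \<in> boundaries_mod p n X"
  then obtain e d where e: "singular_chain (Suc n) X e" "singular_chain n X d" "c = chain_boundary (Suc n) e + frag_cmul (int p) d"
    by (auto simp: boundaries_mod_def)
  then show "c \<in> cycles_mod p n X"
    using chain_boundary_boundary[OF e(1)] singular_chain_boundary_alt[OF e(1)] singular_chain_boundary[OF e(2)]
    by (intro cycles_modI[where d="chain_boundary n d"])
      (simp_all add: singular_chain_add singular_chain_cmul chain_boundary_add chain_boundary_cmul)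
qed

section \<open>Groups of cycles modulo \<open>p\<close> and their quotients\<close>

lemma inv_chain_group: "singular_chain n X c \<Longrightarrow> inv\<^bsub>chain_group n X\<^esub> c = - c"
  by (simp add: singular_chain_def)

lemma subgroup_cycles_mod: "subgroup (cycles_mod p n X) (chain_group n X)"
  by (rule group.subgroupI[OF group_chain_group])
    (auto simp: cycles_mod_chain cycles_mod_add inv_chain_group cycles_mod_minus intro: cycles_mod_0)

lemma carrier_cycle_group_mod: "carrier (cycle_group_mod p n X) = cycles_mod p n X"
  unfolding cycle_group_mod_def
  by (rule subgroup.carrier_subgroup_generated_subgroup[OF subgroup_cycles_mod])

lemma comm_group_cycle_group_mod: "comm_group (cycle_group_mod p n X)"
  unfolding cycle_group_mod_def by (rule group.abelian_subgroup_generated[OF group_chain_group abelian_chain_group])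

lemma mult_cycle_group_mod: "(\<otimes>\<^bsub>cycle_group_mod p n X\<^esub>) = (+)"
  and one_cycle_group_mod: "\<one>\<^bsub>cycle_group_mod p n X\<^esub> = 0"
  by (simp_all add: cycle_group_mod_def)

lemma inv_cycle_group_mod:
  assumes "c \<in> cycles_mod p n X" shows "inv\<^bsub>cycle_group_mod p n X\<^esub> c = - c"
proof -
  interpret comm_group "cycle_group_mod p n X" by (rule comm_group_cycle_group_mod)
  show ?thesis
    using assms by (intro inv_equality)
      (simp_all add: carrier_cycle_group_mod mult_cycle_group_mod one_cycle_group_mod cycles_mod_minus)
qed

lemma subgroup_boundaries_mod: "subgroup (boundaries_mod p n X) (cycle_group_mod p n X)"
proof -
  interpret comm_group "cycle_group_mod p n X" by (rule comm_group_cycle_group_mod)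
  show ?thesis
    using boundaries_mod_subset_cycles_mod
    by (intro subgroupI) (auto simp: carrier_cycle_group_mod mult_cycle_group_mod boundaries_mod_add
        inv_cycle_group_mod subset_iff boundaries_mod_minus intro: boundaries_mod_0)
qed

lemma comm_group_homology_mod: "comm_group (homology_mod p n X)"
  unfolding homology_mod_def
  by (rule comm_group.abelian_FactGroup[OF comm_group_cycle_group_mod subgroup_boundaries_mod])

lemma carrier_homology_mod: "carrier (homology_mod p n X) = hom_class p n X ` cycles_mod p n X"
  unfolding homology_mod_def carrier_FactGroup carrier_cycle_group_mod by (simp add: hom_class_def)

lemma mult_homology_mod:
  assumes "c \<in> cycles_mod p n X" "d \<in> cycles_mod p n X"
  shows "hom_class p n X c \<otimes>\<^bsub>homology_mod p n X\<^esub> hom_class p n X d = hom_class p n X (c + d)"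
proof -
  interpret comm_group "cycle_group_mod p n X" by (rule comm_group_cycle_group_mod)
  interpret normal "boundaries_mod p n X" "cycle_group_mod p n X"
    by (rule subgroup_imp_normal[OF subgroup_boundaries_mod])
  show ?thesis
    using rcos_sum[of c d] assms
    by (simp add: homology_mod_def hom_class_def carrier_cycle_group_mod mult_cycle_group_mod)
qed

lemma one_homology_mod: "\<one>\<^bsub>homology_mod p n X\<^esub> = hom_class p n X 0"
  by (auto simp: homology_mod_def hom_class_def r_coset_def mult_cycle_group_mod)

lemma in_hom_class_iff: "x \<in> hom_class p n X c \<longleftrightarrow> x - c \<in> boundaries_mod p n X"
proof -
  have "x \<in> hom_class p n X c \<longleftrightarrow> (\<exists>b \<in> boundaries_mod p n X. x = b + c)"
    by (simp add: hom_class_def r_coset_def mult_cycle_group_mod)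
  also have "\<dots> \<longleftrightarrow> x - c \<in> boundaries_mod p n X"
    by (metis add_diff_cancel_right' diff_add_cancel)
  finally show ?thesis .
qed

lemma hom_class_eqI:
  assumes "c - d \<in> boundaries_mod p n X"
  shows "hom_class p n X c = hom_class p n X d"
proof (rule Set.set_eqI)
  fix x
  have "x - c \<in> boundaries_mod p n X" if "x - d \<in> boundaries_mod p n X"
    using boundaries_mod_add[OF that boundaries_mod_minus[OF assms]] by simp
  moreover have "x - d \<in> boundaries_mod p n X" if "x - c \<in> boundaries_mod p n X"
    using boundaries_mod_add[OF that assms] by simp
  ultimately show "x \<in> hom_class p n X c \<longleftrightarrow> x \<in> hom_class p n X d"
    unfolding in_hom_class_iff by blast
qed

text \<open>The operations on classes are defined by choosing a chain; this bounds the choice by a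
  boundary modulo \<open>p\<close>.\<close>

lemma some_hom_class:
  assumes "c \<in> cycles_mod p n X"
  obtains b where "b \<in> boundaries_mod p n X" "(SOME x. x \<in> hom_class p n X c) = c + b"
proof -
  have "c \<in> hom_class p n X c" by (simp add: in_hom_class_iff boundaries_mod_0)
  then have "(SOME x. x \<in> hom_class p n X c) \<in> hom_class p n X c" by (rule someI)
  then show ?thesis
    using that[of "(SOME x. x \<in> hom_class p n X c) - c"] by (simp add: in_hom_class_iff)
qed

text \<open>Cycles and boundaries see a space only through its singular simplices. This exchanges a
  \<open>k\<close>-product for the ordinary product.\<close>

lemma homology_mod_cong:
  assumes "\<And>n s. singular_simplex n X s \<longleftrightarrow> singular_simplex n Y s"
  shows "cycles_mod p n X = cycles_mod p n Y" "boundaries_mod p n X = boundaries_mod p n Y"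
    "hom_class p n X = hom_class p n Y"
proof -
  have ch: "singular_chain n X = singular_chain n Y" for n
    using assms by (auto simp: singular_chain_def fun_eq_iff)
  show "cycles_mod p n X = cycles_mod p n Y" and b: "boundaries_mod p n X = boundaries_mod p n Y"
    by (simp_all add: cycles_mod_def boundaries_mod_def ch)
  show "hom_class p n X = hom_class p n Y"
    by (rule ext, rule Set.set_eqI) (simp add: in_hom_class_iff b)
qed

subsection \<open>Induced maps\<close>

lemma singular_map_chain:
  "singular_map X Y f \<Longrightarrow> singular_chain n X c \<Longrightarrow> singular_chain n Y (chain_map n f c)"
  unfolding chain_map_def singular_map_def
  by (intro singular_chain_extend) (auto simp: singular_chain_of singular_chain_def[of n X])

lemma singular_map_cycles_mod:
  assumes f: "singular_map X Y f" and c: "c \<in> cycles_mod p n X"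
  shows "chain_map n f c \<in> cycles_mod p n Y"
proof -
  obtain d where "singular_chain n X c" "singular_chain (n - 1) X d" "chain_boundary n c = frag_cmul (int p) d"
    using c by (auto simp: cycles_mod_def)
  then show ?thesis
    using chain_boundary_chain_map[of n X c f] singular_map_chain[OF f]
    by (intro cycles_modI[where d="chain_map (n - 1) f d"]) simp_all
qed

lemma singular_map_boundaries_mod:
  assumes f: "singular_map X Y f" and c: "c \<in> boundaries_mod p n X"
  shows "chain_map n f c \<in> boundaries_mod p n Y"
proof -
  obtain e d where e: "singular_chain (Suc n) X e" "singular_chain n X d" "c = chain_boundary (Suc n) e + frag_cmul (int p) d"
    using c by (auto simp: boundaries_mod_def)
  then have "chain_map n f c = chain_boundary (Suc n) (chain_map (Suc n) f e) + frag_cmul (int p) (chain_map n f d)"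
    using chain_boundary_chain_map[of "Suc n" X e f] by (simp add: chain_map_add)
  then show ?thesis
    using singular_map_chain[OF f] e by (simp add: boundaries_modI)
qed

lemma singular_map_id: "singular_map (subtopology X S) X id"
  by (rule singular_map_continuous) (simp add: continuous_map_from_subtopology)

lemma singular_map_subtopology:
  assumes "singular_map X Y f" "\<And>x. x \<in> topspace X \<Longrightarrow> x \<in> S \<Longrightarrow> f x \<in> T"
  shows "singular_map (subtopology X S) (subtopology Y T) f"
  unfolding singular_map_def singular_simplex_subtopology
proof (intro allI impI conjI)
  fix n s assume s: "singular_simplex n X s \<and> s ` standard_simplex n \<subseteq> S"
  then show "singular_simplex n Y (simplex_map n f s)" using assms(1) by (simp add: singular_map_def)
  have "s ` standard_simplex n \<subseteq> topspace X"
    using s by (auto simp: singular_simplex_def continuous_map_def Pi_iff)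
  then show "simplex_map n f s ` standard_simplex n \<subseteq> T"
    using s assms(2) by (auto simp: simplex_map_def)
qed

lemma hom_map_hom_class:
  assumes f: "singular_map X Y f" and c: "c \<in> cycles_mod p n X"
  shows "hom_map p n Y f (hom_class p n X c) = hom_class p n Y (chain_map n f c)"
proof -
  obtain b where b: "b \<in> boundaries_mod p n X" "(SOME x. x \<in> hom_class p n X c) = c + b"
    using some_hom_class[OF c] .
  show ?thesis
    unfolding hom_map_def b(2)
    by (rule hom_class_eqI) (simp add: chain_map_add singular_map_boundaries_mod[OF f b(1)])
qed

subsection \<open>Reduced homology\<close>

lemma basepoint_homology_eq:
  "basepoint_homology p n Y y0 = hom_class p n Y ` cycles_mod p n (subtopology Y {y0})"
  unfolding basepoint_homology_def carrier_homology_mod image_image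
  by (rule image_cong) (simp_all add: hom_map_hom_class[OF singular_map_id] chain_map_ident[OF cycles_mod_chain])

lemma cycles_mod_subtopology: "cycles_mod p n (subtopology X S) \<subseteq> cycles_mod p n X"
proof
  fix c assume c: "c \<in> cycles_mod p n (subtopology X S)"
  then show "c \<in> cycles_mod p n X"
    using singular_map_cycles_mod[OF singular_map_id c] chain_map_ident[OF cycles_mod_chain[OF c]] by simp
qed

lemma inv_homology_mod:
  assumes "c \<in> cycles_mod p n X"
  shows "inv\<^bsub>homology_mod p n X\<^esub> hom_class p n X c = hom_class p n X (- c)"
proof -
  interpret comm_group "homology_mod p n X" by (rule comm_group_homology_mod)
  show ?thesis
    using assms by (intro inv_equality)
      (simp_all add: mult_homology_mod cycles_mod_minus one_homology_mod carrier_homology_mod)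
qed

lemma subgroup_basepoint_homology: "subgroup (basepoint_homology p n Y y0) (homology_mod p n Y)"
proof -
  interpret comm_group "homology_mod p n Y" by (rule comm_group_homology_mod)
  let ?Z = "cycles_mod p n (subtopology Y {y0})"
  have Z: "c \<in> cycles_mod p n Y" if "c \<in> ?Z" for c using that cycles_mod_subtopology by blast
  show ?thesis
    unfolding basepoint_homology_eq
  proof (rule subgroupI)
    show "hom_class p n Y ` ?Z \<subseteq> carrier (homology_mod p n Y)"
      using Z by (auto simp: carrier_homology_mod)
    show "hom_class p n Y ` ?Z \<noteq> {}" using cycles_mod_0 by blast
    show "inv\<^bsub>homology_mod p n Y\<^esub> a \<in> hom_class p n Y ` ?Z" if "a \<in> hom_class p n Y ` ?Z" for a
      using that Z by (auto simp: inv_homology_mod cycles_mod_minus)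
    show "a \<otimes>\<^bsub>homology_mod p n Y\<^esub> b \<in> hom_class p n Y ` ?Z"
      if "a \<in> hom_class p n Y ` ?Z" "b \<in> hom_class p n Y ` ?Z" for a b
      using that Z by (auto simp: mult_homology_mod cycles_mod_add)
  qed
qed

lemma comm_group_red_homology: "comm_group (red_homology p n Y y0)"
  unfolding red_homology_def
  by (rule comm_group.abelian_FactGroup[OF comm_group_homology_mod subgroup_basepoint_homology])

definition red_chain_class :: "nat \<Rightarrow> nat \<Rightarrow> 'a topology \<Rightarrow> 'a \<Rightarrow> 'a chain \<Rightarrow> 'a chain set set" where
  "red_chain_class p n Y y0 c = red_class p n Y y0 (hom_class p n Y c)"

lemma carrier_red_homology: "carrier (red_homology p n Y y0) = red_chain_class p n Y y0 ` cycles_mod p n Y"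
  unfolding red_homology_def carrier_FactGroup carrier_homology_mod
  by (simp add: red_chain_class_def[abs_def] red_class_def image_image)

lemma red_chain_class_closed: "c \<in> cycles_mod p n Y \<Longrightarrow> red_chain_class p n Y y0 c \<in> carrier (red_homology p n Y y0)"
  by (simp add: carrier_red_homology)

lemma mult_red_homology:
  assumes "c \<in> cycles_mod p n Y" "d \<in> cycles_mod p n Y"
  shows "red_chain_class p n Y y0 c \<otimes>\<^bsub>red_homology p n Y y0\<^esub> red_chain_class p n Y y0 d =
    red_chain_class p n Y y0 (c + d)"
proof -
  interpret comm_group "homology_mod p n Y" by (rule comm_group_homology_mod)
  interpret normal "basepoint_homology p n Y y0" "homology_mod p n Y"
    by (rule subgroup_imp_normal[OF subgroup_basepoint_homology])
  show ?thesis
    using rcos_sum[of "hom_class p n Y c" "hom_class p n Y d"] assms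
    by (simp add: red_homology_def red_chain_class_def red_class_def carrier_homology_mod mult_homology_mod)
qed

text \<open>The cycle \<open>e\<close> is the ambiguity left by choosing a class in a reduced class;
  checks that a map is well defined on reduced homology end here.\<close>

lemma red_chain_class_add_basepoint:
  assumes c: "c \<in> cycles_mod p n Y" and e: "e \<in> cycles_mod p n (subtopology Y {y0})"
  shows "red_chain_class p n Y y0 (e + c) = red_chain_class p n Y y0 c"
proof -
  interpret comm_group "homology_mod p n Y" by (rule comm_group_homology_mod)
  have eY: "e \<in> cycles_mod p n Y" using e cycles_mod_subtopology by blast
  have "hom_class p n Y (e + c) \<in> basepoint_homology p n Y y0 #>\<^bsub>homology_mod p n Y\<^esub> hom_class p n Y c"
    unfolding r_coset_def basepoint_homology_eq using mult_homology_mod[OF eY c] e by auto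
  from repr_independence[OF this _ subgroup_basepoint_homology] c
  show ?thesis by (simp add: red_chain_class_def red_class_def carrier_homology_mod)
qed

lemma some_red_chain_class:
  assumes c: "c \<in> cycles_mod p n Y"
  obtains e where "e \<in> cycles_mod p n (subtopology Y {y0})"
    "(SOME A. A \<in> red_chain_class p n Y y0 c) = hom_class p n Y (e + c)"
proof -
  interpret comm_group "homology_mod p n Y" by (rule comm_group_homology_mod)
  have "hom_class p n Y c \<in> red_chain_class p n Y y0 c"
    unfolding red_chain_class_def red_class_def
    by (rule rcos_self[OF _ subgroup_basepoint_homology]) (simp add: carrier_homology_mod c)
  then have "(SOME A. A \<in> red_chain_class p n Y y0 c) \<in> red_chain_class p n Y y0 c" by (rule someI)
  then obtain e where "e \<in> cycles_mod p n (subtopology Y {y0})"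
    "(SOME A. A \<in> red_chain_class p n Y y0 c) = hom_class p n Y e \<otimes>\<^bsub>homology_mod p n Y\<^esub> hom_class p n Y c"
    unfolding red_chain_class_def red_class_def r_coset_def basepoint_homology_eq by auto
  moreover from this(1) have "e \<in> cycles_mod p n Y" using cycles_mod_subtopology by blast
  ultimately show ?thesis using that c by (simp add: mult_homology_mod)
qed

text \<open>The class of 0 is idempotent, and the only idempotent of a group is its unit.\<close>

lemma one_red_homology: "\<one>\<^bsub>red_homology p n Y y0\<^esub> = red_chain_class p n Y y0 0"
proof -
  interpret comm_group "red_homology p n Y y0" by (rule comm_group_red_homology)
  have "red_chain_class p n Y y0 0 \<otimes>\<^bsub>red_homology p n Y y0\<^esub> red_chain_class p n Y y0 0 = red_chain_class p n Y y0 0"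
    by (simp add: mult_red_homology cycles_mod_0)
  then show ?thesis
    using red_chain_class_closed[OF cycles_mod_0] by (metis r_cancel_one')
qed

lemma red_map_red_chain_class:
  assumes f: "singular_map Y Z f" and y0: "f y0 = z0" and c: "c \<in> cycles_mod p n Y"
  shows "red_map p n Z z0 f (red_chain_class p n Y y0 c) = red_chain_class p n Z z0 (chain_map n f c)"
proof -
  obtain e where e: "e \<in> cycles_mod p n (subtopology Y {y0})"
    and s: "(SOME A. A \<in> red_chain_class p n Y y0 c) = hom_class p n Y (e + c)"
    using some_red_chain_class[OF c] .
  have "e + c \<in> cycles_mod p n Y" using e c cycles_mod_subtopology cycles_mod_add by blast
  then have "red_map p n Z z0 f (red_chain_class p n Y y0 c) = red_chain_class p n Z z0 (chain_map n f (e + c))"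
    unfolding red_map_def s by (simp add: hom_map_hom_class[OF f] red_chain_class_def)
  moreover have "singular_map (subtopology Y {y0}) (subtopology Z {z0}) f"
    using f by (rule singular_map_subtopology) (simp add: y0)
  ultimately show ?thesis
    using red_chain_class_add_basepoint[OF singular_map_cycles_mod[OF f c] singular_map_cycles_mod[OF _ e]]
    by (simp add: chain_map_add)
qed

subsection \<open>Cross products of homology classes\<close>

lemma cycles_mod_chain_cross:
  assumes a: "a \<in> cycles_mod p m X" and b: "b \<in> cycles_mod p n Y"
  shows "chain_cross m n a b \<in> cycles_mod p (m + n) (prod_topology X Y)"
proof -
  obtain d where d: "singular_chain m X a" "singular_chain (m - 1) X d" "chain_boundary m a = frag_cmul (int p) d"
    using a by (auto simp: cycles_mod_def)
  obtain e where e: "singular_chain n Y b" "singular_chain (n - 1) Y e" "chain_boundary n b = frag_cmul (int p) e"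
    using b by (auto simp: cycles_mod_def)
  \<comment> \<open>For \<open>m = 0\<close> the degree \<open>m - 1 + n\<close> would be
    \<open>n\<close> instead of \<open>m + n - 1\<close>; the boundary of \<open>a\<close> is 0
    then, so 0 is the right value.\<close>
  define D where "D = (if m = 0 then 0 else chain_cross (m - 1) n d b)"
  define E where "E = (if n = 0 then 0 else chain_cross m (n - 1) a e)"
  have "singular_chain (m + n - 1) (prod_topology X Y) D"
    using singular_chain_chain_cross[OF d(2) e(1)] by (cases m) (simp_all add: D_def)
  moreover have "singular_chain (m + n - 1) (prod_topology X Y) E"
    using singular_chain_chain_cross[OF d(1) e(2)] by (cases n) (simp_all add: E_def)
  moreover have "chain_cross (m - 1) n (chain_boundary m a) b = frag_cmul (int p) D"
    using d(3) by (auto simp: D_def chain_cross_cmul chain_boundary_def)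
  moreover have "chain_cross m (n - 1) a (chain_boundary n b) = frag_cmul (int p) E"
    using e(3) by (auto simp: E_def chain_cross_cmul chain_boundary_def)
  ultimately show ?thesis
    using singular_chain_chain_cross[OF d(1) e(1)]
    by (intro cycles_modI[where d="D + frag_cmul ((-1) ^ m) E"])
      (simp_all only: chain_boundary_chain_cross singular_chain_add singular_chain_cmul frag_cmul_distrib2
        frag_cmul_cmul mult.commute)
qed

lemma boundaries_mod_chain_cross_left:
  assumes a: "a \<in> boundaries_mod p m X" and b: "b \<in> cycles_mod p n Y"
  shows "chain_cross m n a b \<in> boundaries_mod p (m + n) (prod_topology X Y)"
proof -
  obtain e d where a: "singular_chain (Suc m) X e" "singular_chain m X d" "a = chain_boundary (Suc m) e + frag_cmul (int p) d"
    using a by (auto simp: boundaries_mod_def)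
  obtain f where b: "singular_chain n Y b" "singular_chain (n - 1) Y f" "chain_boundary n b = frag_cmul (int p) f"
    using b by (auto simp: cycles_mod_def)
  define E where "E = (if n = 0 then 0 else chain_cross (Suc m) (n - 1) e f)"
  have E: "singular_chain (m + n) (prod_topology X Y) E"
    using singular_chain_chain_cross[OF a(1) b(2)] by (cases n) (simp_all add: E_def)
  have "chain_cross (Suc m) (n - 1) e (chain_boundary n b) = frag_cmul (int p) E"
    using b(3) by (auto simp: E_def chain_cross_cmul chain_boundary_def)
  then have "chain_boundary (Suc (m + n)) (chain_cross (Suc m) n e b) =
      chain_cross m n (chain_boundary (Suc m) e) b + frag_cmul ((-1) ^ Suc m) (frag_cmul (int p) E)"
    using chain_boundary_chain_cross[of "Suc m" n e b] by simp
  \<comment> \<open>The Leibniz rule solved for the product with the boundary of \<open>e\<close>.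
    As \<open>b\<close> is a cycle only modulo \<open>p\<close>, the other Leibniz term does not
    vanish, but it is a multiple of \<open>p\<close> and joins the second summand.\<close>
  then have "chain_cross m n a b = chain_boundary (Suc (m + n)) (chain_cross (Suc m) n e b)
      + frag_cmul (int p) (chain_cross m n d b - frag_cmul ((-1) ^ Suc m) E)"
    unfolding a(3) chain_cross_add chain_cross_cmul frag_cmul_diff
    by (simp add: mult.commute)
  moreover have "singular_chain (Suc (m + n)) (prod_topology X Y) (chain_cross (Suc m) n e b)"
    using singular_chain_chain_cross[OF a(1) b(1)] by simp
  ultimately show ?thesis
    using singular_chain_chain_cross[OF a(2) b(1)] E
    by (simp only: boundaries_modI singular_chain_diff singular_chain_cmul)
qed

lemma boundaries_mod_chain_cross_right:
  assumes a: "a \<in> cycles_mod p m X" and b: "b \<in> boundaries_mod p n Y"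
  shows "chain_cross m n a b \<in> boundaries_mod p (m + n) (prod_topology X Y)"
proof -
  obtain e d where b: "singular_chain (Suc n) Y e" "singular_chain n Y d" "b = chain_boundary (Suc n) e + frag_cmul (int p) d"
    using b by (auto simp: boundaries_mod_def)
  obtain f where a: "singular_chain m X a" "singular_chain (m - 1) X f" "chain_boundary m a = frag_cmul (int p) f"
    using a by (auto simp: cycles_mod_def)
  define E where "E = (if m = 0 then 0 else chain_cross (m - 1) (Suc n) f e)"
  have E: "singular_chain (m + n) (prod_topology X Y) E"
    using singular_chain_chain_cross[OF a(2) b(1)] by (cases m) (simp_all add: E_def)
  have "chain_cross (m - 1) (Suc n) (chain_boundary m a) e = frag_cmul (int p) E"
    using a(3) by (auto simp: E_def chain_cross_cmul chain_boundary_def)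
  then have *: "chain_boundary (Suc (m + n)) (chain_cross m (Suc n) a e) =
      frag_cmul (int p) E + frag_cmul ((-1) ^ m) (chain_cross m n a (chain_boundary (Suc n) e))"
    using chain_boundary_chain_cross[of m "Suc n" a e] by simp
  \<comment> \<open>The boundary passes \<open>a\<close> at the cost of \<open>(-1) ^ m\<close>.
    This sign is its own inverse, so it can be moved onto the bounding chain.\<close>
  have "chain_cross m n a (chain_boundary (Suc n) e) =
      frag_cmul ((-1) ^ m) (chain_boundary (Suc (m + n)) (chain_cross m (Suc n) a e) - frag_cmul (int p) E)"
    unfolding * by (simp flip: power_mult_distrib)
  then have "chain_cross m n a b = chain_boundary (Suc (m + n)) (frag_cmul ((-1) ^ m) (chain_cross m (Suc n) a e))
      + frag_cmul (int p) (chain_cross m n a d - frag_cmul ((-1) ^ m) E)"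
    unfolding b(3) chain_cross_add chain_cross_cmul frag_cmul_diff chain_boundary_cmul
    by (simp add: mult.commute)
  moreover have "singular_chain (Suc (m + n)) (prod_topology X Y) (chain_cross m (Suc n) a e)"
    using singular_chain_chain_cross[OF a(1) b(1)] by simp
  ultimately show ?thesis
    using singular_chain_chain_cross[OF a(1) b(2)] E
    by (simp only: boundaries_modI singular_chain_diff singular_chain_cmul)
qed

lemma hom_class_kprod:
  assumes "simplex_Hausdorff X" "simplex_Hausdorff Y"
  shows "cycles_mod p n (kprod X Y) = cycles_mod p n (prod_topology X Y)"
    "hom_class p n (kprod X Y) = hom_class p n (prod_topology X Y)"
  by (rule homology_mod_cong, rule singular_simplex_kprod[OF assms])+

lemma hom_cross_hom_class:
  assumes X: "simplex_Hausdorff X" and Y: "simplex_Hausdorff Y"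
    and a: "a \<in> cycles_mod p m X" and b: "b \<in> cycles_mod p n Y"
  shows "hom_cross p m n X Y (hom_class p m X a) (hom_class p n Y b) =
    hom_class p (m + n) (prod_topology X Y) (chain_cross m n a b)"
proof -
  obtain a' where a': "a' \<in> boundaries_mod p m X" "(SOME x. x \<in> hom_class p m X a) = a + a'"
    using some_hom_class[OF a] .
  obtain b' where b': "b' \<in> boundaries_mod p n Y" "(SOME x. x \<in> hom_class p n Y b) = b + b'"
    using some_hom_class[OF b] .
  have "b + b' \<in> cycles_mod p n Y" using b b'(1) boundaries_mod_subset_cycles_mod cycles_mod_add by blast
  \<comment> \<open>The error of the chosen pair is split asymmetrically, so that in each part one
    factor is a boundary and the other a cycle.\<close>
  from boundaries_mod_chain_cross_left[OF a'(1) this] boundaries_mod_chain_cross_right[OF a b'(1)]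
  have "chain_cross m n a b' + chain_cross m n a' (b + b') \<in> boundaries_mod p (m + n) (prod_topology X Y)"
    by (intro boundaries_mod_add)
  then show ?thesis
    unfolding hom_cross_def a'(2) b'(2) hom_class_kprod[OF X Y]
    by (intro hom_class_eqI) (simp add: chain_cross_add add_ac)
qed

section \<open>The homology suspension on cycles\<close>

definition circle_chain :: "complex chain" where
  "circle_chain = frag_of (\<lambda>x\<in>standard_simplex 1. cis (2 * pi * x 1))"

lemma circle_chain_cycle: "circle_chain \<in> cycles_mod p 1 circle"
proof (rule cycles_modI[where d=0])
  let ?s = "\<lambda>x\<in>standard_simplex 1. cis (2 * pi * x 1)"
  have "continuous_map (simplex_space 1) euclideanreal (\<lambda>x. x 1)"
    by (intro continuous_map_from_subtopology continuous_map_product_projection) simp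
  moreover have "continuous_map euclideanreal circle (\<lambda>r. cis (2 * pi * r))"
    by (auto simp: continuous_map_in_subtopology intro!: continuous_intros)
  ultimately have "continuous_map (simplex_space 1) circle ((\<lambda>r. cis (2 * pi * r)) \<circ> (\<lambda>x. x 1))"
    by (rule continuous_map_compose)
  then have "singular_simplex 1 circle (restrict ((\<lambda>r. cis (2 * pi * r)) \<circ> (\<lambda>x. x 1)) (standard_simplex 1))"
    by (rule singular_simplex_restrict)
  then show "singular_chain 1 circle circle_chain"
    by (simp add: circle_chain_def singular_chain_of comp_def)
  \<comment> \<open>Both ends of the loop are the point 1, so the boundary is 0 even
    integrally.\<close>
  have "singular_face 1 0 ?s = singular_face 1 1 ?s"
    by (auto simp: singular_face_def standard_simplex_0 simplical_face_def standard_simplex_def fun_eq_iff)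
  then show "chain_boundary 1 circle_chain = frag_cmul (int p) 0"
    by (simp add: circle_chain_def chain_boundary_of)
qed simp

lemma circle_class_eq: "circle_class p = hom_class p 1 circle circle_chain"
  by (simp add: circle_class_def circle_chain_def)

abbreviation loop_eval :: "(complex \<Rightarrow> 'a) \<times> complex \<Rightarrow> 'a" where
  "loop_eval \<equiv> \<lambda>(\<alpha>, t). \<alpha> t"

text \<open>The counit evaluates a chosen point of the class. The only class with several points is
  the collapsed wedge, and all of its points evaluate to \<open>z0\<close>.\<close>

lemma loop_counit_smash_point:
  assumes \<alpha>: "\<alpha> \<in> loops Z z0" and t: "t \<in> sphere 0 1" and z0: "z0 \<in> topspace Z"
  shows "loop_counit (smash_point (loop_space Z z0) (const_loop z0) (\<alpha>, t)) = \<alpha> t"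
proof (cases "\<alpha> = const_loop z0 \<or> t = 1")
  case True
  let ?S = "{const_loop z0} \<times> sphere 0 1 \<union> loops Z z0 \<times> {1}"
  have S: "smash_point (loop_space Z z0) (const_loop z0) (\<alpha>, t) = ?S"
    using True by (simp add: smash_point_def topspace_loop_space)
  have some: "(SOME q. q \<in> ?S) \<in> ?S"
    by (rule someI[of _ "(const_loop z0, 1)"]) (simp add: const_loop_in_loops z0)
  have "loop_eval q = z0" if "q \<in> ?S" for q
    using that loops_base by (auto simp: const_loop_def)
  from this[OF some] have "loop_eval (SOME q. q \<in> ?S) = z0" .
  moreover have "\<alpha> t = z0"
    using True
  proof
    assume "\<alpha> = const_loop z0"
    then show ?thesis using t by (simp only: const_loop_def restrict_apply if_True)
  next
    assume "t = 1"
    then show ?thesis using loops_base[OF \<alpha>] by simp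
  qed
  ultimately show ?thesis unfolding S loop_counit_def by simp
next
  case False
  then show ?thesis by (simp add: smash_point_def loop_counit_def)
qed

lemma singular_map_loop_counit:
  assumes z0: "z0 \<in> topspace Z"
  shows "singular_map (suspension (loop_space Z z0) (const_loop z0)) Z loop_counit"
proof (rule singular_map_continuous)
  let ?q = "smash_point (loop_space Z z0) (const_loop z0)"
  have "continuous_map (kprod (loop_space Z z0) circle) Z loop_eval"
    unfolding kprod_def by (intro continuous_map_from_kify continuous_map_eval)
  then have "continuous_map (kprod (loop_space Z z0) circle) Z (loop_counit \<circ> ?q)"
    by (rule continuous_map_eq)
      (auto simp: kprod_def topspace_loop_space loop_counit_smash_point z0)
  then show "continuous_map (suspension (loop_space Z z0) (const_loop z0)) Z loop_counit"
    unfolding suspension_def using quotient_map_quotient_topology continuous_compose_quotient_map by blast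
qed

text \<open>The quotient map to the smash product followed by the counit is evaluation, so the
  suspension drops out and a formula in \<open>Z\<close> alone remains.\<close>

lemma hom_suspension_red_chain_class:
  assumes Z: "weak_Hausdorff Z" and z0: "z0 \<in> topspace Z" and b: "b \<in> cycles_mod p n (loop_space Z z0)"
  shows "hom_suspension p n Z z0 (red_chain_class p n (loop_space Z z0) (const_loop z0) b) =
    red_chain_class p (Suc n) Z z0 (chain_map (Suc n) loop_eval (chain_cross n 1 b circle_chain))"
    and "chain_map (Suc n) loop_eval (chain_cross n 1 b circle_chain) \<in> cycles_mod p (Suc n) Z"
proof -
  let ?Y = "loop_space Z z0" and ?y = "const_loop z0"
  let ?S = "suspension ?Y ?y" and ?q = "smash_point ?Y ?y"
  have Y: "simplex_Hausdorff ?Y" using Z by (rule simplex_Hausdorff_loop_space)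
  have S1: "simplex_Hausdorff circle" using circle_compact(2) by (rule Hausdorff_simplex_Hausdorff)
  obtain e where e: "e \<in> cycles_mod p n (subtopology ?Y {?y})"
    and some: "(SOME A. A \<in> red_chain_class p n ?Y ?y b) = hom_class p n ?Y (e + b)"
    using some_red_chain_class[OF b] .
  have eb: "e + b \<in> cycles_mod p n ?Y" using e b cycles_mod_subtopology cycles_mod_add by blast
  let ?c = "chain_cross n 1 (e + b) circle_chain"
  have c: "?c \<in> cycles_mod p (n + 1) (prod_topology ?Y circle)"
    using cycles_mod_chain_cross[OF eb circle_chain_cycle] .
  have ev: "singular_map (prod_topology ?Y circle) Z loop_eval"
    by (rule singular_map_continuous[OF continuous_map_eval])
  have "singular_map (kprod ?Y circle) ?S ?q"
    unfolding suspension_def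
    by (intro singular_map_continuous quotient_imp_continuous_map quotient_map_quotient_topology)
  then have q: "singular_map (prod_topology ?Y circle) ?S ?q"
    by (simp add: singular_map_def singular_simplex_kprod[OF Y S1])
  have "suspension_iso p n ?Y ?y (red_chain_class p n ?Y ?y b) =
      red_chain_class p (n + 1) ?S (suspension_basepoint ?Y ?y) (chain_map (n + 1) ?q ?c)"
    unfolding suspension_iso_def some circle_class_eq hom_cross_hom_class[OF Y S1 eb circle_chain_cycle]
    by (simp only: hom_map_hom_class[OF q c] red_chain_class_def)
  moreover have "loop_counit (suspension_basepoint ?Y ?y) = z0"
    unfolding suspension_basepoint_def
    using loop_counit_smash_point[OF const_loop_in_loops[OF z0] _ z0, of 1] by (simp add: const_loop_def)
  ultimately have "hom_suspension p n Z z0 (red_chain_class p n ?Y ?y b) =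
      red_chain_class p (n + 1) Z z0 (chain_map (n + 1) loop_counit (chain_map (n + 1) ?q ?c))"
    unfolding hom_suspension_def
    by (simp only: red_map_red_chain_class[OF singular_map_loop_counit[OF z0] _ singular_map_cycles_mod[OF q c]])
  also have "chain_map (n + 1) loop_counit (chain_map (n + 1) ?q ?c) = chain_map (n + 1) (loop_counit \<circ> ?q) ?c"
    by (simp add: chain_map_compose)
  also have "\<dots> = chain_map (n + 1) loop_eval ?c"
    using cycles_mod_chain[OF c]
    by (rule chain_map_eq) (auto simp: topspace_loop_space loop_counit_smash_point z0)
  also have "\<dots> = chain_map (n + 1) loop_eval (chain_cross n 1 e circle_chain)
      + chain_map (n + 1) loop_eval (chain_cross n 1 b circle_chain)"
    by (simp only: chain_cross_add chain_map_add)
  also have "red_chain_class p (n + 1) Z z0 \<dots> =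
      red_chain_class p (n + 1) Z z0 (chain_map (n + 1) loop_eval (chain_cross n 1 b circle_chain))"
  proof (rule red_chain_class_add_basepoint)
    show "chain_map (n + 1) loop_eval (chain_cross n 1 b circle_chain) \<in> cycles_mod p (n + 1) Z"
      by (rule singular_map_cycles_mod[OF ev cycles_mod_chain_cross[OF b circle_chain_cycle]])
    \<comment> \<open>The chosen class is ambiguous up to \<open>e\<close> at the constant loop;
      evaluation sends that slice to \<open>z0\<close>, so the ambiguity vanishes in reduced
      homology.\<close>
    have "singular_map (subtopology (prod_topology ?Y circle) ({?y} \<times> topspace circle)) (subtopology Z {z0}) loop_eval"
      using ev by (rule singular_map_subtopology) (auto simp: const_loop_def)
    then have "singular_map (prod_topology (subtopology ?Y {?y}) circle) (subtopology Z {z0}) loop_eval"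
      by (simp only: prod_topology_subtopology(1)[of ?Y "{?y}" circle])
    from singular_map_cycles_mod[OF this cycles_mod_chain_cross[OF e circle_chain_cycle]]
    show "chain_map (n + 1) loop_eval (chain_cross n 1 e circle_chain) \<in> cycles_mod p (n + 1) (subtopology Z {z0})" .
  qed
  finally show "hom_suspension p n Z z0 (red_chain_class p n ?Y ?y b) =
    red_chain_class p (Suc n) Z z0 (chain_map (Suc n) loop_eval (chain_cross n 1 b circle_chain))" by simp
  show "chain_map (Suc n) loop_eval (chain_cross n 1 b circle_chain) \<in> cycles_mod p (Suc n) Z"
    using singular_map_cycles_mod[OF ev cycles_mod_chain_cross[OF b circle_chain_cycle]] by simp
qed

section \<open>The module structure on cycles\<close>

lemma orbit_space_basepoint_fixed:
  assumes C: "is_operad C" and X: "operad_algebra C X \<theta>" and Q: "Q \<in> topspace (orbit_space C k)"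
  shows "diagonal_action \<theta> k (Q, algebra_basepoint C \<theta>) = algebra_basepoint C \<theta>"
proof -
  interpret finite_right_action "sym_group k" "opspace C k" "opact C k"
    by (rule operad_finite_right_action[OF C])
  obtain c where c: "c \<in> topspace (opspace C k)" "Q = orbit C k c"
    using Q by (auto simp: orbit_space_def topspace_quotient_topology)
  have "c \<in> Q" using in_orb[OF c(1)] c(2) by (simp add: orbit_def)
  then have "(SOME c. c \<in> Q) \<in> orbit C k c" using c(2) by (metis someI)
  then have "(SOME c. c \<in> Q) \<in> topspace (opspace C k)"
    using act_closed[OF c(1)] by (auto simp: orbit_def)
  then show ?thesis
    using algebra_basepoint_fixed[OF C X] by (simp add: diagonal_action_def)
qed

text \<open>The space \<open>Y\<close> is arbitrary so that \<open>X\<close> and its loop space are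
  treated at once; they differ only in why \<open>act\<close> and \<open>base\<close> hold.\<close>

lemma red_circ_red_chain_class:
  assumes C: "is_operad C" and Y: "simplex_Hausdorff Y"
    and act: "singular_map (prod_topology (orbit_space C k) Y) Y (diagonal_action \<theta> k)"
    and base: "\<And>Q. Q \<in> topspace (orbit_space C k) \<Longrightarrow> diagonal_action \<theta> k (Q, y0) = y0"
    and y0: "y0 = algebra_basepoint C \<theta>"
    and a: "a \<in> cycles_mod p m (orbit_space C k)" and b: "b \<in> cycles_mod p n Y"
  shows "red_circ p C Y \<theta> (k, m) n (hom_class p m (orbit_space C k) a) (red_chain_class p n Y y0 b) =
    red_chain_class p (m + n) Y y0 (chain_map (m + n) (diagonal_action \<theta> k) (chain_cross m n a b))"
    and "chain_map (m + n) (diagonal_action \<theta> k) (chain_cross m n a b) \<in> cycles_mod p (m + n) Y"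
proof -
  let ?D = "diagonal_action \<theta> k" and ?Q = "orbit_space C k"
  have Q: "simplex_Hausdorff ?Q" using C by (rule simplex_Hausdorff_operad_orbit_space)
  show cyc: "chain_map (m + n) ?D (chain_cross m n a b) \<in> cycles_mod p (m + n) Y"
    by (rule singular_map_cycles_mod[OF act cycles_mod_chain_cross[OF a b]])
  obtain e where e: "e \<in> cycles_mod p n (subtopology Y {y0})"
    and some: "(SOME A. A \<in> red_chain_class p n Y y0 b) = hom_class p n Y (e + b)"
    using some_red_chain_class[OF b] .
  have eb: "e + b \<in> cycles_mod p n Y" using e b cycles_mod_subtopology cycles_mod_add by blast
  have "red_circ p C Y \<theta> (k, m) n (hom_class p m ?Q a) (red_chain_class p n Y y0 b) =
      red_chain_class p (m + n) Y y0 (chain_map (m + n) ?D (chain_cross m n a (e + b)))"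
    unfolding red_circ_def hom_circ_def prod.case some hom_cross_hom_class[OF Q Y a eb]
      hom_map_hom_class[OF act cycles_mod_chain_cross[OF a eb]]
    by (simp only: red_chain_class_def y0)
  also have "chain_map (m + n) ?D (chain_cross m n a (e + b)) =
      chain_map (m + n) ?D (chain_cross m n a e) + chain_map (m + n) ?D (chain_cross m n a b)"
    by (simp only: chain_cross_add chain_map_add)
  also have "red_chain_class p (m + n) Y y0 \<dots> = red_chain_class p (m + n) Y y0 (chain_map (m + n) ?D (chain_cross m n a b))"
  proof (rule red_chain_class_add_basepoint[OF cyc])
    have "singular_map (subtopology (prod_topology ?Q Y) (topspace ?Q \<times> {y0})) (subtopology Y {y0}) ?D"
      using act by (rule singular_map_subtopology) (auto simp: base)
    then have "singular_map (prod_topology ?Q (subtopology Y {y0})) (subtopology Y {y0}) ?D"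
      by (simp only: prod_topology_subtopology(2)[of ?Q Y "{y0}"])
    from singular_map_cycles_mod[OF this cycles_mod_chain_cross[OF a e]]
    show "chain_map (m + n) ?D (chain_cross m n a e) \<in> cycles_mod p (m + n) (subtopology Y {y0})" .
  qed
  finally show "red_circ p C Y \<theta> (k, m) n (hom_class p m ?Q a) (red_chain_class p n Y y0 b) =
    red_chain_class p (m + n) Y y0 (chain_map (m + n) ?D (chain_cross m n a b))" .
qed

text \<open>
  Both sides are the push-forward of \<open>a \<times> b \<times> \<iota>\<close> along \<open>([c], \<alpha>, t) \<mapsto> \<theta>(c; \<alpha>(t), \<dots>, \<alpha>(t))\<close>.
\<close>

lemma suspension_diagonal_chain:
  assumes a: "singular_chain m (orbit_space C k) a" and b: "singular_chain n (loop_space Z z0) b"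
  shows "chain_map (Suc (m + n)) loop_eval
      (chain_cross (m + n) 1 (chain_map (m + n) (diagonal_action (loop_action \<theta>) k) (chain_cross m n a b)) circle_chain)
    = chain_map (m + Suc n) (diagonal_action \<theta> k)
      (chain_cross m (Suc n) a (chain_map (Suc n) loop_eval (chain_cross n 1 b circle_chain)))"
proof -
  let ?Q = "orbit_space C k" and ?Y = "loop_space Z z0"
  let ?D = "diagonal_action (loop_action \<theta>) k" and ?E = "diagonal_action \<theta> k"
  let ?N = "m + n + 1" and ?c = "chain_cross (m + n) 1 (chain_cross m n a b) circle_chain"
  have \<iota>: "singular_chain 1 circle circle_chain"
    using cycles_mod_chain[OF circle_chain_cycle] .
  have c: "singular_chain ?N (prod_topology (prod_topology ?Q ?Y) circle) ?c"
    by (intro singular_chain_chain_cross a b \<iota>)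
  \<comment> \<open>An identity is inserted on the circle factor to make naturality of the cross
    product applicable; it is removed at the end.\<close>
  have "chain_map ?N loop_eval (chain_cross (m + n) 1 (chain_map (m + n) ?D (chain_cross m n a b)) (chain_map 1 id circle_chain))
      = chain_map ?N (loop_eval \<circ> map_prod ?D id) ?c"
    by (simp only: chain_cross_chain_map chain_map_compose comp_apply)
  \<comment> \<open>The operations on loops are pointwise, so evaluating at \<open>t\<close> before
    or after the action gives the same point.\<close>
  also have "\<dots> = chain_map ?N (?E \<circ> map_prod id loop_eval \<circ> reassoc) ?c"
    using c
  proof (rule chain_map_eq)
    fix z assume "z \<in> topspace (prod_topology (prod_topology ?Q ?Y) circle)"
    then obtain Q \<alpha> t where z: "z = ((Q, \<alpha>), t)" "t \<in> sphere 0 1" by auto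
    have "(\<lambda>i\<in>{1..k}. (\<lambda>i\<in>{1..k}. \<alpha>) i t) = (\<lambda>i\<in>{1..k}. \<alpha> t)" by (rule restrict_ext) simp
    then show "(loop_eval \<circ> map_prod ?D id) z = (?E \<circ> map_prod id loop_eval \<circ> reassoc) z"
      using z(2) by (simp add: z(1) diagonal_action_def loop_action_def)
  qed
  also have "\<dots> = chain_map ?N ?E (chain_map ?N (map_prod id loop_eval) (chain_map ?N reassoc ?c))"
    by (simp only: chain_map_compose comp_apply)
  also have "chain_map ?N reassoc ?c = chain_cross m (n + 1) a (chain_cross n 1 b circle_chain)"
    by (rule chain_cross_assoc)
  also have "chain_map ?N (map_prod id loop_eval) \<dots> =
      chain_cross m (n + 1) (chain_map m id a) (chain_map (n + 1) loop_eval (chain_cross n 1 b circle_chain))"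
    by (simp only: chain_cross_chain_map add.assoc)
  finally show ?thesis
    unfolding chain_map_ident[OF \<iota>] chain_map_ident[OF a] by simp
qed

section \<open>The module map\<close>

lemma finprod_hom:
  assumes "comm_group G" "comm_group H" and h: "\<And>x. x \<in> carrier G \<Longrightarrow> h x \<in> carrier H"
    "\<And>x y. x \<in> carrier G \<Longrightarrow> y \<in> carrier G \<Longrightarrow> h (x \<otimes>\<^bsub>G\<^esub> y) = h x \<otimes>\<^bsub>H\<^esub> h y"
    and f: "finite A" "f \<in> A \<rightarrow> carrier G"
  shows "h (finprod G f A) = finprod H (\<lambda>i. h (f i)) A"
proof -
  interpret G: comm_group G by fact
  interpret H: comm_group H by fact
  interpret group_hom G H h using h by unfold_locales (auto simp: hom_def)
  show ?thesis
    using f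
  proof (induction A rule: finite_induct)
    case (insert i A)
    then show ?case using h by (simp add: Pi_iff)
  qed simp
qed

context
  fixes p :: nat and C :: "'c operad" and X :: "'x topology" and \<theta> :: "nat \<Rightarrow> 'c \<Rightarrow> (nat \<Rightarrow> 'x) \<Rightarrow> 'x"
  assumes C: "is_operad C" and X: "operad_algebra C X \<theta>"
begin

abbreviation (input) "x0 \<equiv> algebra_basepoint C \<theta>"
abbreviation (input) "\<Omega> \<equiv> loop_space X x0"
abbreviation (input) "\<sigma> \<equiv> \<lambda>n. hom_suspension p n X x0"
abbreviation (input) "H\<Omega> \<equiv> \<lambda>n. red_homology p n \<Omega> (const_loop x0)"
abbreviation (input) "HX \<equiv> \<lambda>n. red_homology p n X x0"
abbreviation (input) "circ\<Omega> \<equiv> red_circ p C \<Omega> (loop_action \<theta>)"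
abbreviation (input) "circX \<equiv> red_circ p C X \<theta>"

section \<open>Suspension and the pairings on reduced classes\<close>

lemma suspension_closed: "x \<in> carrier (H\<Omega> n) \<Longrightarrow> \<sigma> n x \<in> carrier (HX (Suc n))"
  using hom_suspension_red_chain_class[OF algebra_weak_Hausdorff[OF X] algebra_basepoint_in_space[OF C X]]
  by (auto simp: carrier_red_homology)

lemma suspension_mult:
  assumes "x \<in> carrier (H\<Omega> n)" "y \<in> carrier (H\<Omega> n)"
  shows "\<sigma> n (x \<otimes>\<^bsub>H\<Omega> n\<^esub> y) = \<sigma> n x \<otimes>\<^bsub>HX (Suc n)\<^esub> \<sigma> n y"
proof -
  note s = hom_suspension_red_chain_class[OF algebra_weak_Hausdorff[OF X] algebra_basepoint_in_space[OF C X]]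
  obtain b b' where b: "b \<in> cycles_mod p n \<Omega>" "x = red_chain_class p n \<Omega> (const_loop x0) b"
    and b': "b' \<in> cycles_mod p n \<Omega>" "y = red_chain_class p n \<Omega> (const_loop x0) b'"
    using assms by (auto simp: carrier_red_homology)
  show ?thesis
    unfolding b(2) b'(2) mult_red_homology[OF b(1) b'(1)] s(1)[OF cycles_mod_add[OF b(1) b'(1)]]
      s(1)[OF b(1)] s(1)[OF b'(1)] mult_red_homology[OF s(2)[OF b(1)] s(2)[OF b'(1)]]
    by (simp only: chain_cross_add chain_map_add)
qed

lemma suspension_one: "\<sigma> n \<one>\<^bsub>H\<Omega> n\<^esub> = \<one>\<^bsub>HX (Suc n)\<^esub>"
  unfolding one_red_homology
  using hom_suspension_red_chain_class(1)[OF algebra_weak_Hausdorff[OF X] algebra_basepoint_in_space[OF C X] cycles_mod_0]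
  by simp

lemma circX_red_chain_class:
  assumes "a \<in> cycles_mod p m (orbit_space C k)" "b \<in> cycles_mod p n X"
  shows "circX (k, m) n (hom_class p m (orbit_space C k) a) (red_chain_class p n X x0 b) =
      red_chain_class p (m + n) X x0 (chain_map (m + n) (diagonal_action \<theta> k) (chain_cross m n a b))"
    "chain_map (m + n) (diagonal_action \<theta> k) (chain_cross m n a b) \<in> cycles_mod p (m + n) X"
  using red_circ_red_chain_class[OF C weak_Hausdorff_simplex_Hausdorff[OF algebra_weak_Hausdorff[OF X]]
    singular_map_diagonal_action[OF C X] orbit_space_basepoint_fixed[OF C X] refl assms] by auto

lemma circ\<Omega>_red_chain_class:
  assumes "a \<in> cycles_mod p m (orbit_space C k)" "b \<in> cycles_mod p n \<Omega>"
  shows "circ\<Omega> (k, m) n (hom_class p m (orbit_space C k) a) (red_chain_class p n \<Omega> (const_loop x0) b) =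
      red_chain_class p (m + n) \<Omega> (const_loop x0)
        (chain_map (m + n) (diagonal_action (loop_action \<theta>) k) (chain_cross m n a b))"
    "chain_map (m + n) (diagonal_action (loop_action \<theta>) k) (chain_cross m n a b) \<in> cycles_mod p (m + n) \<Omega>"
proof -
  have "diagonal_action (loop_action \<theta>) k (Q, const_loop x0) = const_loop x0"
    if "Q \<in> topspace (orbit_space C k)" for Q
  proof (rule ext)
    fix t :: complex
    have "(\<lambda>i\<in>{1..k}. (\<lambda>i\<in>{1..k}. const_loop x0) i t) = (\<lambda>i\<in>{1..k}. x0)" if "t \<in> sphere 0 1"
      using that by (intro restrict_ext) (simp add: const_loop_def)
    then show "diagonal_action (loop_action \<theta>) k (Q, const_loop x0) t = const_loop x0 t"
      using orbit_space_basepoint_fixed[OF C X \<open>Q \<in> _\<close>]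
      by (simp add: diagonal_action_def loop_action_def const_loop_def restrict_def)
  qed
  note * = red_circ_red_chain_class[OF C simplex_Hausdorff_loop_space[OF algebra_weak_Hausdorff[OF X]]
    singular_map_diagonal_loop_action[OF C X] this algebra_basepoint_loop_action[symmetric] assms]
  show "circ\<Omega> (k, m) n (hom_class p m (orbit_space C k) a) (red_chain_class p n \<Omega> (const_loop x0) b) =
      red_chain_class p (m + n) \<Omega> (const_loop x0)
        (chain_map (m + n) (diagonal_action (loop_action \<theta>) k) (chain_cross m n a b))"
    "chain_map (m + n) (diagonal_action (loop_action \<theta>) k) (chain_cross m n a b) \<in> cycles_mod p (m + n) \<Omega>"
    by (rule *, assumption)+
qed

lemma sym_homologyE:
  assumes "r \<in> carrier (sym_homology p C (k, m))"
  obtains a where "a \<in> cycles_mod p m (orbit_space C k)" "r = hom_class p m (orbit_space C k) a"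
  using assms by (auto simp: sym_homology_def carrier_homology_mod)

lemma circ\<Omega>_closed:
  assumes r: "r \<in> carrier (sym_homology p C i)" and x: "x \<in> carrier (H\<Omega> n)"
  shows "circ\<Omega> i n r x \<in> carrier (H\<Omega> (snd i + n))"
proof -
  obtain k m where i: "i = (k, m)" by (cases i)
  obtain a where a: "a \<in> cycles_mod p m (orbit_space C k)" "r = hom_class p m (orbit_space C k) a"
    using r unfolding i by (rule sym_homologyE)
  obtain b where b: "b \<in> cycles_mod p n \<Omega>" "x = red_chain_class p n \<Omega> (const_loop x0) b"
    using x by (auto simp: carrier_red_homology)
  show ?thesis
    unfolding i a(2) b(2) circ\<Omega>_red_chain_class(1)[OF a(1) b(1)] snd_conv
    by (rule red_chain_class_closed[OF circ\<Omega>_red_chain_class(2)[OF a(1) b(1)]])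
qed

lemma circX_closed:
  assumes r: "r \<in> carrier (sym_homology p C i)" and x: "x \<in> carrier (HX n)"
  shows "circX i n r x \<in> carrier (HX (snd i + n))"
proof -
  obtain k m where i: "i = (k, m)" by (cases i)
  obtain a where a: "a \<in> cycles_mod p m (orbit_space C k)" "r = hom_class p m (orbit_space C k) a"
    using r unfolding i by (rule sym_homologyE)
  obtain b where b: "b \<in> cycles_mod p n X" "x = red_chain_class p n X x0 b"
    using x by (auto simp: carrier_red_homology)
  show ?thesis
    unfolding i a(2) b(2) circX_red_chain_class(1)[OF a(1) b(1)] snd_conv
    by (rule red_chain_class_closed[OF circX_red_chain_class(2)[OF a(1) b(1)]])
qed

text \<open>Suspension may kill a nonzero component. Its term is then absent from the sum over
  nonzero components in \<open>X\<close>, and this shows that the absent term is trivial.\<close>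

lemma circX_one:
  assumes r: "r \<in> carrier (sym_homology p C i)"
  shows "circX i n r \<one>\<^bsub>HX n\<^esub> = \<one>\<^bsub>HX (snd i + n)\<^esub>"
proof -
  obtain k m where i: "i = (k, m)" by (cases i)
  obtain a where a: "a \<in> cycles_mod p m (orbit_space C k)" "r = hom_class p m (orbit_space C k) a"
    using r unfolding i by (rule sym_homologyE)
  show ?thesis
    unfolding i a(2) one_red_homology circX_red_chain_class(1)[OF a(1) cycles_mod_0] snd_conv by simp
qed

text \<open>The homogeneous case, to which the direct sums reduce by additivity.\<close>

lemma suspension_circ:
  assumes r: "r \<in> carrier (sym_homology p C i)" and x: "x \<in> carrier (H\<Omega> n)"
  shows "\<sigma> (snd i + n) (circ\<Omega> i n r x) = circX i (Suc n) r (\<sigma> n x)"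
proof -
  note s = hom_suspension_red_chain_class[OF algebra_weak_Hausdorff[OF X] algebra_basepoint_in_space[OF C X]]
  obtain k m where i: "i = (k, m)" by (cases i)
  obtain a where a: "a \<in> cycles_mod p m (orbit_space C k)" "r = hom_class p m (orbit_space C k) a"
    using r unfolding i by (rule sym_homologyE)
  obtain b where b: "b \<in> cycles_mod p n \<Omega>" "x = red_chain_class p n \<Omega> (const_loop x0) b"
    using x by (auto simp: carrier_red_homology)
  have "\<sigma> (m + n) (circ\<Omega> (k, m) n r x) = red_chain_class p (Suc (m + n)) X x0
      (chain_map (Suc (m + n)) loop_eval (chain_cross (m + n) 1
        (chain_map (m + n) (diagonal_action (loop_action \<theta>) k) (chain_cross m n a b)) circle_chain))"
    unfolding a(2) b(2) circ\<Omega>_red_chain_class(1)[OF a(1) b(1)]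
    by (rule s(1)[OF circ\<Omega>_red_chain_class(2)[OF a(1) b(1)]])
  also have "\<dots> = red_chain_class p (m + Suc n) X x0 (chain_map (m + Suc n) (diagonal_action \<theta> k)
      (chain_cross m (Suc n) a (chain_map (Suc n) loop_eval (chain_cross n 1 b circle_chain))))"
    unfolding suspension_diagonal_chain[OF cycles_mod_chain[OF a(1)] cycles_mod_chain[OF b(1)]] by simp
  also have "\<dots> = circX (k, m) (Suc n) r (\<sigma> n x)"
    unfolding a(2) b(2) s(1)[OF b(1)] by (rule circX_red_chain_class(1)[OF a(1) s(2)[OF b(1)], symmetric])
  finally show ?thesis by (simp add: i)
qed

text \<open>What remains is to match two finite sums: one runs over the nonzero components of
  \<open>x\<close>, the other over the nonzero components of its suspension, one degree
  higher.\<close>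

lemma suspension_module_map:
  "module_map (sym_homology_ring p C)
     (red_homology_module p C \<Omega> (loop_action \<theta>)) (red_homology_module p C X \<theta>)
     (total_hom_suspension p X x0)"
proof -
  let ?R = "sym_homology_ring p C" and ?M = "red_homology_module p C \<Omega> (loop_action \<theta>)"
  let ?N = "red_homology_module p C X \<theta>" and ?\<sigma> = "total_hom_suspension p X x0"
  have grp: "group (sym_homology p C i)" "group (H\<Omega> n)" "group (HX n)" for i n
    unfolding sym_homology_def
    using comm_group.axioms(2)[OF comm_group_homology_mod] comm_group.axioms(2)[OF comm_group_red_homology]
    by (simp_all only: case_prod_unfold)
  have R: "carrier ?R = {r. (\<forall>i. r i \<in> carrier (sym_homology p C i)) \<and> finite {i. r i \<noteq> \<one>\<^bsub>sym_homology p C i\<^esub>}}"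
    by (auto simp: sym_homology_ring_def Let_def carrier_sum_group grp PiE_UNIV_domain)
  have M: "carrier ?M = {x. (\<forall>n. x n \<in> carrier (H\<Omega> n)) \<and> finite {n. x n \<noteq> \<one>\<^bsub>H\<Omega> n\<^esub>}}"
    "x \<oplus>\<^bsub>?M\<^esub> y = (\<lambda>n. x n \<otimes>\<^bsub>H\<Omega> n\<^esub> y n)"
    "r \<odot>\<^bsub>?M\<^esub> x = (\<lambda>N. finprod (H\<Omega> N) (\<lambda>(i, n). circ\<Omega> i n (r i) (x n))
        {(i, n). r i \<noteq> \<one>\<^bsub>sym_homology p C i\<^esub> \<and> x n \<noteq> \<one>\<^bsub>H\<Omega> n\<^esub> \<and> snd i + n = N})" for x y r
    by (auto simp: red_homology_module_def Let_def carrier_sum_group grp PiE_UNIV_domain algebra_basepoint_loop_action)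
  have N: "carrier ?N = {x. (\<forall>n. x n \<in> carrier (HX n)) \<and> finite {n. x n \<noteq> \<one>\<^bsub>HX n\<^esub>}}"
    "x \<oplus>\<^bsub>?N\<^esub> y = (\<lambda>n. x n \<otimes>\<^bsub>HX n\<^esub> y n)"
    "r \<odot>\<^bsub>?N\<^esub> x = (\<lambda>N. finprod (HX N) (\<lambda>(i, n). circX i n (r i) (x n))
        {(i, n). r i \<noteq> \<one>\<^bsub>sym_homology p C i\<^esub> \<and> x n \<noteq> \<one>\<^bsub>HX n\<^esub> \<and> snd i + n = N})" for x y r
    by (auto simp: red_homology_module_def Let_def carrier_sum_group grp PiE_UNIV_domain)
  have \<sigma>0: "?\<sigma> x 0 = \<one>\<^bsub>HX 0\<^esub>" and \<sigma>Suc: "?\<sigma> x (Suc n) = \<sigma> n (x n)" for x n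
    by (simp_all add: total_hom_suspension_def)
  have one: "\<one>\<^bsub>HX n\<^esub> \<in> carrier (HX n)" for n
    using grp(3)[of n] by (simp add: group_def)
  have closed: "?\<sigma> x n \<in> carrier (HX n)" if "x \<in> carrier ?M" for x n
    using that one by (cases n) (simp_all add: \<sigma>0 \<sigma>Suc M suspension_closed)
  show ?thesis
    unfolding module_map_def
  proof (intro conjI ballI)
    show "?\<sigma> \<in> carrier ?M \<rightarrow> carrier ?N"
    proof
      fix x assume x: "x \<in> carrier ?M"
      have "{n. ?\<sigma> x n \<noteq> \<one>\<^bsub>HX n\<^esub>} \<subseteq> Suc ` {n. x n \<noteq> \<one>\<^bsub>H\<Omega> n\<^esub>}"
      proof
        fix n assume "n \<in> {n. ?\<sigma> x n \<noteq> \<one>\<^bsub>HX n\<^esub>}"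
        then show "n \<in> Suc ` {n. x n \<noteq> \<one>\<^bsub>H\<Omega> n\<^esub>}"
          by (cases n) (auto simp: \<sigma>0 \<sigma>Suc suspension_one)
      qed
      then show "?\<sigma> x \<in> carrier ?N"
        using x closed[OF x] by (simp add: M(1) N(1) finite_subset)
    qed
  next
    fix x y assume x: "x \<in> carrier ?M" and y: "y \<in> carrier ?M"
    show "?\<sigma> (x \<oplus>\<^bsub>?M\<^esub> y) = ?\<sigma> x \<oplus>\<^bsub>?N\<^esub> ?\<sigma> y"
    proof
      fix n
      show "?\<sigma> (x \<oplus>\<^bsub>?M\<^esub> y) n = (?\<sigma> x \<oplus>\<^bsub>?N\<^esub> ?\<sigma> y) n"
        using x y grp(3)[of 0] one[of 0] unfolding M(2) N(2)
        by (cases n) (simp_all add: \<sigma>0 \<sigma>Suc M(1) suspension_mult group.is_monoid monoid.l_one)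
    qed
  next
    fix r x assume "r \<in> carrier ?R" and x: "x \<in> carrier ?M"
    then have r: "r i \<in> carrier (sym_homology p C i)" "finite {i. r i \<noteq> \<one>\<^bsub>sym_homology p C i\<^esub>}" for i
      unfolding R by blast+
    have xc: "x n \<in> carrier (H\<Omega> n)" for n using x by (simp add: M)
    have xfin: "finite {n. x n \<noteq> \<one>\<^bsub>H\<Omega> n\<^esub>}" using x by (simp add: M)
    show "?\<sigma> (r \<odot>\<^bsub>?M\<^esub> x) = r \<odot>\<^bsub>?N\<^esub> ?\<sigma> x"
    proof
      fix N
      interpret HX: comm_group "HX N" by (rule comm_group_red_homology)
      let ?B = "{(i, n). r i \<noteq> \<one>\<^bsub>sym_homology p C i\<^esub> \<and> ?\<sigma> x n \<noteq> \<one>\<^bsub>HX n\<^esub> \<and> snd i + n = N}"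
      let ?g = "\<lambda>(i, n). circX i n (r i) (?\<sigma> x n)"
      show "?\<sigma> (r \<odot>\<^bsub>?M\<^esub> x) N = (r \<odot>\<^bsub>?N\<^esub> ?\<sigma> x) N"
      proof (cases N)
        \<comment> \<open>The suspension has trivial component in degree 0, so no pair of total
          degree 0 contributes on the right.\<close>
        case 0
        then have "?B = {}" using \<sigma>0[of x] by auto
        then have "(r \<odot>\<^bsub>?N\<^esub> ?\<sigma> x) N = \<one>\<^bsub>HX N\<^esub>"
          unfolding N(3) by (simp only: HX.finprod_empty)
        then show ?thesis by (simp add: 0 \<sigma>0)
      next
        case (Suc M')
        let ?A = "{(i, n). r i \<noteq> \<one>\<^bsub>sym_homology p C i\<^esub> \<and> x n \<noteq> \<one>\<^bsub>H\<Omega> n\<^esub> \<and> snd i + n = M'}"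
        \<comment> \<open>The pairs that survive suspension. Raising \<open>n\<close> by one turns
          them into \<open>?B\<close>; the discarded pairs have trivial terms by
          \<open>circX_one\<close>.\<close>
        let ?A' = "{(i, n) \<in> ?A. \<sigma> n (x n) \<noteq> \<one>\<^bsub>HX (Suc n)\<^esub>}"
        let ?h = "\<lambda>(i, n). circX i (Suc n) (r i) (\<sigma> n (x n))"
        have "?A \<subseteq> {i. r i \<noteq> \<one>\<^bsub>sym_homology p C i\<^esub>} \<times> {n. x n \<noteq> \<one>\<^bsub>H\<Omega> n\<^esub>}" by auto
        then have fin: "finite ?A" using r(2) xfin by (rule finite_subset[OF _ finite_cartesian_product])
        have hc: "?h \<in> ?A \<rightarrow> carrier (HX N)"
          using circX_closed[OF r(1) suspension_closed[OF xc]] by (fastforce simp: Suc)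
        have B: "?B = (\<lambda>(i, n). (i, Suc n)) ` ?A'"
        proof (intro subset_antisym subsetI)
          fix z assume "z \<in> ?B"
          then obtain i n' where z: "z = (i, n')" "r i \<noteq> \<one>\<^bsub>sym_homology p C i\<^esub>"
            "?\<sigma> x n' \<noteq> \<one>\<^bsub>HX n'\<^esub>" "snd i + n' = N" by blast
          then obtain n where n: "n' = Suc n" using \<sigma>0 by (cases n') auto
          have "(i, n) \<in> ?A'" using z suspension_one[of n] by (auto simp: n \<sigma>Suc Suc)
          then show "z \<in> (\<lambda>(i, n). (i, Suc n)) ` ?A'" using z(1) n by (auto intro!: image_eqI[of _ _ "(i, n)"])
        next
          fix z assume "z \<in> (\<lambda>(i, n). (i, Suc n)) ` ?A'"
          then obtain w where w: "z = (\<lambda>(i, n). (i, Suc n)) w" "w \<in> ?A'" by (rule imageE)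
          obtain i n where "w = (i, n)" by (cases w)
          with w have "z = (i, Suc n)" "(i, n) \<in> ?A'" by simp_all
          then show "z \<in> ?B" by (simp add: \<sigma>Suc Suc)
        qed
        have "?\<sigma> (r \<odot>\<^bsub>?M\<^esub> x) N = \<sigma> M' (finprod (H\<Omega> M') (\<lambda>(i, n). circ\<Omega> i n (r i) (x n)) ?A)"
          by (simp only: Suc \<sigma>Suc M(3))
        also have "\<dots> = finprod (HX N) (\<lambda>z. \<sigma> M' ((\<lambda>(i, n). circ\<Omega> i n (r i) (x n)) z)) ?A"
          unfolding Suc
        proof (rule finprod_hom[OF comm_group_red_homology comm_group_red_homology suspension_closed suspension_mult fin])
          show "(\<lambda>(i, n). circ\<Omega> i n (r i) (x n)) \<in> ?A \<rightarrow> carrier (H\<Omega> M')"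
            using circ\<Omega>_closed[OF r(1) xc] by fastforce
        qed
        also have "\<dots> = finprod (HX N) ?h ?A"
        proof (rule HX.finprod_cong'[OF refl hc])
          fix z assume "z \<in> ?A"
          moreover obtain i n where "z = (i, n)" by (cases z)
          ultimately have z: "z = (i, n)" "M' = snd i + n" by simp_all
          show "\<sigma> M' ((\<lambda>(i, n). circ\<Omega> i n (r i) (x n)) z) = ?h z"
            unfolding z prod.case by (rule suspension_circ[OF r(1) xc])
        qed
        also have "\<dots> = finprod (HX N) ?h ?A'"
        proof (rule HX.finprod_mono_neutral_cong_right[OF fin _ _ _ hc])
          fix z assume "z \<in> ?A - ?A'"
          then obtain i n where "z = (i, n)" "\<sigma> n (x n) = \<one>\<^bsub>HX (Suc n)\<^esub>" "snd i + Suc n = N"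
            by (auto simp: Suc)
          then show "?h z = \<one>\<^bsub>HX N\<^esub>" using circX_one[OF r(1)[of i], of "Suc n"] by simp
        qed auto
        also have "\<dots> = finprod (HX N) (\<lambda>z. ?g ((\<lambda>(i, n). (i, Suc n)) z)) ?A'"
          by (simp only: case_prod_unfold fst_conv snd_conv \<sigma>Suc)
        also have "\<dots> = finprod (HX N) ?g ?B"
          unfolding B
        proof (rule HX.finprod_reindex[symmetric])
          show "?g \<in> (\<lambda>(i, n). (i, Suc n)) ` ?A' \<rightarrow> carrier (HX N)"
            using circX_closed[OF r(1) suspension_closed[OF xc]] by (fastforce simp: \<sigma>Suc Suc)
          show "inj_on (\<lambda>(i, n). (i, Suc n)) ?A'" by (auto simp: inj_on_def)
        qed
        finally show ?thesis by (simp only: N(3))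
      qed
    qed
  qed
qed

end

theorem theorem69:
  fixes p :: nat
    and C :: "'c operad"
    and X :: "'x topology"
    and \<theta> :: "nat \<Rightarrow> 'c \<Rightarrow> (nat \<Rightarrow> 'x) \<Rightarrow> 'x"
  assumes "prime p"
    and "E_infinity_operad TYPE('z) C"
    and "operad_algebra C X \<theta>"
  shows "module_map (sym_homology_ring p C)
           (red_homology_module p C (loop_space X (algebra_basepoint C \<theta>)) (loop_action \<theta>))
           (red_homology_module p C X \<theta>)
           (total_hom_suspension p X (algebra_basepoint C \<theta>))"
proof (rule suspension_module_map)
  show "is_operad C" using assms(2) by (simp add: E_infinity_operad_def)
qed (rule assms(3))

end
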